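(* Let $G$ be a valued abelian group with valuation $v:G\to\Gamma$ and infinite value set $\Gamma$. Then $G$ is minimal (as a valued group) if and only if the following hold: $\Gamma$ with its induced $\mathcal L_v$-structure is minimal and has order type $\omega^*$; the map $v$ has finite fibres; and either $G$ is elementary abelian, or, for some prime $p$, $G$ is a finite product of Prüfer $p$-groups and $f_p$ is eventually a well-defined $\mathcal L_v$-isomorphism acting by right shift.
   Context: A valued abelian group is an abelian group $G$ together with a surjective map $v:G\to\Gamma$, where $\Gamma$ is a linearly ordered set with maximum $\infty$, such that (1) $v(x)=\infty$ iff $x=0$, and (2) $v(x-y)\ge\min\{v(x),v(y)\}$. It is viewed as a structure with group sort $G$ and value sort $\Gamma$ in the language $\mathcal L_{vg}=\{+,0,v,\le,\infty\}$. It is minimal if $G$ is infinite and every subset of $G$ definable with parameters in this structure is finite or co-finite in $G$. In general an infinite first-order structure is minimal if every subset of it definable with parameters is finite or co-finite. $\omega^*$ denotes the reverse order of $\omega$. For $\gamma\in\Gamma\setminus\{\infty\}$ put $\bar B(\gamma)=\{x\in G:v(x)\ge\gamma\}$ and $B^o(\gamma)=\{x\in G:v(x)>\gamma\}$; these are subgroups of $G$. For $m\ge1$, $R_m$ is the unary relation on $\Gamma$ given by $R_m(\gamma)\Leftrightarrow|\bar B(\gamma)/B^o(\gamma)|>m$. For $n\ge 1$, the function $f_n:\Gamma\to\Gamma$ is given by $f_n(v(x))=v(nx)$ wherever this is well-defined, and takes the value $\infty$ at those $\gamma$ where it is not well-defined. $\mathcal L_v=\{\le,R_n,f_n:n\ge1\}$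 is the resulting language on $\Gamma$. "$f_p$ is eventually a well-defined $\mathcal L_v$-isomorphism acting by right shift" means: outside a finite set (i.e. on an initial segment of $\Gamma$ with finite complement) $f_p$ is well-defined, is given by $\gamma\mapsto$ the $\ell$-th successor of $\gamma$ in $\Gamma$ for some fixed $\ell$, and is an isomorphism onto its image for the $\mathcal L_v$-structure (in particular $R_m(\gamma)\Leftrightarrow R_m(f_p(\gamma))$ for all $m$). *)

theory Defs
  imports Complex_Main "HOL-Library.FuncSet" "HOL-Computational_Algebra.Primes"
begin

section \<open>Valued abelian groups\<close>

text \<open>The element \<open>\<infinity>\<close> of the value set is \<^term>\<open>top\<close>.\<close>

locale valued_abelian_group =
  fixes v :: "'a::ab_group_add \<Rightarrow> 'g::{linorder, order_top}"
  assumes surj_v: "surj v"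
    and v_eq_top_iff: "\<And>x. v x = top \<longleftrightarrow> x = 0"
    and v_diff: "\<And>x y. v (x - y) \<ge> min (v x) (v y)"

definition nmul :: "nat \<Rightarrow> 'a::ab_group_add \<Rightarrow> 'a" where
  "nmul n x = ((+) x ^^ n) 0"

definition closed_ball :: "('a::ab_group_add \<Rightarrow> 'g::{linorder, order_top}) \<Rightarrow> 'g \<Rightarrow> 'a set" where
  "closed_ball v \<gamma> = {x. v x \<ge> \<gamma>}"

definition open_ball :: "('a::ab_group_add \<Rightarrow> 'g::{linorder, order_top}) \<Rightarrow> 'g \<Rightarrow> 'a set" where
  "open_ball v \<gamma> = {x. v x > \<gamma>}"

definition ball_quotient ::
    "('a::ab_group_add \<Rightarrow> 'g::{linorder, order_top}) \<Rightarrow> 'g \<Rightarrow> 'a set set" where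
  "ball_quotient v \<gamma> =
     closed_ball v \<gamma> //
       {(x, y). x \<in> closed_ball v \<gamma> \<and> y \<in> closed_ball v \<gamma> \<and> x - y \<in> open_ball v \<gamma>}"


section \<open>The induced structure on the value set\<close>

text \<open>An infinite quotient has more than \<open>m\<close> elements for every \<open>m\<close>, whereas
  \<^const>\<open>card\<close> of an infinite set is \<open>0\<close>. The open ball at \<open>\<infinity>\<close> is empty, hence not a
  subgroup, and the relation is taken to be false there.\<close>

definition R_rel :: "('a::ab_group_add \<Rightarrow> 'g::{linorder, order_top}) \<Rightarrow> nat \<Rightarrow> 'g \<Rightarrow> bool" where
  "R_rel v m \<gamma> \<longleftrightarrow>
     \<gamma> \<noteq> top \<and> (infinite (ball_quotient v \<gamma>) \<or> card (ball_quotient v \<gamma>) > m)"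

definition f_defined_at ::
    "('a::ab_group_add \<Rightarrow> 'g::{linorder, order_top}) \<Rightarrow> nat \<Rightarrow> 'g \<Rightarrow> bool" where
  "f_defined_at v n \<gamma> \<longleftrightarrow> (\<exists>\<delta>. \<forall>x. v x = \<gamma> \<longrightarrow> v (nmul n x) = \<delta>)"

definition f_fun :: "('a::ab_group_add \<Rightarrow> 'g::{linorder, order_top}) \<Rightarrow> nat \<Rightarrow> 'g \<Rightarrow> 'g" where
  "f_fun v n \<gamma> =
     (if f_defined_at v n \<gamma> then (THE \<delta>. \<forall>x. v x = \<gamma> \<longrightarrow> v (nmul n x) = \<delta>) else top)"

lemma (in valued_abelian_group) f_fun_eq:
  assumes "f_defined_at v n (v x)"
  shows "f_fun v n (v x) = v (nmul n x)"
  using assms unfolding f_fun_def f_defined_at_def by (auto intro!: the_equality)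


section \<open>First-order definability and minimality\<close>

text \<open>Formulas use named variables. A set is definable with parameters if it is defined by some
  formula in the variable \<open>0\<close> (of the relevant sort) under some assignment, the values
  of the remaining free variables being the parameters.\<close>

definition minimal_wrt :: "('u set \<Rightarrow> bool) \<Rightarrow> bool" where
  "minimal_wrt definable \<longleftrightarrow>
     infinite (UNIV :: 'u set) \<and> (\<forall>A. definable A \<longrightarrow> finite A \<or> finite (- A))"

subsection \<open>The two-sorted language of valued groups\<close>

datatype group_term = GVar nat | GZero | GAdd group_term group_term

datatype value_term = VVar nat | VInfty | Val group_term

datatype vg_formula =
    GEq group_term group_term
  | VEq value_term value_term
  | VLe value_term value_term
  | VgNot vg_formula
  | VgAnd vg_formula vg_formula
  | ExG nat vg_formula
  | ExV nat vg_formula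

primrec eval_g :: "(nat \<Rightarrow> 'a::ab_group_add) \<Rightarrow> group_term \<Rightarrow> 'a" where
  "eval_g a (GVar i) = a i"
| "eval_g a GZero = 0"
| "eval_g a (GAdd s t) = eval_g a s + eval_g a t"

primrec eval_v ::
    "('a::ab_group_add \<Rightarrow> 'g::{linorder, order_top}) \<Rightarrow> (nat \<Rightarrow> 'a) \<Rightarrow> (nat \<Rightarrow> 'g)
      \<Rightarrow> value_term \<Rightarrow> 'g" where
  "eval_v v a b (VVar i) = b i"
| "eval_v v a b VInfty = top"
| "eval_v v a b (Val t) = v (eval_g a t)"

primrec sat_vg ::
    "('a::ab_group_add \<Rightarrow> 'g::{linorder, order_top}) \<Rightarrow> (nat \<Rightarrow> 'a) \<Rightarrow> (nat \<Rightarrow> 'g)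
      \<Rightarrow> vg_formula \<Rightarrow> bool" where
  "sat_vg v a b (GEq s t) \<longleftrightarrow> eval_g a s = eval_g a t"
| "sat_vg v a b (VEq s t) \<longleftrightarrow> eval_v v a b s = eval_v v a b t"
| "sat_vg v a b (VLe s t) \<longleftrightarrow> eval_v v a b s \<le> eval_v v a b t"
| "sat_vg v a b (VgNot \<phi>) \<longleftrightarrow> \<not> sat_vg v a b \<phi>"
| "sat_vg v a b (VgAnd \<phi> \<psi>) \<longleftrightarrow> sat_vg v a b \<phi> \<and> sat_vg v a b \<psi>"
| "sat_vg v a b (ExG i \<phi>) \<longleftrightarrow> (\<exists>x. sat_vg v (a(i := x)) b \<phi>)"
| "sat_vg v a b (ExV i \<phi>) \<longleftrightarrow> (\<exists>\<gamma>. sat_vg v a (b(i := \<gamma>)) \<phi>)"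

definition vg_definable ::
    "('a::ab_group_add \<Rightarrow> 'g::{linorder, order_top}) \<Rightarrow> 'a set \<Rightarrow> bool" where
  "vg_definable v A \<longleftrightarrow> (\<exists>\<phi> a b. A = {x. sat_vg v (a(0 := x)) b \<phi>})"

definition minimal_valued_group ::
    "('a::ab_group_add \<Rightarrow> 'g::{linorder, order_top}) \<Rightarrow> bool" where
  "minimal_valued_group v \<longleftrightarrow> minimal_wrt (vg_definable v)"

subsection \<open>The language of the value set\<close>

text \<open>The language has function and relation symbols with index \<open>n \<ge> 1\<close> only: \<open>LF k\<close> and
  \<open>LR k\<close> are the symbols with index \<open>k + 1\<close>.\<close>

datatype lv_term = LVar nat | LF nat lv_term

datatype lv_formula =
    LEq lv_term lv_term
  | LLe lv_term lv_term
  | LR nat lv_term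
  | LNot lv_formula
  | LAnd lv_formula lv_formula
  | LEx nat lv_formula

primrec eval_lv ::
    "('a::ab_group_add \<Rightarrow> 'g::{linorder, order_top}) \<Rightarrow> (nat \<Rightarrow> 'g) \<Rightarrow> lv_term \<Rightarrow> 'g" where
  "eval_lv v b (LVar i) = b i"
| "eval_lv v b (LF k t) = f_fun v (Suc k) (eval_lv v b t)"

primrec sat_lv ::
    "('a::ab_group_add \<Rightarrow> 'g::{linorder, order_top}) \<Rightarrow> (nat \<Rightarrow> 'g) \<Rightarrow> lv_formula \<Rightarrow> bool" where
  "sat_lv v b (LEq s t) \<longleftrightarrow> eval_lv v b s = eval_lv v b t"
| "sat_lv v b (LLe s t) \<longleftrightarrow> eval_lv v b s \<le> eval_lv v b t"
| "sat_lv v b (LR k t) \<longleftrightarrow> R_rel v (Suc k) (eval_lv v b t)"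
| "sat_lv v b (LNot \<phi>) \<longleftrightarrow> \<not> sat_lv v b \<phi>"
| "sat_lv v b (LAnd \<phi> \<psi>) \<longleftrightarrow> sat_lv v b \<phi> \<and> sat_lv v b \<psi>"
| "sat_lv v b (LEx i \<phi>) \<longleftrightarrow> (\<exists>\<gamma>. sat_lv v (b(i := \<gamma>)) \<phi>)"

definition lv_definable ::
    "('a::ab_group_add \<Rightarrow> 'g::{linorder, order_top}) \<Rightarrow> 'g set \<Rightarrow> bool" where
  "lv_definable v A \<longleftrightarrow> (\<exists>\<phi> b. A = {\<gamma>. sat_lv v (b(0 := \<gamma>)) \<phi>})"

definition minimal_value_set ::
    "('a::ab_group_add \<Rightarrow> 'g::{linorder, order_top}) \<Rightarrow> bool" where
  "minimal_value_set v \<longleftrightarrow> minimal_wrt (lv_definable v)"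


section \<open>The conditions on the order, the group and the functions\<close>

definition order_type_omega_star :: "'g::linorder itself \<Rightarrow> bool" where
  "order_type_omega_star (_ :: 'g itself) \<longleftrightarrow>
     (\<exists>h :: nat \<Rightarrow> 'g. bij h \<and> (\<forall>i j. h i \<le> h j \<longleftrightarrow> j \<le> i))"

definition elementary_abelian :: "'a::ab_group_add itself \<Rightarrow> bool" where
  "elementary_abelian (_ :: 'a itself) \<longleftrightarrow>
     (\<exists>q::nat. prime q \<and> (\<forall>x::'a. nmul q x = 0))"

text \<open>The Pruefer \<open>p\<close>-group, as the multiplicative group of complex roots of unity
  of \<open>p\<close>-power order.\<close>

definition pruefer :: "nat \<Rightarrow> complex set" where
  "pruefer p = {z. \<exists>k. z ^ (p ^ k) = 1}"

definition finite_product_of_pruefer :: "nat \<Rightarrow> 'a::ab_group_add itself \<Rightarrow> bool" where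
  "finite_product_of_pruefer p (_ :: 'a itself) \<longleftrightarrow>
     (\<exists>(n::nat) (\<phi> :: 'a \<Rightarrow> nat \<Rightarrow> complex).
        bij_betw \<phi> UNIV ({..<n} \<rightarrow>\<^sub>E pruefer p) \<and>
        (\<forall>x y. \<forall>i<n. \<phi> (x + y) i = \<phi> x i * \<phi> y i))"

definition is_successor :: "'g::linorder \<Rightarrow> 'g \<Rightarrow> bool" where
  "is_successor \<gamma> \<delta> \<longleftrightarrow> \<gamma> < \<delta> \<and> \<not> (\<exists>\<epsilon>. \<gamma> < \<epsilon> \<and> \<epsilon> < \<delta>)"

text \<open>A subset of the value set need not be closed under the functions of the language, so
  compatibility of an isomorphism between two subsets with these functions is compatibility with
  their graphs restricted to the subsets.\<close>

definition lv_iso_onto_image ::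
    "('a::ab_group_add \<Rightarrow> 'g::{linorder, order_top}) \<Rightarrow> 'g set \<Rightarrow> ('g \<Rightarrow> 'g) \<Rightarrow> bool" where
  "lv_iso_onto_image v I h \<longleftrightarrow>
     inj_on h I \<and>
     (\<forall>\<gamma>\<in>I. \<forall>\<delta>\<in>I. \<gamma> \<le> \<delta> \<longleftrightarrow> h \<gamma> \<le> h \<delta>) \<and>
     (\<forall>m\<ge>1. \<forall>\<gamma>\<in>I. R_rel v m \<gamma> \<longleftrightarrow> R_rel v m (h \<gamma>)) \<and>
     (\<forall>n\<ge>1. \<forall>\<gamma>\<in>I. \<forall>\<delta>\<in>I. f_fun v n \<gamma> = \<delta> \<longleftrightarrow> f_fun v n (h \<gamma>) = h \<delta>)"

definition eventually_right_shift_iso ::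
    "('a::ab_group_add \<Rightarrow> 'g::{linorder, order_top}) \<Rightarrow> nat \<Rightarrow> bool" where
  "eventually_right_shift_iso v p \<longleftrightarrow>
     (\<exists>I. (\<forall>\<gamma>\<in>I. \<forall>\<delta>\<le>\<gamma>. \<delta> \<in> I) \<and> finite (- I) \<and>
        (\<forall>\<gamma>\<in>I. f_defined_at v p \<gamma>) \<and>
        (\<exists>l\<ge>1. \<forall>\<gamma>\<in>I. (is_successor ^^ l) \<gamma> (f_fun v p \<gamma>)) \<and>
        lv_iso_onto_image v I (f_fun v p))"

end

theory Submission
  imports Defs "HOL-Library.Countable_Set"
begin

text \<open>
  \<^bold>\<open>From minimality to the conditions.\<close> A definable subgroup of a minimal group is finite or everything.
  Applied to balls this gives the order type and the finite fibres; applied to the kernel and the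
  image of multiplication by \<open>n\<close> it shows that \<open>G\<close> is elementary abelian or divisible of finite
  ranks. If \<open>G[p] \<noteq> 0\<close> in the latter case, then \<open>v (p x) > v x\<close> for infinitely many, hence almost all
  \<open>x\<close>; this cannot happen for two primes. A definable set that meets infinitely many fibres of \<open>v\<close>
  contains almost all of them, which makes \<open>f\<^sub>p\<close> eventually well defined and strictly increasing.

  \<^bold>\<open>From the conditions to minimality.\<close> Number the values by levels, so that level \<open>0\<close> is \<open>\<infinity>\<close>.
  We compare sequences in \<open>G\<close> along a free ultrafilter, that is, elements of an ultrapower. A back
  and forth argument runs on countable divisible groups of pairs of sequences that preserve all
  inequalities between levels up to integer shifts. Given a new sequence \<open>u\<close>, approximate it by a
  closest \<open>a\<close> among finitely many old ones; only the position of the level of \<open>u - a\<close> and the fact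
  that its residue class is new have to be copied, and the sizes of the residue groups allow this
  because they converge in \<open>\<nat> \<union> {\<infinity>}\<close>. Saturation removes the finiteness restriction. All sequences
  whose levels tend to infinity have the same type over \<open>G\<close>, so no definable set can be infinite
  and coinfinite.
\<close>


section \<open>Integer multiples and valuations\<close>

lemma nmul_0 [simp]: "nmul 0 x = 0"
  by (simp add: nmul_def)

lemma nmul_Suc: "nmul (Suc n) x = x + nmul n x"
  by (simp add: nmul_def)

lemma nmul_1 [simp]: "nmul (Suc 0) x = x"
  by (simp add: nmul_Suc)

lemma nmul_add_left: "nmul (m + n) x = nmul m x + nmul n x"
  by (induction m) (simp_all add: nmul_Suc algebra_simps)

lemma nmul_add_right: "nmul n (x + y) = nmul n x + nmul n y"
  by (induction n) (simp_all add: nmul_Suc algebra_simps)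

lemma nmul_zero_right [simp]: "nmul n 0 = 0"
  by (induction n) (simp_all add: nmul_Suc)

lemma nmul_mult: "nmul (m * n) x = nmul m (nmul n x)"
  by (induction m) (simp_all add: nmul_Suc nmul_add_left)

lemma nmul_uminus: "nmul n (- x) = - nmul n x"
  by (induction n) (simp_all add: nmul_Suc)

lemma nmul_diff: "nmul n (x - y) = nmul n x - nmul n y"
  using nmul_add_right[of n x "- y"] by (simp add: nmul_uminus)

text \<open>At most one of \<open>nat c\<close> and \<open>nat (- c)\<close> is nonzero, so the sign
  of c needs no case distinction. Integer multiples make Bezout identities applicable.\<close>

definition zmul :: "int \<Rightarrow> 'a::ab_group_add \<Rightarrow> 'a" where
  "zmul c x = nmul (nat c) x - nmul (nat (- c)) x"

lemma zmul_diff_int: "zmul (int m - int n) x = nmul m x - nmul n x"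
proof (cases "n \<le> m")
  case True
  then obtain d where "m = n + d" using le_Suc_ex by blast
  then show ?thesis by (simp add: zmul_def nmul_add_left)
next
  case False
  then obtain d where "n = m + d" using le_Suc_ex nat_le_linear by blast
  then show ?thesis by (simp add: zmul_def nmul_add_left)
qed

lemma zmul_int: "zmul (int n) x = nmul n x"
  using zmul_diff_int[of n 0 x] by simp

interpretation zmul: module zmul
proof
  fix c d :: int and x y :: 'a
  obtain m n where c: "c = int m - int n" by (rule int_diff_cases)
  obtain k l where d: "d = int k - int l" by (rule int_diff_cases)
  show "zmul c (x + y) = zmul c x + zmul c y"
    unfolding c zmul_diff_int by (simp add: nmul_add_right)
  have "c + d = int (m + k) - int (n + l)" by (simp add: c d)
  then have "zmul (c + d) x = nmul (m + k) x - nmul (n + l) x" by (simp only: zmul_diff_int)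
  then show "zmul (c + d) x = zmul c x + zmul d x"
    by (simp add: c d zmul_diff_int nmul_add_left)
  have "c * d = int (m * k + n * l) - int (m * l + n * k)" by (simp add: c d algebra_simps)
  then have "zmul (c * d) x = nmul (m * k + n * l) x - nmul (m * l + n * k) x"
    by (simp only: zmul_diff_int)
  then show "zmul c (zmul d x) = zmul (c * d) x"
    by (simp add: c d zmul_diff_int nmul_add_left nmul_mult nmul_diff)
  show "zmul 1 x = x" using zmul_int[of 1 x] by simp
qed

lemma zmul_eq_0_dvd:
  assumes "zmul a x = 0" "a dvd b"
  shows "zmul b x = 0"
proof -
  obtain k where "b = a * k" using assms(2) by (rule dvdE)
  then have "zmul b x = zmul k (zmul a x)" by (simp add: mult.commute)
  then show ?thesis using assms(1) by (simp only: zmul.scale_zero_right)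
qed

context valued_abelian_group begin

lemma v_zero [simp]: "v 0 = top"
  using v_eq_top_iff by blast

lemma v_uminus [simp]: "v (- x) = v x"
proof -
  have le: "v y \<le> v (- y)" for y using v_diff[of 0 y] by simp
  show ?thesis using le[of x] le[of "- x"] by simp
qed

lemma v_add: "min (v x) (v y) \<le> v (x + y)"
  using v_diff[of x "- y"] by simp

lemma v_diff_commute: "v (x - y) = v (y - x)"
  using v_uminus[of "x - y"] by simp

lemma v_nmul: "v x \<le> v (nmul n x)"
proof (induction n)
  case (Suc n)
  then show ?case using v_add[of x "nmul n x"] by (simp add: nmul_Suc)
qed simp

lemma v_zmul: "v x \<le> v (zmul c x)"
  using v_diff[of "nmul (nat c) x" "nmul (nat (- c)) x"] v_nmul[of x "nat c"] v_nmul[of x "nat (- c)"]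
  unfolding zmul_def by (metis (no_types, lifting) min_def order_trans)

text \<open>One representative from each class turns a large quotient into m + 1 elements of the
  closed ball whose differences avoid the open ball, hence have value exactly \<gamma>. No quotient
  remains, so the condition can be expressed by a formula and carried along group maps.\<close>

lemma R_rel_iff:
  "R_rel v m \<gamma> \<longleftrightarrow> \<gamma> \<noteq> top \<and>
     (\<exists>X. finite X \<and> card X = Suc m \<and> (\<forall>x\<in>X. \<gamma> \<le> v x) \<and>
        (\<forall>x\<in>X. \<forall>y\<in>X. x \<noteq> y \<longrightarrow> v (x - y) = \<gamma>))" (is "_ \<longleftrightarrow> _ \<and> ?ex")
proof (cases "\<gamma> = top")
  case False
  define r where "r = {(x, y). x \<in> closed_ball v \<gamma> \<and> y \<in> closed_ball v \<gamma> \<and> x - y \<in> open_ball v \<gamma>}"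
  have eq: "equiv (closed_ball v \<gamma>) r"
  proof (rule equivI)
    show "r \<subseteq> closed_ball v \<gamma> \<times> closed_ball v \<gamma>" by (auto simp: r_def)
    show "refl_on (closed_ball v \<gamma>) r"
      using False by (auto simp: r_def refl_on_def open_ball_def top.not_eq_extremum)
    show "sym r" by (auto simp: r_def sym_def open_ball_def v_diff_commute)
    show "trans r"
    proof (rule transI)
      fix x y z assume "(x, y) \<in> r" "(y, z) \<in> r"
      then show "(x, z) \<in> r"
        using less_le_trans[OF _ v_add[of "x - y" "y - z"]] by (auto simp: r_def open_ball_def)
    qed
  qed
  have Q: "ball_quotient v \<gamma> = closed_ball v \<gamma> // r" by (simp add: ball_quotient_def r_def)
  have "(infinite (ball_quotient v \<gamma>) \<or> card (ball_quotient v \<gamma>) > m) \<longleftrightarrow>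
      (\<exists>C. C \<subseteq> ball_quotient v \<gamma> \<and> finite C \<and> card C = Suc m)"
    by (metis Suc_le_eq card_mono infinite_arbitrarily_large obtain_subset_with_card_n)
  also have "\<dots> \<longleftrightarrow> ?ex"
  proof
    assume "\<exists>C. C \<subseteq> ball_quotient v \<gamma> \<and> finite C \<and> card C = Suc m"
    then obtain C where C: "C \<subseteq> closed_ball v \<gamma> // r" "finite C" "card C = Suc m" using Q by auto
    define s where "s = (\<lambda>c::'a set. SOME x. x \<in> c)"
    have s: "s c \<in> c" if "c \<in> C" for c
      using in_quotient_imp_non_empty[OF eq] C(1) that unfolding s_def
      by (metis ex_in_conv someI_ex subsetD)
    have sr: "(s c, s c') \<notin> r" if "c \<in> C" "c' \<in> C" "c \<noteq> c'" for c c'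
      using quotient_eqI[OF eq, of c c' "s c" "s c'"] that s C(1) by blast
    have inb: "s c \<in> closed_ball v \<gamma>" if "c \<in> C" for c
      using that s C(1) in_quotient_imp_subset[OF eq] by blast
    have inj: "inj_on s C"
      by (rule inj_onI) (metis sr inb equivE eq refl_onD)
    have "v (x - y) = \<gamma>" if xy: "x \<in> s ` C" "y \<in> s ` C" "x \<noteq> y" for x y
    proof -
      have "(x, y) \<notin> r" "\<gamma> \<le> v x" "\<gamma> \<le> v y" using xy sr inb by (auto simp: closed_ball_def)
      then have "\<not> v (x - y) > \<gamma>" by (auto simp: r_def closed_ball_def open_ball_def)
      moreover have "\<gamma> \<le> v (x - y)"
        using \<open>\<gamma> \<le> v x\<close> \<open>\<gamma> \<le> v y\<close> v_diff[of x y] by (meson min.boundedI order_trans)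
      ultimately show ?thesis by simp
    qed
    then show ?ex
      using C inj inb by (intro exI[of _ "s ` C"]) (auto simp: card_image closed_ball_def)
  next
    assume ?ex
    then obtain X where X: "finite X" "card X = Suc m" "\<And>x. x \<in> X \<Longrightarrow> \<gamma> \<le> v x"
      "\<And>x y. x \<in> X \<Longrightarrow> y \<in> X \<Longrightarrow> x \<noteq> y \<Longrightarrow> v (x - y) = \<gamma>" by blast
    have inj: "inj_on (\<lambda>x. r `` {x}) X"
    proof (rule inj_onI, rule ccontr)
      fix x y assume xy: "x \<in> X" "y \<in> X" "r `` {x} = r `` {y}" "x \<noteq> y"
      then have "(x, y) \<in> r"
        using eq_equiv_class[OF xy(3) eq] X(3) by (auto simp: closed_ball_def)
      then show False using X(4)[OF xy(1,2,4)] by (auto simp: r_def open_ball_def)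
    qed
    show "\<exists>C. C \<subseteq> ball_quotient v \<gamma> \<and> finite C \<and> card C = Suc m"
      using X inj unfolding Q
      by (intro exI[of _ "(\<lambda>x. r `` {x}) ` X"]) (auto simp: card_image closed_ball_def intro: quotientI)
  qed
  finally show ?thesis using False by (simp add: R_rel_def)
qed (simp add: R_rel_def)

end

section \<open>Finite products of Pruefer groups\<close>

lemma cis_eq_iff_Ints: "cis (2 * pi * a) = cis (2 * pi * b) \<longleftrightarrow> a - b \<in> \<int>"
proof -
  have "cis (2 * pi * a) = cis (2 * pi * b) \<longleftrightarrow> cis (2 * pi * a) / cis (2 * pi * b) = 1"
    by simp
  also have "\<dots> \<longleftrightarrow> cis (2 * pi * (a - b)) = 1"
    by (simp add: cis_divide algebra_simps)
  also have "\<dots> \<longleftrightarrow> cos (2 * pi * (a - b)) = 1"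
    by (auto simp: complex_eq_iff cos_one_sin_zero)
  also have "\<dots> \<longleftrightarrow> (\<exists>m::int. (2 * pi) * (a - b) = (2 * pi) * of_int m)"
    by (simp only: cos_one_2pi_int mult.commute[of _ "2 * pi"] mult.assoc mult.left_commute)
  also have "\<dots> \<longleftrightarrow> a - b \<in> \<int>"
    by (auto simp only: mult_cancel_left Ints_def) auto
  finally show ?thesis .
qed

text \<open>A maximal family independent modulo p in the finite kernel of p is a basis of that
  kernel. Repeated division turns each basis element into a copy of the Pruefer group; a coefficient
  c at stage k becomes the root of unity of angle c / p^k.\<close>

lemma finite_product_of_prueferI:
  assumes p: "prime p"
    and tors: "\<And>x::'a::ab_group_add. \<exists>k. nmul (p ^ k) x = 0"
    and divis: "\<And>x::'a. \<exists>y. nmul p y = x"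
    and fin: "finite {x::'a. nmul p x = 0}"
  shows "finite_product_of_pruefer p TYPE('a)"
proof -
  define P where "P = int p"
  have pP: "prime P" using p by (simp add: P_def)
  then have P1: "P > 1" by (rule prime_gt_1_int)
  have nP: "zmul P x = nmul p x" "zmul (P ^ k) x = nmul (p ^ k) x" for k and x :: 'a
    using zmul_int[of p x] zmul_int[of "p ^ k" x] by (simp_all add: P_def)
  define indep where "indep n e \<longleftrightarrow> (\<forall>i<n. zmul P (e i) = 0) \<and>
      (\<forall>c. (\<Sum>i<n. zmul (c i) (e i)) = 0 \<longrightarrow> (\<forall>i<n. P dvd c i))" for n and e :: "nat \<Rightarrow> 'a"
  have bound: "n \<le> card {x::'a. nmul p x = 0}" if "indep n e" for n e
  proof -
    have "inj_on e {..<n}"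
    proof (rule inj_onI, rule ccontr)
      fix i j assume ij: "i \<in> {..<n}" "j \<in> {..<n}" "e i = e j" "i \<noteq> j"
      \<comment> \<open>The coefficients of \<open>e i - e j\<close>: a repetition in the family
        would be a relation with coefficient 1.\<close>
      define c where "c k = (if k = i then 1 else if k = j then - 1 else 0 :: int)" for k
      have "(\<Sum>k<n. zmul (c k) (e k)) = (\<Sum>k\<in>{i, j}. zmul (c k) (e k))"
        using ij by (intro sum.mono_neutral_right) (auto simp: c_def)
      also have "\<dots> = 0" using ij by (simp add: c_def)
      finally have "\<forall>i<n. P dvd c i" using conjunct2[OF that[unfolded indep_def]] by simp
      then have "P dvd c i" using ij(1) by simp
      then show False using P1 by (simp add: c_def)
    qed
    moreover have "e ` {..<n} \<subseteq> {x. nmul p x = 0}"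
      using conjunct1[OF that[unfolded indep_def]] by (auto simp: nP)
    ultimately show ?thesis using card_inj_on_le[OF _ _ fin, of e "{..<n}"] by simp
  qed
  have "indep 0 (\<lambda>_. 0)" by (simp add: indep_def)
  then have "\<exists>n. (\<exists>e. indep n e) \<and> (\<forall>m. (\<exists>e. indep m e) \<longrightarrow> m \<le> n)"
    by (intro ex_has_greatest_nat[where b = "Suc (card {x::'a. nmul p x = 0})"])
      (auto dest: bound simp: less_Suc_eq_le)
  then obtain n e where e: "indep n e" and max': "\<forall>m. (\<exists>e. indep m e) \<longrightarrow> m \<le> n" by (elim exE conjE)
  have max: "m \<le> n" if "indep m e" for m e using max' that by blast
  have span: "\<exists>c. x = (\<Sum>i<n. zmul (c i) (e i))" if x: "zmul P x = 0" for x
  proof -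
    define e' where "e' = e(n := x)"
    have "\<not> indep (Suc n) e'" using max[of "Suc n" e'] by (metis Suc_n_not_le_n)
    moreover have "\<forall>i<Suc n. zmul P (e' i) = 0"
      using conjunct1[OF e[unfolded indep_def]] x by (simp add: e'_def less_Suc_eq)
    ultimately obtain c i where c: "(\<Sum>i<Suc n. zmul (c i) (e' i)) = 0" "i < Suc n" "\<not> P dvd c i"
      unfolding indep_def by blast
    have "(\<Sum>i<n. zmul (c i) (e' i)) = (\<Sum>i<n. zmul (c i) (e i))"
      by (rule sum.cong) (simp_all add: e'_def)
    then have c': "(\<Sum>i<n. zmul (c i) (e i)) + zmul (c n) x = 0" using c(1) by (simp add: e'_def)
    have "\<not> P dvd c n"
    proof (rule notI)
      assume d: "P dvd c n"
      then have "zmul (c n) x = 0" using x zmul_eq_0_dvd by blast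
      then have "\<forall>i<n. P dvd c i" using c' conjunct2[OF e[unfolded indep_def]] by simp
      then show False using c(2,3) d by (auto simp: less_Suc_eq)
    qed
    \<comment> \<open>The coefficient of \<open>x\<close> is invertible modulo p, so the relation
      can be solved for \<open>x\<close>.\<close>
    then have "coprime P (c n)" using pP by (simp add: prime_imp_coprime)
    then obtain u w where uw: "u * P + w * c n = 1" by (metis bezout_int coprime_imp_gcd_eq_1)
    have "x = zmul (u * P + w * c n) x" by (simp add: uw)
    also have "\<dots> = zmul u (zmul P x) + zmul w (zmul (c n) x)"
      by (simp only: zmul.scale_left_distrib zmul.scale_scale)
    also have "\<dots> = zmul w (zmul (c n) x)"
      by (simp only: x zmul.scale_zero_right add_0_left)
    also have "zmul (c n) x = - (\<Sum>i<n. zmul (c i) (e i))"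
      using c' by (simp add: eq_neg_iff_add_eq_0 add.commute)
    also have "zmul w (- (\<Sum>i<n. zmul (c i) (e i))) = (\<Sum>i<n. zmul (- w * c i) (e i))"
      by (simp add: zmul.scale_sum_right sum_negf)
    finally show ?thesis by (rule exI[where x = "\<lambda>i. - w * c i"])
  qed
  \<comment> \<open>\<open>e\<close> is a basis of \<open>G[p]\<close>; continuing it by successive division by \<open>p\<close> gives elements \<open>g k i\<close>
    that generate \<open>G[p\<^sup>k]\<close> freely over \<open>\<int>/p\<^sup>k\<close>.\<close>
  define d where "d x = (SOME y. zmul P y = x)" for x :: 'a
  have d: "zmul P (d x) = x" for x
    unfolding d_def using divis[of x] by (intro someI_ex[of "\<lambda>y. zmul P y = x"]) (simp add: nP)
  \<comment> \<open>The index is shifted by one: \<open>g k i\<close> is annihilated by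
    \<open>P ^ k\<close>, and the value 0 at \<open>k = 0\<close> makes the recursion
    \<open>gS\<close> hold there as well.\<close>
  define g where "g k i = (case k of 0 \<Rightarrow> 0 | Suc j \<Rightarrow> (d ^^ j) (e i))" for k i
  have g0: "g 0 i = 0" and g1: "g (Suc 0) i = e i" for i by (simp_all add: g_def)
  have gS: "zmul P (g (Suc k) i) = g k i" if "i < n" for k i
    using conjunct1[OF e[unfolded indep_def]] d that by (cases k) (simp_all add: g_def)
  have gpow: "zmul (P ^ j) (g (j + k) i) = g k i" if "i < n" for i j k
  proof (induction j)
    case (Suc j)
    have "zmul (P ^ Suc j) (g (Suc j + k) i) = zmul (P ^ j) (zmul P (g (Suc (j + k)) i))"
      by (simp add: mult.commute)
    then show ?case using Suc gS[OF that] by simp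
  qed simp
  define S where "S k c = (\<Sum>i<n. zmul (c i) (g k i))" for k c
  have S_diff: "S k (\<lambda>i. c i - c' i) = S k c - S k c'" for k c c'
    by (simp add: S_def zmul.scale_left_diff_distrib sum_subtractf)
  have S_add: "S k (\<lambda>i. c i + c' i) = S k c + S k c'" for k c c'
    by (simp add: S_def zmul.scale_left_distrib sum.distrib)
  have S_scale: "zmul b (S k c) = S k (\<lambda>i. b * c i)" for b k c
    by (simp add: S_def zmul.scale_sum_right)
  \<comment> \<open>The index of a presentation can be raised at will; this brings any two elements
    to a common index.\<close>
  have S_lift: "S (j + k) (\<lambda>i. P ^ j * c i) = S k c" for j k c
    unfolding S_def
  proof (intro sum.cong refl)
    fix i assume "i \<in> {..<n}"
    then have "zmul (P ^ j) (g (j + k) i) = g k i" using gpow by simp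
    moreover have "zmul (P ^ j * c i) (g (j + k) i) = zmul (c i) (zmul (P ^ j) (g (j + k) i))"
      by (simp add: mult.commute)
    ultimately show "zmul (P ^ j * c i) (g (j + k) i) = zmul (c i) (g k i)" by (simp only:)
  qed
  \<comment> \<open>Multiplying by \<open>P ^ k\<close> leaves a relation among the
    \<open>e i\<close>, so P divides every coefficient; one factor P is then cancelled by
    \<open>S_lift\<close>.\<close>
  have S_eq0: "\<forall>i<n. P ^ k dvd c i" if "S k c = 0" for k c
    using that
  proof (induction k arbitrary: c)
    case (Suc k)
    have "0 = zmul (P ^ k) (S (Suc k) c)" using Suc.prems by simp
    also have "\<dots> = S (k + Suc 0) (\<lambda>i. P ^ k * c i)" by (simp add: S_scale)
    also have "\<dots> = (\<Sum>i<n. zmul (c i) (e i))" by (simp only: S_lift) (simp add: S_def g1)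
    finally have pc: "\<forall>i<n. P dvd c i" using conjunct2[OF e[unfolded indep_def]] by simp
    have "0 = S (Suc 0 + k) (\<lambda>i. P ^ Suc 0 * (c i div P))"
      using Suc.prems pc by (simp add: S_def)
    then have "S k (\<lambda>i. c i div P) = 0" by (simp only: S_lift)
    then show ?case using Suc.IH pc by (metis dvd_div_iff_mult mult.commute power_Suc P1 not_one_less_zero)
  qed simp
  have S_kill: "S k c = 0" if "\<forall>i<n. P ^ k dvd c i" for k c
    unfolding S_def
  proof (intro sum.neutral ballI)
    fix i assume i: "i \<in> {..<n}"
    then show "zmul (c i) (g k i) = 0"
      using gpow[of i k 0] g0 that by (auto intro: zmul_eq_0_dvd[of "P ^ k"])
  qed
  have S_ex: "\<exists>c. x = S k c" if "zmul (P ^ k) x = 0" for k x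
    using that
  proof (induction k arbitrary: x)
    case 0
    then show ?case by (auto simp: S_def g0)
  next
    case (Suc k)
    then have "zmul (P ^ k) (zmul P x) = 0" by (simp add: mult.commute)
    then obtain c where c: "zmul P x = S k c" using Suc.IH by blast
    have "S k c = zmul P (S (Suc k) c)" using S_lift[of "Suc 0" k c] by (simp add: S_scale)
    then have "zmul P (x - S (Suc k) c) = 0" using c by (simp add: zmul.scale_right_diff_distrib)
    from span[OF this] obtain b where "x - S (Suc k) c = (\<Sum>i<n. zmul (b i) (e i))" by (elim exE)
    also have "\<dots> = S (k + Suc 0) (\<lambda>i. P ^ k * b i)" by (simp only: S_lift) (simp add: S_def g1)
    finally have "x = S (Suc k) (\<lambda>i. c i + P ^ k * b i)" by (simp add: S_add algebra_simps)
    then show ?case by blast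
  qed
  have "\<exists>k c. x = S k c" for x using tors[of x] S_ex nP by metis
  then obtain K C where KC: "\<And>x. x = S (K x) (C x)" by metis
  define ang where "ang k c i = (of_int (c i) / of_int (P ^ k) :: real)" for k c and i :: nat
  have ang_diff: "ang k (\<lambda>i. c i - c' i) i = ang k c i - ang k c' i" for k c c' i
    by (simp add: ang_def diff_divide_distrib)
  have ang_add: "ang k (\<lambda>i. c i + c' i) i = ang k c i + ang k c' i" for k c c' i
    by (simp add: ang_def add_divide_distrib)
  have ang_lift: "ang (j + k) (\<lambda>i. P ^ j * c i) i = ang k c i" for j k c i
    using P1 by (simp add: ang_def power_add)
  have ang_Ints: "ang k c i \<in> \<int> \<longleftrightarrow> P ^ k dvd c i" for k c i
    unfolding ang_def using P1 by (subst of_int_div_of_int_in_Ints_iff) auto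
  define \<phi> where "\<phi> x = (\<lambda>i\<in>{..<n}. cis (2 * pi * ang (K x) (C x) i))" for x
  \<comment> \<open>The chosen presentation is irrelevant: two presentations of one element, lifted
    to a common index, differ by a presentation of 0, so by \<open>S_eq0\<close> their angles differ
    by integers.\<close>
  have \<phi>: "\<phi> (S k c) i = cis (2 * pi * ang k c i)" if i: "i < n" for k c i
  proof -
    let ?x = "S k c"
    have "S (k + K ?x) (\<lambda>i. P ^ k * C ?x i - P ^ K ?x * c i) = S (K ?x) (C ?x) - S k c"
      using S_lift[of k "K ?x" "C ?x"] S_lift[of "K ?x" k c] by (simp add: S_diff add.commute)
    also have "\<dots> = 0" using KC[of ?x] by simp
    finally have "ang (k + K ?x) (\<lambda>i. P ^ k * C ?x i - P ^ K ?x * c i) i \<in> \<int>"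
      using S_eq0 i ang_Ints by blast
    then have "ang (K ?x) (C ?x) i - ang k c i \<in> \<int>"
      using ang_lift[of k "K ?x" "C ?x"] ang_lift[of "K ?x" k c] by (simp add: ang_diff add.commute)
    then show ?thesis using i by (simp add: \<phi>_def cis_eq_iff_Ints)
  qed
  have common: "\<exists>k c c'. x = S k c \<and> y = S k c'" for x y
  proof -
    have "x = S (K y + K x) (\<lambda>i. P ^ K y * C x i)" using KC[of x] by (simp only: S_lift)
    moreover have "y = S (K y + K x) (\<lambda>i. P ^ K x * C y i)"
      using KC[of y] by (simp only: S_lift add.commute[of "K y"])
    ultimately show ?thesis by blast
  qed
  have hom: "\<phi> (x + y) i = \<phi> x i * \<phi> y i" if "i < n" for x y i
  proof -
    obtain k c c' where k: "x = S k c" "y = S k c'" using common by blast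
    have "\<phi> (x + y) i = cis (2 * pi * ang k (\<lambda>i. c i + c' i) i)" using \<phi>[OF that] k by (simp flip: S_add)
    then show ?thesis using k \<phi>[OF that] by (simp add: ang_add cis_mult algebra_simps)
  qed
  have "inj \<phi>"
  proof (rule injI)
    fix x y assume xy: "\<phi> x = \<phi> y"
    obtain k c c' where k: "x = S k c" "y = S k c'" using common by blast
    have "ang k c i - ang k c' i \<in> \<int>" if "i < n" for i
      using fun_cong[OF xy, of i] k \<phi>[OF that] by (simp add: cis_eq_iff_Ints)
    then have "S k (\<lambda>i. c i - c' i) = 0" using S_kill ang_Ints by (simp flip: ang_diff)
    then show "x = y" using k S_diff by simp
  qed
  moreover have "range \<phi> = {..<n} \<rightarrow>\<^sub>E pruefer p"
  proof (intro equalityI subsetI)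
    fix f assume "f \<in> range \<phi>"
    then obtain x where x: "f = \<phi> x" by blast
    have "cis (2 * pi * ang (K x) (C x) i) ^ (p ^ K x) = 1" for i
    proof -
      have "real (p ^ K x) * (2 * pi * ang (K x) (C x) i) = 2 * pi * of_int (C x i)"
        using p by (simp add: ang_def P_def prime_gt_0_nat)
      then show ?thesis by (simp only: DeMoivre) (simp add: cis_multiple_2pi)
    qed
    then show "f \<in> {..<n} \<rightarrow>\<^sub>E pruefer p" unfolding x \<phi>_def pruefer_def by auto
  next
    fix f assume f: "f \<in> {..<n} \<rightarrow>\<^sub>E pruefer p"
    then have "\<forall>i. \<exists>k. i < n \<longrightarrow> f i ^ (p ^ k) = 1" by (auto simp: pruefer_def PiE_iff)
    then obtain k where k: "\<And>i. i < n \<Longrightarrow> f i ^ (p ^ k i) = 1" by metis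
    \<comment> \<open>A common exponent for all coordinates, since the sum bounds each
      \<open>k i\<close>.\<close>
    define m where "m = (\<Sum>i<n. k i)"
    have m: "\<exists>j::int. f i = cis (2 * pi * (of_int j / of_int (P ^ m)))" if i: "i < n" for i
    proof -
      have "k i \<le> m" unfolding m_def using i by (intro member_le_sum) auto
      then have "p ^ m = p ^ k i * p ^ (m - k i)" by (simp flip: power_add)
      then have "f i ^ (p ^ m) = 1" using k[OF i] by (simp add: power_mult)
      moreover have "p ^ m > 0" using p by (simp add: prime_gt_0_nat)
      ultimately obtain j :: nat where "f i = cis (2 * pi * real j / real (p ^ m))"
        using bij_betw_imp_surj_on[OF bij_betw_roots_unity[of "p ^ m"]] by blast
      then show ?thesis by (intro exI[of _ "int j"]) (simp add: P_def)
    qed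
    then obtain c where c: "\<And>i. i < n \<Longrightarrow> f i = cis (2 * pi * (of_int (c i) / of_int (P ^ m)))"
      by metis
    have "f = \<phi> (S m c)"
    proof
      fix i show "f i = \<phi> (S m c) i"
      proof (cases "i < n")
        case True
        then show ?thesis using \<phi> c by (simp add: ang_def)
      next
        case False
        then show ?thesis using f by (auto simp: \<phi>_def PiE_iff extensional_def)
      qed
    qed
    then show "f \<in> range \<phi>" by blast
  qed
  ultimately have "bij_betw \<phi> UNIV ({..<n} \<rightarrow>\<^sub>E pruefer p)" by (simp add: bij_betw_def)
  then show ?thesis unfolding finite_product_of_pruefer_def using hom by blast
qed

text \<open>Both properties are checked coordinatewise. Complex p-th roots exist, and a p-th root of
  a root of unity of p-power order again has p-power order.\<close>

lemma finite_product_of_prueferD: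
  assumes p: "prime p" and G: "finite_product_of_pruefer p TYPE('a::ab_group_add)"
  shows "\<exists>k. nmul (p ^ k) (x::'a) = 0" and "\<exists>y. nmul p y = (x::'a)"
proof -
  obtain n and \<phi> :: "'a \<Rightarrow> nat \<Rightarrow> complex" where bij: "bij_betw \<phi> UNIV ({..<n} \<rightarrow>\<^sub>E pruefer p)"
    and hom: "\<And>x y i. i < n \<Longrightarrow> \<phi> (x + y) i = \<phi> x i * \<phi> y i"
    using G unfolding finite_product_of_pruefer_def by blast
  have p0: "p > 0" using p by (simp add: prime_gt_0_nat)
  have mem: "\<phi> y \<in> {..<n} \<rightarrow>\<^sub>E pruefer p" for y using bij by (auto simp: bij_betw_def)
  have eqI: "y = z" if "\<And>i. i < n \<Longrightarrow> \<phi> y i = \<phi> z i" for y z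
    using that mem[of y] mem[of z] bij PiE_ext[of "\<phi> y" "{..<n}" _ "\<phi> z"]
    by (metis bij_betw_imp_inj_on injD lessThan_iff)
  have zero: "\<phi> 0 i = 1" if i: "i < n" for i
  proof -
    obtain k where "\<phi> 0 i ^ (p ^ k) = 1" using mem[of 0] i by (auto simp: pruefer_def PiE_iff)
    then have "\<phi> 0 i \<noteq> 0" using p0 by (metis power_eq_0_iff zero_neq_one zero_power zero_less_power)
    then show ?thesis using hom[OF i, of 0 0] by simp
  qed
  have pow: "\<phi> (nmul m y) i = \<phi> y i ^ m" if "i < n" for m y i
    using that by (induction m) (simp_all add: zero nmul_Suc hom)
  have "\<forall>i. \<exists>k. i < n \<longrightarrow> \<phi> x i ^ (p ^ k) = 1" using mem[of x] by (auto simp: pruefer_def PiE_iff)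
  then obtain k where k: "\<And>i. i < n \<Longrightarrow> \<phi> x i ^ (p ^ k i) = 1" by metis
  define m where "m = (\<Sum>i<n. k i)"
  have "\<phi> x i ^ (p ^ m) = 1" if i: "i < n" for i
  proof -
    have "k i \<le> m" unfolding m_def using i by (intro member_le_sum) auto
    then have "p ^ m = p ^ k i * p ^ (m - k i)" by (simp flip: power_add)
    then show ?thesis using k[OF i] by (simp add: power_mult)
  qed
  then have "nmul (p ^ m) x = 0" by (intro eqI) (simp add: pow zero)
  then show "\<exists>k. nmul (p ^ k) x = 0" by blast
  have "\<exists>z. z \<in> pruefer p \<and> z ^ p = \<phi> x i" if i: "i < n" for i
  proof -
    have "\<phi> x i \<noteq> 0" using k[OF i] p0 by (metis zero_neq_one zero_power zero_less_power)
    then have "card {z. z ^ p = \<phi> x i} \<noteq> 0" using card_nth_roots[of "\<phi> x i" p] p0 by simp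
    then have "{z. z ^ p = \<phi> x i} \<noteq> {}" by (metis card.empty)
    then obtain z where z: "z ^ p = \<phi> x i" by blast
    have "z ^ (p ^ Suc (k i)) = 1" using k[OF i] by (simp add: power_mult z)
    then show ?thesis using z unfolding pruefer_def by blast
  qed
  then obtain z where z: "\<And>i. i < n \<Longrightarrow> z i \<in> pruefer p \<and> z i ^ p = \<phi> x i" by metis
  have "(\<lambda>i\<in>{..<n}. z i) \<in> {..<n} \<rightarrow>\<^sub>E pruefer p" using z by auto
  then obtain y where y: "\<phi> y = (\<lambda>i\<in>{..<n}. z i)"
    using bij by (metis bij_betw_imp_surj_on imageE)
  have "nmul p y = x" using z by (intro eqI) (simp add: pow y)
  then show "\<exists>y. nmul p y = x" by blast
qed

section \<open>Ultrafilters and good correspondences\<close>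

text \<open>Zorn's lemma for proper filters, ordered towards finer ones. The infimum of a chain is
  proper because its events are those of the members. Restricting a maximal U to P gives either the
  trivial filter, and then U contains the complement, or U itself.\<close>

lemma ex_ultrafilter:
  fixes F :: "'a filter"
  assumes "F \<noteq> bot"
  shows "\<exists>U\<le>F. U \<noteq> bot \<and> (\<forall>P. eventually P U \<or> eventually (\<lambda>x. \<not> P x) U)"
proof -
  define A where "A = {U. U \<le> F \<and> U \<noteq> bot}"
  have "\<exists>m\<in>A. \<forall>a\<in>A. a \<le> m \<longrightarrow> a = m"
  proof (rule predicate_Zorn)
    show "partial_order_on A (relation_of (\<lambda>x y. y \<le> x) A)"
      by (rule partial_order_on_relation_ofI) auto
  next
    fix C assume "C \<in> Chains (relation_of (\<lambda>x y. y \<le> x) A)"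
    then have C: "C \<subseteq> A" "\<And>x y. x \<in> C \<Longrightarrow> y \<in> C \<Longrightarrow> x \<le> y \<or> y \<le> x"
      unfolding Chains_def relation_of_def by auto
    show "\<exists>u\<in>A. \<forall>a\<in>C. u \<le> a"
    proof (cases "C = {}")
      case True
      then show ?thesis using assms by (auto simp: A_def)
    next
      case False
      have "eventually P (Inf C) \<longleftrightarrow> (\<exists>b\<in>C. eventually P b)" for P
        using False C(2) by (intro eventually_Inf_base) (metis inf.absorb1 inf.absorb2 order_refl)+
      then have "Inf C \<noteq> bot" using C(1) by (auto simp: trivial_limit_def A_def)
      moreover have "Inf C \<le> F" using False C(1) by (auto simp: A_def intro: Inf_lower2)
      ultimately show ?thesis by (intro bexI[of _ "Inf C"]) (auto simp: A_def Inf_lower)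
    qed
  qed
  then obtain U where U: "U \<le> F" "U \<noteq> bot" and max: "\<And>G. G \<le> U \<Longrightarrow> G \<noteq> bot \<Longrightarrow> G = U"
    unfolding A_def by (auto dest: order_trans)
  have "eventually P U \<or> eventually (\<lambda>x. \<not> P x) U" for P
  proof (cases "inf U (principal {x. P x}) = bot")
    case True
    then have "eventually (\<lambda>_. False) (inf U (principal {x. P x}))" by simp
    then show ?thesis by (simp add: eventually_inf_principal)
  next
    case False
    then have "inf U (principal {x. P x}) = U" by (intro max) auto
    moreover have "eventually P (inf U (principal {x. P x}))" by (simp add: eventually_inf_principal)
    ultimately show ?thesis by simp
  qed
  then show ?thesis using U by blast
qed

text \<open>For \<open>n > 0\<close> this is the relation R_m at the value of level n, given by m +
  1 representatives.\<close>

definition separated :: "('a::ab_group_add \<Rightarrow> nat) \<Rightarrow> nat \<Rightarrow> nat \<Rightarrow> bool" where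
  "separated lev m n \<longleftrightarrow> (\<exists>X. finite X \<and> card X = Suc m \<and> (\<forall>x\<in>X. lev x \<le> n) \<and>
     (\<forall>x\<in>X. \<forall>y\<in>X. x \<noteq> y \<longrightarrow> lev (x - y) = n))"

text \<open>The common abstraction of the two kinds of groups. The integers c with
  \<open>zmul c y \<noteq> 0\<close> for some y are the non-multiples of q when G has exponent q,
  and all nonzero integers when G is a product of Pruefer groups. \<open>separated_limit\<close>
  says that the size of the residue group has a limit, possibly infinite.\<close>

locale leveled_group =
  fixes lev :: "'a::ab_group_add \<Rightarrow> nat"
  assumes lev_eq_0_iff: "lev x = 0 \<longleftrightarrow> x = 0"
    and lev_diff: "lev (x - y) \<le> max (lev x) (lev y)"
    and finite_lev: "finite {x. lev x \<le> n}"
    and lev_surj: "\<exists>x. lev x = n"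
    and zmul_surj: "zmul c y \<noteq> 0 \<Longrightarrow> \<exists>z. zmul c z = x"
    and zmul_shift: "zmul c y \<noteq> 0 \<Longrightarrow> \<exists>d N. \<forall>x. N < lev x \<longrightarrow> lev (zmul c x) + d = lev x"
    and separated_limit:
      "(\<exists>N. \<forall>n>N. separated lev m n) \<or> (\<exists>N. \<forall>n>N. \<not> separated lev m n)"
begin

lemma lev_zero [simp]: "lev 0 = 0"
  by (simp add: lev_eq_0_iff)

lemma lev_uminus [simp]: "lev (- x) = lev x"
  using lev_diff[of 0 x] lev_diff[of 0 "- x"] by simp

lemma lev_add: "lev (x + y) \<le> max (lev x) (lev y)"
  using lev_diff[of x "- y"] by simp

lemma lev_diff_commute: "lev (x - y) = lev (y - x)"
  using lev_uminus[of "x - y"] by simp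

lemma lev_diff_eq: "lev x < lev y \<Longrightarrow> lev (x - y) = lev y"
  using lev_diff[of x y] lev_diff[of "x - y" x] by (simp add: max_def split: if_splits)

lemma lev_diff_eq': "lev y < lev x \<Longrightarrow> lev (x - y) = lev x"
  using lev_diff_eq[of y x] lev_diff_commute[of x y] by simp

lemma lev_zmul: "lev (zmul c x) \<le> lev x"
proof -
  have n: "lev (nmul n x) \<le> lev x" for n
    by (induction n) (auto simp: nmul_Suc intro: order_trans[OF lev_add])
  show ?thesis unfolding zmul_def using lev_diff n by (meson max.boundedI order_trans)
qed

definition kills :: "int \<Rightarrow> bool" where
  "kills c \<longleftrightarrow> (\<forall>y::'a. zmul c y = 0)"

lemma kills_0: "kills 0"
  by (simp add: kills_def)

text \<open>The annihilating integers form a prime ideal: if a x is nonzero, then x = b z by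
  surjectivity, and a b z is nonzero.\<close>

lemma not_kills_mult: "\<not> kills a \<Longrightarrow> \<not> kills b \<Longrightarrow> \<not> kills (a * b)"
  unfolding kills_def by (metis zmul_surj zmul.scale_scale)

lemma not_kills_abs: "\<not> kills c \<Longrightarrow> \<not> kills \<bar>c\<bar>"
  unfolding kills_def by (auto simp: abs_if)

end

section \<open>Calculus along a free ultrafilter, and correspondences between sequences\<close>

locale leveled_group_ultra = leveled_group lev for lev :: "'a::ab_group_add \<Rightarrow> nat" +
  fixes U :: "nat filter"
  assumes U_free: "U \<le> sequentially"
    and U_proper: "U \<noteq> bot"
    and U_ultra: "eventually P U \<or> eventually (\<lambda>k. \<not> P k) U"
begin

abbreviation ae :: "(nat \<Rightarrow> bool) \<Rightarrow> bool" where
  "ae P \<equiv> eventually P U"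

lemma ae_not: "ae (\<lambda>k. \<not> P k) \<longleftrightarrow> \<not> ae P"
proof
  assume n: "ae (\<lambda>k. \<not> P k)"
  show "\<not> ae P"
  proof
    assume "ae P"
    with n have "ae (\<lambda>_. False)" by eventually_elim simp
    then show False using U_proper by (simp add: trivial_limit_def)
  qed
qed (use U_ultra in blast)

lemma ae_cong: "ae (\<lambda>k. P k \<longleftrightarrow> Q k) \<Longrightarrow> ae P \<longleftrightarrow> ae Q"
  by (rule eventually_subst)

text \<open>The limiting truth value is attained at almost every k. A type, which consists of such
  limiting values, thereby becomes a pointwise condition that can be solved separately for each
  k.\<close>

lemma ae_truth: "ae (\<lambda>k. P k \<longleftrightarrow> ae P)"
  using ae_not[of P] by (cases "ae P") auto

lemma ae_iffI: "ae (\<lambda>k. P k \<longleftrightarrow> t) \<Longrightarrow> ae P \<longleftrightarrow> t"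
  using ae_not[of P] by (cases t) auto

lemma ae_ge: "ae (\<lambda>k. n \<le> k)"
  using eventually_ge_at_top[of n] U_free by (rule filter_leD[rotated])

text \<open>A choice among finitely many candidates that depends on k can be made independently of
  k.\<close>

lemma ae_Bex:
  assumes "finite A" "ae (\<lambda>k. \<exists>x\<in>A. P x k)"
  shows "\<exists>x\<in>A. ae (P x)"
proof (rule ccontr)
  assume "\<not> (\<exists>x\<in>A. ae (P x))"
  then have "\<forall>x\<in>A. ae (\<lambda>k. \<not> P x k)" using ae_not by blast
  then have "ae (\<lambda>k. \<forall>x\<in>A. \<not> P x k)" by (rule eventually_ball_finite[OF assms(1)])
  then show False using assms(2) ae_not[of "\<lambda>k. \<exists>x\<in>A. P x k"] by simp
qed

lemma ae_argmin:
  fixes f :: "'b \<Rightarrow> nat \<Rightarrow> 'c::linorder"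
  assumes "finite A" "A \<noteq> {}"
  shows "\<exists>p\<in>A. ae (\<lambda>k. \<forall>q\<in>A. f p k \<le> f q k)"
proof (rule ae_Bex[OF assms(1), of "\<lambda>p k. \<forall>q\<in>A. f p k \<le> f q k"], rule always_eventually, rule allI)
  fix k
  obtain p where "p \<in> A" "Min ((\<lambda>q. f q k) ` A) = f p k"
    using assms by (rule obtains_MIN)
  then show "\<exists>p\<in>A. \<forall>q\<in>A. f p k \<le> f q k" using assms(1) by (metis Min_le finite_imageI imageI)
qed

lemma ae_argmax:
  fixes f :: "'b \<Rightarrow> nat \<Rightarrow> 'c::linorder"
  assumes "finite A" "A \<noteq> {}"
  shows "\<exists>p\<in>A. ae (\<lambda>k. \<forall>q\<in>A. f q k \<le> f p k)"
proof (rule ae_Bex[OF assms(1), of "\<lambda>p k. \<forall>q\<in>A. f q k \<le> f p k"], rule always_eventually, rule allI)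
  fix k
  obtain p where "p \<in> A" "Max ((\<lambda>q. f q k) ` A) = f p k"
    using assms by (rule obtains_MAX)
  then show "\<exists>p\<in>A. \<forall>q\<in>A. f q k \<le> f p k" using assms(1) by (metis Max_ge finite_imageI imageI)
qed

text \<open>The existential step of the theorem of Los: witnesses for the single k form a
  sequence.\<close>

lemma ae_ex: "ae (\<lambda>k. \<exists>x. P k x) \<longleftrightarrow> (\<exists>w. ae (\<lambda>k. P k (w k)))"
proof
  assume "ae (\<lambda>k. \<exists>x. P k x)"
  then have "ae (\<lambda>k. P k (SOME x. P k x))" by eventually_elim (rule someI_ex)
  then show "\<exists>w. ae (\<lambda>k. P k (w k))" by (rule exI[where x = "\<lambda>k. SOME x. P k x"])
next
  assume "\<exists>w. ae (\<lambda>k. P k (w k))"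
  then obtain w where "ae (\<lambda>k. P k (w k))" by blast
  then show "ae (\<lambda>k. \<exists>x. P k x)" by (rule eventually_mono) blast
qed

text \<open>Balls are finite, so a bounded sequence takes one of its values almost everywhere. In
  the ultrapower, everything outside G has infinite level.\<close>

lemma ae_bounded_const:
  assumes "ae (\<lambda>k. lev (z k) \<le> n)"
  shows "\<exists>g. ae (\<lambda>k. z k = g)"
  using ae_Bex[OF finite_lev[of n], of "\<lambda>g k. z k = g"] assms by auto

text \<open>Countable saturation: at k, solve as many of the increasing conditions as possible, but
  only up to index k so that a greatest index exists. As U is free, the cap at k does not matter for
  a fixed n.\<close>

lemma saturation:
  fixes C :: "nat \<Rightarrow> nat \<Rightarrow> 'b \<Rightarrow> bool"
  assumes C: "\<And>n. ae (\<lambda>k. \<exists>x. C n k x)"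
    and mono: "\<And>m n k x. m \<le> n \<Longrightarrow> C n k x \<Longrightarrow> C m k x"
  shows "\<exists>w. \<forall>n. ae (\<lambda>k. C n k (w k))"
proof -
  define M where "M k = (GREATEST n. n \<le> k \<and> (\<exists>x. C n k x))" for k
  define w where "w k = (SOME x. C (M k) k x)" for k
  have "ae (\<lambda>k. C n k (w k))" for n
    using C[of n] ae_ge[of n]
  proof eventually_elim
    case (elim k)
    define P where "P n \<longleftrightarrow> n \<le> k \<and> (\<exists>x. C n k x)" for n
    have n: "P n" and bound: "\<And>m. P m \<Longrightarrow> m \<le> k" using elim by (auto simp: P_def)
    have M: "M k = Greatest P" by (simp add: M_def P_def[abs_def])
    have "P (M k)" unfolding M by (rule GreatestI_nat[of P n k, OF n]) (rule bound)
    then have "C (M k) k (w k)" unfolding w_def P_def by (blast intro: someI_ex)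
    moreover have "n \<le> M k" unfolding M by (rule Greatest_le_nat[of P n k, OF n]) (rule bound)
    ultimately show ?case by (rule mono[rotated])
  qed
  then show ?thesis by blast
qed

text \<open>Modulo equality along \<open>U\<close>, a good relation is the graph of an isomorphism between two countable
  subgroups of the ultrapower that fixes \<open>G\<close>. The integer shifts \<open>D\<close> are part of the structure
  because multiplication by \<open>c\<close> lowers large levels by a constant.\<close>

definition good :: "((nat \<Rightarrow> 'a) \<times> (nat \<Rightarrow> 'a)) set \<Rightarrow> bool" where
  "good \<rho> \<longleftrightarrow> countable \<rho> \<and>
     (\<forall>g. ((\<lambda>_. g), (\<lambda>_. g)) \<in> \<rho>) \<and>
     (\<forall>a a' b b'. (a, a') \<in> \<rho> \<longrightarrow> (b, b') \<in> \<rho> \<longrightarrow> ((\<lambda>k. a k - b k), (\<lambda>k. a' k - b' k)) \<in> \<rho>) \<and>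
     (\<forall>a a' c. (a, a') \<in> \<rho> \<longrightarrow> \<not> kills c \<longrightarrow>
        (\<exists>b b'. (b, b') \<in> \<rho> \<and> (\<forall>k. a k = zmul c (b k)) \<and> (\<forall>k. a' k = zmul c (b' k)))) \<and>
     (\<forall>a a' b b'. \<forall>D::int. (a, a') \<in> \<rho> \<longrightarrow> (b, b') \<in> \<rho> \<longrightarrow>
        ae (\<lambda>k. int (lev (a k)) + D \<le> int (lev (b k))) =
        ae (\<lambda>k. int (lev (a' k)) + D \<le> int (lev (b' k))))"

text \<open>Since D runs over all integers, negation turns these upper bounds for
  \<open>lev (b k)\<close> failing into strict lower bounds; comparisons in the other direction and
  between two differences of \<open>u\<close> are derived from them later.\<close>

definition same_type :: "((nat \<Rightarrow> 'a) \<times> (nat \<Rightarrow> 'a)) set \<Rightarrow> (nat \<Rightarrow> 'a) \<Rightarrow> (nat \<Rightarrow> 'a) \<Rightarrow> bool" where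
  "same_type \<rho> u w \<longleftrightarrow> (\<forall>a a' b b'. \<forall>D::int. (a, a') \<in> \<rho> \<longrightarrow> (b, b') \<in> \<rho> \<longrightarrow>
     ae (\<lambda>k. int (lev (u k - a k)) + D \<le> int (lev (b k))) =
     ae (\<lambda>k. int (lev (w k - a' k)) + D \<le> int (lev (b' k))))"

text \<open>All clauses are symmetric in the two sides. Hence only the "forth" half of the game
  needs proof, and negation can be treated by exchanging the sides.\<close>

lemma good_converse: "good \<rho> \<Longrightarrow> good (\<rho>\<inverse>)"
proof -
  assume g: "good \<rho>"
  have "\<rho>\<inverse> = prod.swap ` \<rho>" by (force simp: image_iff)
  then have "countable (\<rho>\<inverse>)" using g[unfolded good_def, THEN conjunct1] by simp
  note parts = g[unfolded good_def, THEN conjunct2]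
  show "good (\<rho>\<inverse>)"
    unfolding good_def converse_iff
  proof (intro conjI allI impI)
    fix a a' b b' and D :: int
    assume "(a', a) \<in> \<rho>" "(b', b) \<in> \<rho>"
    then show "ae (\<lambda>k. int (lev (a k)) + D \<le> int (lev (b k))) =
        ae (\<lambda>k. int (lev (a' k)) + D \<le> int (lev (b' k)))"
      by (rule parts[THEN conjunct2, THEN conjunct2, THEN conjunct2, rule_format, symmetric])
  next
    fix a a' c assume "(a', a) \<in> \<rho>" "\<not> kills c"
    then show "\<exists>b b'. (b', b) \<in> \<rho> \<and> (\<forall>k. a k = zmul c (b k)) \<and> (\<forall>k. a' k = zmul c (b' k))"
      using parts[THEN conjunct2, THEN conjunct2, THEN conjunct1, rule_format, of a' a c] by metis
  qed (use \<open>countable (\<rho>\<inverse>)\<close> parts[THEN conjunct1] parts[THEN conjunct2, THEN conjunct1] in simp_all)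
qed

context
  fixes \<rho> assumes good: "good \<rho>"
begin

lemmas good_parts = good[unfolded good_def, THEN conjunct2]

lemma good_countable: "countable \<rho>"
  by (rule good[unfolded good_def, THEN conjunct1])

lemma good_const: "((\<lambda>_. g), (\<lambda>_. g)) \<in> \<rho>"
  by (rule good_parts[THEN conjunct1, rule_format])

lemma good_diff: "(a, a') \<in> \<rho> \<Longrightarrow> (b, b') \<in> \<rho> \<Longrightarrow> ((\<lambda>k. a k - b k), (\<lambda>k. a' k - b' k)) \<in> \<rho>"
  by (rule good_parts[THEN conjunct2, THEN conjunct1, rule_format])

lemma good_divide:
  "(a, a') \<in> \<rho> \<Longrightarrow> \<not> kills c \<Longrightarrow>
    \<exists>b b'. (b, b') \<in> \<rho> \<and> (\<forall>k. a k = zmul c (b k)) \<and> (\<forall>k. a' k = zmul c (b' k))"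
  by (rule good_parts[THEN conjunct2, THEN conjunct2, THEN conjunct1, rule_format])

lemma good_lev:
  "(a, a') \<in> \<rho> \<Longrightarrow> (b, b') \<in> \<rho> \<Longrightarrow>
    ae (\<lambda>k. int (lev (a k)) + D \<le> int (lev (b k))) =
    ae (\<lambda>k. int (lev (a' k)) + D \<le> int (lev (b' k)))"
  by (rule good_parts[THEN conjunct2, THEN conjunct2, THEN conjunct2, rule_format])

lemma good_uminus: "(a, a') \<in> \<rho> \<Longrightarrow> ((\<lambda>k. - a k), (\<lambda>k. - a' k)) \<in> \<rho>"
  using good_diff[OF good_const[of 0]] by simp

lemma good_add: "(a, a') \<in> \<rho> \<Longrightarrow> (b, b') \<in> \<rho> \<Longrightarrow> ((\<lambda>k. a k + b k), (\<lambda>k. a' k + b' k)) \<in> \<rho>"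
  using good_diff[OF _ good_uminus] by simp

lemma good_zmul:
  assumes "(a, a') \<in> \<rho>"
  shows "((\<lambda>k. zmul c (a k)), (\<lambda>k. zmul c (a' k))) \<in> \<rho>"
proof -
  have n: "((\<lambda>k. nmul n (a k)), (\<lambda>k. nmul n (a' k))) \<in> \<rho>" for n
    by (induction n) (simp_all add: nmul_Suc good_const good_add assms)
  show ?thesis unfolding zmul_def by (intro good_diff n)
qed

text \<open>If l has constant distance from some level of B, copy that level with the same distance.
  Otherwise l is further than K from all of them, and any place in the corresponding gap that keeps
  distance K from both ends will do.\<close>

lemma ex_level:
  fixes l :: "nat \<Rightarrow> nat" and K :: nat
  assumes B: "finite B" "B \<subseteq> \<rho>" and zero: "((\<lambda>_. 0), (\<lambda>_. 0)) \<in> B"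
  shows "\<exists>l'::nat \<Rightarrow> nat. \<forall>q\<in>B. \<forall>D\<in>{- int K..int K}.
    ae (\<lambda>k. int (l k) + D \<le> int (lev (fst q k))) = ae (\<lambda>k. int (l' k) + D \<le> int (lev (snd q k)))"
proof (cases "\<exists>q\<in>B. \<exists>d. ae (\<lambda>k. int (l k) = int (lev (fst q k)) + d)")
  case True
  then obtain q d where q: "q \<in> B" and d: "ae (\<lambda>k. int (l k) = int (lev (fst q k)) + d)" by blast
  then have q\<rho>: "(fst q, snd q) \<in> \<rho>" using B by auto
  define l' where "l' k = nat (int (lev (snd q k)) + d)" for k
  \<comment> \<open>Comparison with the level of 0 transfers that level plus d is nonnegative, so
    \<open>nat\<close> does not truncate in \<open>l'\<close>.\<close>
  have "ae (\<lambda>k. int (lev 0) + (- d) \<le> int (lev (fst q k)))" using d by eventually_elim simp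
  then have "ae (\<lambda>k. int (lev 0) + (- d) \<le> int (lev (snd q k)))" using good_lev[OF good_const q\<rho>] by blast
  then have d': "ae (\<lambda>k. int (l' k) = int (lev (snd q k)) + d)" by eventually_elim (simp add: l'_def)
  have "ae (\<lambda>k. int (l k) + D \<le> int (lev (fst r k))) = ae (\<lambda>k. int (l' k) + D \<le> int (lev (snd r k)))"
    if r: "r \<in> B" for r D
  proof -
    have r\<rho>: "(fst r, snd r) \<in> \<rho>" using r B by auto
    have "ae (\<lambda>k. int (l k) + D \<le> int (lev (fst r k))) =
        ae (\<lambda>k. int (lev (fst q k)) + (d + D) \<le> int (lev (fst r k)))"
      by (rule ae_cong) (use d in \<open>eventually_elim; simp add: algebra_simps\<close>)
    also have "\<dots> = ae (\<lambda>k. int (lev (snd q k)) + (d + D) \<le> int (lev (snd r k)))"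
      by (rule good_lev[OF q\<rho> r\<rho>])
    also have "\<dots> = ae (\<lambda>k. int (l' k) + D \<le> int (lev (snd r k)))"
      by (rule ae_cong) (use d' in \<open>eventually_elim; simp add: algebra_simps\<close>)
    finally show ?thesis .
  qed
  then show ?thesis by blast
next
  case False
  have far: "ae (\<lambda>k. lev (fst q k) + K < l k) \<or> ae (\<lambda>k. l k + K < lev (fst q k))" if "q \<in> B" for q
  proof (rule ccontr)
    assume "\<not> ?thesis"
    then have "ae (\<lambda>k. \<not> lev (fst q k) + K < l k)" "ae (\<lambda>k. \<not> l k + K < lev (fst q k))"
      by (auto simp: ae_not)
    then have d: "ae (\<lambda>k. \<exists>d\<in>{- int K..int K}. int (l k) = int (lev (fst q k)) + d)"
    proof eventually_elim
      case (elim k)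
      then show ?case by (intro bexI[of _ "int (l k) - int (lev (fst q k))"]) auto
    qed
    show False using ae_Bex[OF _ d] that False by blast
  qed
  define B0 where "B0 = {q \<in> B. ae (\<lambda>k. lev (fst q k) + K < l k)}"
  \<comment> \<open>No level lies below that of 0, so the zero sequence must belong to the lower
    part, which is therefore nonempty.\<close>
  have "((\<lambda>_. 0), (\<lambda>_. 0)) \<in> B0"
    using far[OF zero] zero ae_not[of "\<lambda>_. True"] by (auto simp: B0_def)
  then have B0: "finite B0" "B0 \<noteq> {}" using B(1) by (auto simp: B0_def)
  obtain q where q: "q \<in> B0" and qmax: "ae (\<lambda>k. \<forall>r\<in>B0. lev (fst r k) \<le> lev (fst q k))"
    using ae_argmax[OF B0, of "\<lambda>q k. lev (fst q k)"] by blast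
  then have q\<rho>: "(fst q, snd q) \<in> \<rho>" and ql: "ae (\<lambda>k. lev (fst q k) + K < l k)"
    using B by (auto simp: B0_def)
  \<comment> \<open>Just beyond the window above the greatest lower level. The gap has width at
    least 2K + 2, which leaves room for the window on the upper side.\<close>
  define l' where "l' k = lev (snd q k) + K + 1" for k
  have "ae (\<lambda>k. int (l k) + D \<le> int (lev (fst r k))) = ae (\<lambda>k. int (l' k) + D \<le> int (lev (snd r k)))"
    if r: "r \<in> B" and D: "D \<in> {- int K..int K}" for r D
  proof (cases "r \<in> B0")
    case True
    have r\<rho>: "(fst r, snd r) \<in> \<rho>" using r B by auto
    have "ae (\<lambda>k. lev (fst r k) + K < l k)" using True by (simp add: B0_def)
    then have 1: "ae (\<lambda>k. \<not> int (l k) + D \<le> int (lev (fst r k)))"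
      by eventually_elim (use D in auto)
    have "ae (\<lambda>k. int (lev (fst r k)) + 0 \<le> int (lev (fst q k)))"
      using qmax by eventually_elim (use True in auto)
    then have "ae (\<lambda>k. int (lev (snd r k)) + 0 \<le> int (lev (snd q k)))"
      using good_lev[OF r\<rho> q\<rho>] by blast
    then have "ae (\<lambda>k. \<not> int (l' k) + D \<le> int (lev (snd r k)))"
      by eventually_elim (use D in \<open>auto simp: l'_def\<close>)
    with 1 show ?thesis by (simp add: ae_not)
  next
    case False
    have r\<rho>: "(fst r, snd r) \<in> \<rho>" using r B by auto
    have 2: "ae (\<lambda>k. l k + K < lev (fst r k))" using far[OF r] False r by (simp add: B0_def)
    then have 1: "ae (\<lambda>k. int (l k) + D \<le> int (lev (fst r k)))"
      by eventually_elim (use D in auto)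
    from 2 ql have "ae (\<lambda>k. int (lev (fst q k)) + (2 * int K + 2) \<le> int (lev (fst r k)))"
      by eventually_elim simp
    then have "ae (\<lambda>k. int (lev (snd q k)) + (2 * int K + 2) \<le> int (lev (snd r k)))"
      using good_lev[OF q\<rho> r\<rho>] by blast
    then have "ae (\<lambda>k. int (l' k) + D \<le> int (lev (snd r k)))"
      by eventually_elim (use D in \<open>auto simp: l'_def\<close>)
    with 1 show ?thesis by simp
  qed
  then show ?thesis by blast
qed

end

end

section \<open>Realizing the type of a new sequence\<close>

context leveled_group_ultra begin

context
  fixes \<rho> assumes good: "good \<rho>"
begin

text \<open>With p closest to u among F and l the distance, the ultrametric law gives lev (u - q) =
  max l (lev (q - p)) for all q in F. So it suffices to find x of a suitable level l' such that x +
  p' has the same formula for its distances on the second side.\<close>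

lemma finite_satisfiability:
  fixes K :: nat
  assumes F: "finite F" "F \<subseteq> \<rho>" and zero: "((\<lambda>_. 0), (\<lambda>_. 0)) \<in> F"
  shows "ae (\<lambda>k. \<exists>x. \<forall>q\<in>F. \<forall>r\<in>F. \<forall>D\<in>{- int K..int K}.
    int (lev (x - snd q k)) + D \<le> int (lev (snd r k)) \<longleftrightarrow>
    ae (\<lambda>k. int (lev (u k - fst q k)) + D \<le> int (lev (fst r k))))"
proof -
  have F\<rho>: "(fst q, snd q) \<in> \<rho>" if "q \<in> F" for q using that F by auto
  have "F \<noteq> {}" using zero by blast
  then obtain p where p: "p \<in> F" and pmin: "ae (\<lambda>k. \<forall>q\<in>F. lev (u k - fst p k) \<le> lev (u k - fst q k))"
    using ae_argmin[OF F(1), of "\<lambda>q k. lev (u k - fst q k)"] by blast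
  define l where "l k = lev (u k - fst p k)" for k
  show ?thesis
  proof (cases "\<exists>n. ae (\<lambda>k. l k \<le> n)")
    case True
    then obtain n where "ae (\<lambda>k. lev (u k - fst p k) \<le> n)" unfolding l_def by blast
    \<comment> \<open>At bounded distance, u is p plus a constant g, and the same g added to the
      second side of p is a solution.\<close>
    from ae_bounded_const[OF this] obtain g where g: "ae (\<lambda>k. u k - fst p k = g)" by (elim exE)
    define c c' where "c k = fst p k + g" and "c' k = snd p k + g" for k
    have c\<rho>: "(c, c') \<in> \<rho>"
      using good_add[OF good F\<rho>[OF p] good_const[OF good, of g]] by (simp add: c_def[abs_def] c'_def[abs_def])
    have "ae (\<lambda>k. int (lev (c' k - snd q k)) + D \<le> int (lev (snd r k)) \<longleftrightarrow>
        ae (\<lambda>k. int (lev (u k - fst q k)) + D \<le> int (lev (fst r k))))"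
      if "q \<in> F" "r \<in> F" for q r D
    proof -
      have "ae (\<lambda>k. int (lev (u k - fst q k)) + D \<le> int (lev (fst r k))) =
          ae (\<lambda>k. int (lev (c k - fst q k)) + D \<le> int (lev (fst r k)))"
      proof (rule ae_cong)
        show "ae (\<lambda>k. (int (lev (u k - fst q k)) + D \<le> int (lev (fst r k))) =
            (int (lev (c k - fst q k)) + D \<le> int (lev (fst r k))))"
          using g by eventually_elim (auto simp: c_def)
      qed
      also have "\<dots> = ae (\<lambda>k. int (lev (c' k - snd q k)) + D \<le> int (lev (snd r k)))"
        by (rule good_lev[OF good good_diff[OF good c\<rho> F\<rho>[OF that(1)]] F\<rho>[OF that(2)]])
      finally show ?thesis using ae_truth by simp
    qed
    then have "ae (\<lambda>k. \<forall>q\<in>F. \<forall>r\<in>F. \<forall>D\<in>{- int K..int K}.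
        int (lev (c' k - snd q k)) + D \<le> int (lev (snd r k)) \<longleftrightarrow>
        ae (\<lambda>k. int (lev (u k - fst q k)) + D \<le> int (lev (fst r k))))"
      by (intro eventually_ball_finite F ballI) auto
    then show ?thesis by (rule eventually_mono) blast
  next
    case False
    then have l_large: "ae (\<lambda>k. n < l k)" for n using ae_not[of "\<lambda>k. l k \<le> n"] by (simp add: not_le)
    \<comment> \<open>Only elements within distance l of p compete with u for a residue class at
      level l; the distance from u to the others is already determined by p.\<close>
    define C where "C = {q \<in> F. ae (\<lambda>k. lev (fst q k - fst p k) \<le> l k)}"
    have C: "finite C" "C \<subseteq> F" "p \<in> C" using F p by (auto simp: C_def)
    define apart where "apart q r = ae (\<lambda>k. l k \<le> lev (fst q k - fst r k))" for q r :: "(nat \<Rightarrow> 'a) \<times> (nat \<Rightarrow> 'a)"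
    have apart_sym: "apart q r = apart r q" for q r unfolding apart_def by (simp add: lev_diff_commute)
    define S where "S = {R. R \<subseteq> C \<and> (\<forall>q\<in>R. \<forall>r\<in>R. q \<noteq> r \<longrightarrow> apart q r)}"
    have "finite S" "{} \<in> S" using C by (auto simp: S_def)
    then obtain Rep where Rep: "Rep \<in> S" and Rmax: "\<And>R. R \<in> S \<Longrightarrow> Rep \<subseteq> R \<Longrightarrow> R = Rep"
      using finite_has_maximal[of S] by (metis empty_iff)
    have Rep_C: "Rep \<subseteq> C" and Rep_F: "Rep \<subseteq> F" and fin_Rep: "finite Rep"
      using Rep C finite_subset by (auto simp: S_def)
    have Rep_apart: "apart q r" if "q \<in> Rep" "r \<in> Rep" "q \<noteq> r" for q r using Rep that by (auto simp: S_def)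
    have rep: "\<exists>r\<in>Rep. \<not> apart q r" if q: "q \<in> C" for q
    proof (cases "q \<in> Rep")
      case True
      have "\<not> apart q q" unfolding apart_def using l_large[of 0] ae_not[of "\<lambda>k. l k \<le> 0"] by simp
      then show ?thesis using True by blast
    next
      case False
      then have "insert q Rep \<notin> S" using Rmax[of "insert q Rep"] by auto
      then show ?thesis using Rep q apart_sym by (auto simp: S_def)
    qed
    \<comment> \<open>\<open>Rep\<close> represents the residue classes at level \<open>l\<close> of the old elements. Together with the class
      of \<open>u - p\<close>, which is new, this shows that the residue group has more than \<open>m\<close> elements.\<close>
    define m where "m = card Rep"
    have "ae (\<lambda>k. \<forall>q\<in>Rep. \<forall>r\<in>Rep. q \<noteq> r \<longrightarrow> l k \<le> lev (fst q k - fst r k))"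
      using Rep_apart unfolding apart_def by (intro eventually_ball_finite fin_Rep ballI) auto
    moreover have "ae (\<lambda>k. \<forall>q\<in>Rep. lev (fst q k - fst p k) \<le> l k)"
      using Rep_C by (intro eventually_ball_finite fin_Rep ballI) (auto simp: C_def)
    ultimately have "ae (\<lambda>k. separated lev m (l k))"
      using pmin l_large[of 0]
    proof eventually_elim
      case (elim k)
      define f where "f q = fst q k - fst p k" for q :: "(nat \<Rightarrow> 'a) \<times> (nat \<Rightarrow> 'a)"
      define z where "z = u k - fst p k"
      have ff: "l k \<le> lev (f q - f r)" if "q \<in> Rep" "r \<in> Rep" "q \<noteq> r" for q r
        using elim(1) that by (auto simp: f_def)
      have zf: "l k \<le> lev (z - f r)" if "r \<in> Rep" for r
        using elim(3) that Rep_F by (auto simp: f_def z_def l_def)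
      have lz: "lev z = l k" and lf: "lev (f r) \<le> l k" if "r \<in> Rep" for r
        using elim(2) that by (auto simp: f_def z_def l_def)
      have inj: "inj_on f Rep"
        by (rule inj_onI, rule ccontr) (use ff elim(4) in fastforce)
      have notin: "z \<notin> f ` Rep" using zf elim(4) by fastforce
      let ?X = "insert z (f ` Rep)"
      have "card ?X = Suc m" using inj notin fin_Rep by (simp add: m_def card_image)
      moreover have le: "lev x \<le> l k" if "x \<in> ?X" for x
        using that elim(2) by (auto simp: f_def z_def l_def)
      moreover have "lev (x - y) = l k" if xy: "x \<in> ?X" "y \<in> ?X" "x \<noteq> y" for x y
      proof (rule antisym)
        show "lev (x - y) \<le> l k" using le[OF xy(1)] le[OF xy(2)] lev_diff[of x y] by simp
        have fz: "l k \<le> lev (f r - z)" if "r \<in> Rep" for r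
          using zf[OF that] by (simp only: lev_diff_commute[of "f r" z])
        show "l k \<le> lev (x - y)"
        proof (cases "x = z")
          case True
          then show ?thesis using xy zf by blast
        next
          case False
          then obtain q where q: "q \<in> Rep" "x = f q" using xy(1) by blast
          show ?thesis
          proof (cases "y = z")
            case True
            then show ?thesis using q fz by simp
          next
            case False
            then obtain r where r: "r \<in> Rep" "y = f r" using xy(2) by blast
            then have "q \<noteq> r" using q xy(3) by auto
            then show ?thesis using q r ff by simp
          qed
        qed
      qed
      ultimately show ?case unfolding separated_def using fin_Rep by (intro exI[of _ ?X]) blast
    qed
    \<comment> \<open>Separation holds along l, which tends to infinity, so it cannot be eventually
      false; by \<open>separated_limit\<close> it holds at all large levels.\<close>
    then obtain N where N: "\<And>n. n > N \<Longrightarrow> separated lev m n"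
    proof (cases "\<exists>N. \<forall>n>N. \<not> separated lev m n")
      case True
      then obtain N where "\<forall>n>N. \<not> separated lev m n" by blast
      then have "ae (\<lambda>k. \<not> separated lev m (l k))" using l_large[of N] by (auto elim: eventually_mono)
      then show ?thesis using \<open>ae (\<lambda>k. separated lev m (l k))\<close> by (simp add: ae_not)
    qed (use separated_limit that in blast)
    \<comment> \<open>Including the constant g among the compared elements forces l' above N, where
      the residue group is known to be large enough.\<close>
    obtain g where g: "lev g = N" using lev_surj by blast
    define d where "d q r = ((\<lambda>k. fst q k - fst r k), (\<lambda>k. snd q k - snd r k))"
      for q r :: "(nat \<Rightarrow> 'a) \<times> (nat \<Rightarrow> 'a)"
    define B where "B = F \<union> (\<Union>q\<in>F. d q ` F) \<union> {((\<lambda>_. g), (\<lambda>_. g))}"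
    have "finite B" "((\<lambda>_. 0), (\<lambda>_. 0)) \<in> B" using F zero by (auto simp: B_def)
    moreover have "B \<subseteq> \<rho>"
      using F good_const[OF good] good_diff[OF good F\<rho> F\<rho>] by (auto simp: B_def d_def)
    \<comment> \<open>The window is enlarged to \<open>Suc K\<close> so that it contains the shift
      1, needed for strict inequalities even when K = 0.\<close>
    ultimately obtain l' where l': "\<And>q D. q \<in> B \<Longrightarrow> D \<in> {- int (Suc K)..int (Suc K)} \<Longrightarrow>
        ae (\<lambda>k. int (l k) + D \<le> int (lev (fst q k))) = ae (\<lambda>k. int (l' k) + D \<le> int (lev (snd q k)))"
      using ex_level[OF good, of B "Suc K" l] by blast
    have l'_N: "ae (\<lambda>k. N < l' k)"
    proof -
      have "\<not> ae (\<lambda>k. int (l k) + 0 \<le> int (lev g))" using l_large[of N] g ae_not[of "\<lambda>k. l k \<le> N"] by (simp add: not_le)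
      then have "\<not> ae (\<lambda>k. int (l' k) + 0 \<le> int (lev g))"
        using l'[of "((\<lambda>_. g), (\<lambda>_. g))" 0] by (simp add: B_def)
      then show ?thesis using g ae_not[of "\<lambda>k. l' k \<le> N"] by (simp add: not_le)
    qed
    have dB: "d q r \<in> B" if "q \<in> F" "r \<in> F" for q r using that by (auto simp: B_def)
    have in_C: "ae (\<lambda>k. lev (snd q k - snd p k) \<le> l' k)" if "q \<in> C" for q
    proof -
      have "ae (\<lambda>k. lev (fst q k - fst p k) \<le> l k)" using that by (simp add: C_def)
      then have "ae (\<lambda>k. \<not> int (l k) + 1 \<le> int (lev (fst (d q p) k)))"
        by eventually_elim (simp add: d_def)
      then have "\<not> ae (\<lambda>k. int (l k) + 1 \<le> int (lev (fst (d q p) k)))" by (rule ae_not[THEN iffD1])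
      then have "ae (\<lambda>k. \<not> int (l' k) + 1 \<le> int (lev (snd (d q p) k)))"
        using l'[OF dB, of q p 1] that C p by (auto simp: ae_not)
      then show ?thesis by eventually_elim (simp add: d_def)
    qed
    have not_C: "ae (\<lambda>k. l k < lev (fst q k - fst p k)) \<and> ae (\<lambda>k. l' k < lev (snd q k - snd p k))"
      if "q \<in> F" "q \<notin> C" for q
    proof -
      have "ae (\<lambda>k. \<not> lev (fst q k - fst p k) \<le> l k)" using that by (simp add: C_def ae_not)
      then have 1: "ae (\<lambda>k. int (l k) + 1 \<le> int (lev (fst (d q p) k)))"
        by eventually_elim (simp add: d_def)
      then have "ae (\<lambda>k. int (l' k) + 1 \<le> int (lev (snd (d q p) k)))"
        using l'[OF dB, of q p 1] that p by auto
      with 1 show ?thesis by (auto simp: d_def elim: eventually_mono)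
    qed
    have near: "ae (\<lambda>k. \<exists>r\<in>Rep. lev (snd q k - snd r k) < l' k)" if q: "q \<in> C" for q
    proof -
      obtain r where r: "r \<in> Rep" "\<not> apart q r" using rep[OF q] by blast
      then have "\<not> ae (\<lambda>k. int (l k) + 0 \<le> int (lev (fst (d q r) k)))" by (simp add: apart_def d_def)
      then have "ae (\<lambda>k. \<not> int (l' k) + 0 \<le> int (lev (snd (d q r) k)))"
        using l'[OF dB, of q r 0] q r Rep_F C by (auto simp: ae_not)
      then show ?thesis by eventually_elim (use r in \<open>auto simp: d_def not_le\<close>)
    qed
    have unprimed: "ae (\<lambda>k. lev (u k - fst q k) = max (l k) (lev (fst q k - fst p k)))" if q: "q \<in> F" for q
      using pmin
    proof eventually_elim
      case (elim k)
      have eq: "u k - fst q k = (u k - fst p k) - (fst q k - fst p k)" by simp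
      have "l k \<le> lev (u k - fst q k)" using elim q by (simp add: l_def)
      moreover have "lev (u k - fst q k) \<le> max (l k) (lev (fst q k - fst p k))"
        unfolding eq l_def by (rule lev_diff)
      moreover have "lev (u k - fst q k) = lev (fst q k - fst p k)" if "l k < lev (fst q k - fst p k)"
        unfolding eq using that unfolding l_def by (rule lev_diff_eq)
      ultimately show ?case
        by (cases "l k < lev (fst q k - fst p k)") (simp_all add: max.absorb1 max.absorb2)
    qed
    define t where "t q r D = ae (\<lambda>k. int (lev (u k - fst q k)) + D \<le> int (lev (fst r k)))"
      for q r :: "(nat \<Rightarrow> 'a) \<times> (nat \<Rightarrow> 'a)" and D
    have t: "ae (\<lambda>k. (int (max (l' k) (lev (snd q k - snd p k))) + D \<le> int (lev (snd r k))) = t q r D)"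
      if q: "q \<in> F" and r: "r \<in> F" and D: "D \<in> {- int K..int K}" for q r D
    proof -
      have "t q r D = ae (\<lambda>k. int (l k) + D \<le> int (lev (fst r k)) \<and>
          int (lev (fst (d q p) k)) + D \<le> int (lev (fst r k)))"
        unfolding t_def
        by (rule ae_cong) (use unprimed[OF q] in \<open>eventually_elim; auto simp: d_def max_def\<close>)
      also have "\<dots> = (ae (\<lambda>k. int (l k) + D \<le> int (lev (fst r k))) \<and>
          ae (\<lambda>k. int (lev (fst (d q p) k)) + D \<le> int (lev (fst r k))))"
        by (rule eventually_conj_iff)
      also have "\<dots> = (ae (\<lambda>k. int (l' k) + D \<le> int (lev (snd r k))) \<and>
          ae (\<lambda>k. int (lev (snd (d q p) k)) + D \<le> int (lev (snd r k))))"
      proof -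
        have "ae (\<lambda>k. int (l k) + D \<le> int (lev (fst r k))) = ae (\<lambda>k. int (l' k) + D \<le> int (lev (snd r k)))"
          using r D by (intro l') (auto simp: B_def)
        moreover have "(fst (d q p), snd (d q p)) \<in> \<rho>" using \<open>B \<subseteq> \<rho>\<close> dB[OF q p] by auto
        then have "ae (\<lambda>k. int (lev (fst (d q p) k)) + D \<le> int (lev (fst r k))) =
            ae (\<lambda>k. int (lev (snd (d q p) k)) + D \<le> int (lev (snd r k)))"
          using F\<rho>[OF r] by (rule good_lev[OF good])
        ultimately show ?thesis by simp
      qed
      also have "\<dots> = ae (\<lambda>k. int (max (l' k) (lev (snd q k - snd p k))) + D \<le> int (lev (snd r k)))"
        unfolding eventually_conj_iff[symmetric]
        by (rule arg_cong[where f = ae]) (auto simp: d_def max_def fun_eq_iff)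
      finally show ?thesis using ae_truth by simp
    qed
    have "ae (\<lambda>k. \<forall>q\<in>F. \<forall>r\<in>F. \<forall>D\<in>{- int K..int K}.
        (int (max (l' k) (lev (snd q k - snd p k))) + D \<le> int (lev (snd r k))) = t q r D)"
      using t by (intro eventually_ball_finite F ballI) auto
    moreover have "ae (\<lambda>k. \<forall>q\<in>C. lev (snd q k - snd p k) \<le> l' k)"
      using in_C by (intro eventually_ball_finite C ballI)
    moreover have "ae (\<lambda>k. \<forall>q\<in>F - C. l' k < lev (snd q k - snd p k))"
      using not_C F by (intro eventually_ball_finite ballI) auto
    moreover have "ae (\<lambda>k. \<forall>q\<in>C. \<exists>r\<in>Rep. lev (snd q k - snd r k) < l' k)"
      using near by (intro eventually_ball_finite C ballI)
    ultimately show ?thesis using l'_N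
    proof eventually_elim
      case (elim k)
      define f where "f q = snd q k - snd p k" for q :: "(nat \<Rightarrow> 'a) \<times> (nat \<Rightarrow> 'a)"
      obtain X where X: "finite X" "card X = Suc m" "\<And>x. x \<in> X \<Longrightarrow> lev x \<le> l' k"
        "\<And>x y. x \<in> X \<Longrightarrow> y \<in> X \<Longrightarrow> x \<noteq> y \<Longrightarrow> lev (x - y) = l' k"
        using N[OF elim(5)] unfolding separated_def by blast
      \<comment> \<open>Pigeonhole: two of the m + 1 elements of X near the same one of the m
        representatives would be closer than l' to each other.\<close>
      have "\<exists>x\<in>X. \<forall>r\<in>Rep. \<not> lev (x - f r) < l' k"
      proof (rule ccontr)
        assume "\<not> ?thesis"
        then obtain h where h: "\<And>x. x \<in> X \<Longrightarrow> h x \<in> Rep \<and> lev (x - f (h x)) < l' k" by metis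
        have "card (h ` X) \<le> card Rep" using h by (intro card_mono fin_Rep) auto
        then have "\<not> inj_on h X" using X(2) by (intro pigeonhole) (simp add: m_def)
        then obtain x y where xy: "x \<in> X" "y \<in> X" "x \<noteq> y" "h x = h y" by (auto simp: inj_on_def)
        have "lev (x - y) = lev ((x - f (h x)) - (y - f (h y)))" using xy by simp
        also have "\<dots> < l' k" using h[OF xy(1)] h[OF xy(2)] lev_diff le_less_trans max_less_iff_conj by metis
        finally show False using X(4) xy by simp
      qed
      then obtain x where x: "x \<in> X" "\<And>r. r \<in> Rep \<Longrightarrow> l' k \<le> lev (x - f r)" by (auto simp: not_less)
      have xC: "lev (x - f q) = l' k" if q: "q \<in> C" for q
      proof -
        obtain r where r: "r \<in> Rep" "lev (snd q k - snd r k) < l' k" using elim(4) q by blast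
        have fr: "lev (f r) \<le> l' k" using elim(2) r Rep_C by (auto simp: f_def)
        have xr: "lev (x - f r) = l' k"
          using x(2)[OF r(1)] X(3)[OF x(1)] fr lev_diff[of x "f r"] by simp
        have eq: "x - f q = (x - f r) - (snd q k - snd r k)" by (simp add: f_def)
        show ?thesis unfolding eq using lev_diff_eq'[of "snd q k - snd r k" "x - f r"] r xr by simp
      qed
      have lx: "lev x = l' k" using xC[OF C(3)] by (simp add: f_def)
      have "lev (x + snd p k - snd q k) = max (l' k) (lev (f q))" if q: "q \<in> F" for q
      proof -
        have eq: "x + snd p k - snd q k = x - f q" by (simp add: f_def)
        show ?thesis
        proof (cases "q \<in> C")
          case True
          then show ?thesis unfolding eq using xC elim(2) by (auto simp: f_def)
        next
          case False
          then have "lev x < lev (f q)" using elim(3) q lx by (auto simp: f_def)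
          then show ?thesis unfolding eq using lev_diff_eq lx by simp
        qed
      qed
      then show ?case using elim(1) unfolding t_def f_def by (intro exI[of _ "x + snd p k"]) simp
    qed
  qed
qed

text \<open>Exhaust the countable correspondence by finite sets F n and the shifts by windows of
  radius n. The growing finite conditions are satisfiable, so one sequence solves them all by
  saturation.\<close>

lemma ex_same_type: "\<exists>w. same_type \<rho> u w"
proof -
  let ?Z = "((\<lambda>_. 0), (\<lambda>_. 0)) :: (nat \<Rightarrow> 'a) \<times> (nat \<Rightarrow> 'a)"
  have Z: "?Z \<in> \<rho>" using good_const[OF good] by blast
  define F where "F n = insert ?Z (from_nat_into \<rho> ` {..<n})" for n :: nat
  have F: "finite (F n)" "F n \<subseteq> \<rho>" "?Z \<in> F n" for n
    using Z by (auto simp: F_def intro: from_nat_into)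
  have F_mono: "F m \<subseteq> F n" if "m \<le> n" for m n using that by (auto simp: F_def)
  have F_ex: "\<exists>n. q \<in> F n" if "q \<in> \<rho>" for q
    using from_nat_into_surj[OF good_countable[OF good] that] by (auto simp: F_def)
  define t where "t q r D = ae (\<lambda>k. int (lev (u k - fst q k)) + D \<le> int (lev (fst r k)))"
    for q r :: "(nat \<Rightarrow> 'a) \<times> (nat \<Rightarrow> 'a)" and D
  define C where "C n k x \<longleftrightarrow> (\<forall>q\<in>F n. \<forall>r\<in>F n. \<forall>D\<in>{- int n..int n}.
      int (lev (x - snd q k)) + D \<le> int (lev (snd r k)) \<longleftrightarrow> t q r D)" for n k x
  have "\<exists>w. \<forall>n. ae (\<lambda>k. C n k (w k))"
  proof (rule saturation)
    show "ae (\<lambda>k. \<exists>x. C n k x)" for n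
      unfolding C_def t_def by (rule finite_satisfiability[OF F])
    show "C m k x" if "m \<le> n" "C n k x" for m n k x
    proof -
      have "{- int m..int m} \<subseteq> {- int n..int n}" using that(1) by auto
      then show ?thesis using that(2) F_mono[OF that(1)] unfolding C_def by blast
    qed
  qed
  then obtain w where w: "\<And>n. ae (\<lambda>k. C n k (w k))" by blast
  have "same_type \<rho> u w"
    unfolding same_type_def
  proof (intro allI impI)
    fix a a' b b' and D :: int
    assume "(a, a') \<in> \<rho>" "(b, b') \<in> \<rho>"
    then obtain i j where "(a, a') \<in> F i" "(b, b') \<in> F j" using F_ex by meson
    then have ij: "(a, a') \<in> F (max (max i j) (nat \<bar>D\<bar>))" "(b, b') \<in> F (max (max i j) (nat \<bar>D\<bar>))"
      using F_mono by (meson in_mono max.cobounded1 max.cobounded2 order_trans)+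
    have "ae (\<lambda>k. int (lev (w k - a' k)) + D \<le> int (lev (b' k)) \<longleftrightarrow> t (a, a') (b, b') D)"
      using w[of "max (max i j) (nat \<bar>D\<bar>)"]
    proof eventually_elim
      case (elim k)
      have "D \<in> {- int (max (max i j) (nat \<bar>D\<bar>))..int (max (max i j) (nat \<bar>D\<bar>))}" by auto
      with elim show ?case unfolding C_def using ij by fastforce
    qed
    then have "ae (\<lambda>k. int (lev (w k - a' k)) + D \<le> int (lev (b' k))) = t (a, a') (b, b') D"
      by (rule ae_iffI)
    then show "ae (\<lambda>k. int (lev (u k - a k)) + D \<le> int (lev (b k))) =
        ae (\<lambda>k. int (lev (w k - a' k)) + D \<le> int (lev (b' k)))"
      by (simp add: t_def)
  qed
  then show ?thesis by blast
qed

end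

end

section \<open>Extending correspondences\<close>

context leveled_group_ultra begin

text \<open>Points of the ultrapower are sequences modulo equality along U, whereas \<rho> contains
  individual sequences.\<close>

definition represents ::
    "((nat \<Rightarrow> 'a) \<times> (nat \<Rightarrow> 'a)) set \<Rightarrow> (nat \<Rightarrow> 'a) \<Rightarrow> (nat \<Rightarrow> 'a) \<Rightarrow> bool" where
  "represents \<rho> u w \<longleftrightarrow> (\<exists>a a'. (a, a') \<in> \<rho> \<and> ae (\<lambda>k. u k = a k) \<and> ae (\<lambda>k. w k = a' k))"

lemma represents_mem: "(a, a') \<in> \<rho> \<Longrightarrow> represents \<rho> a a'"
  unfolding represents_def by (intro exI[of _ a] exI[of _ a'] conjI) simp_all

lemma ex_nonzero: "\<exists>x::'a. x \<noteq> 0"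
  using lev_surj[of 1] by (metis lev_zero zero_neq_one)

lemma not_kills_prod: "finite A \<Longrightarrow> \<forall>c\<in>A. \<not> kills c \<Longrightarrow> \<not> kills (\<Prod>c\<in>A. c)"
proof (induction A rule: finite_induct)
  case empty
  then show ?case using ex_nonzero by (simp add: kills_def)
next
  case (insert c A)
  then show ?case using not_kills_mult by simp
qed

text \<open>The i-th term is the product of the non-annihilating integers from 1 to i. Dividing
  successively by these terms therefore divides by every non-annihilating integer at some
  stage.\<close>

lemma divisible_chain:
  "\<exists>n::nat \<Rightarrow> int. (\<forall>i. \<not> kills (n i)) \<and> (\<forall>i c. \<not> kills c \<longrightarrow> \<bar>c\<bar> \<le> int i \<longrightarrow> c dvd n i)"
proof -
  define n where "n i = (\<Prod>c\<in>{c\<in>{1..int i}. \<not> kills c}. c)" for i :: nat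
  have fin: "finite {c\<in>{1..int i}. \<not> kills c}" for i
    by (rule finite_subset[of _ "{1..int i}"]) auto
  have "\<not> kills (n i)" for i unfolding n_def by (rule not_kills_prod[OF fin]) auto
  moreover have "c dvd n i" if "\<not> kills c" "\<bar>c\<bar> \<le> int i" for c i
  proof -
    have "c \<noteq> 0" using that kills_0 by auto
    then have "\<bar>c\<bar> \<in> {c\<in>{1..int i}. \<not> kills c}" using that not_kills_abs by auto
    then have "\<bar>c\<bar> dvd n i" unfolding n_def by (rule dvd_prodI[OF fin])
    then show ?thesis by simp
  qed
  ultimately show ?thesis by blast
qed

lemma lev_zmul_large:
  assumes "\<not> kills c"
  shows "\<exists>d. \<forall>y. (\<forall>n. ae (\<lambda>k. n < lev (y k))) \<longrightarrow> ae (\<lambda>k. lev (zmul c (y k)) + d = lev (y k))"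
proof -
  obtain d N where dN: "\<And>x. N < lev x \<Longrightarrow> lev (zmul c x) + d = lev x"
    using assms zmul_shift unfolding kills_def by metis
  show ?thesis
  proof (intro exI allI impI)
    fix y :: "nat \<Rightarrow> 'a" assume "\<forall>n. ae (\<lambda>k. n < lev (y k))"
    then have "ae (\<lambda>k. N < lev (y k))" by blast
    then show "ae (\<lambda>k. lev (zmul c (y k)) + d = lev (y k))" by eventually_elim (rule dN)
  qed
qed

context
  fixes \<rho> u w
  assumes good: "good \<rho>" and same: "same_type \<rho> u w"
begin

lemma same_typeD:
  "(a, a') \<in> \<rho> \<Longrightarrow> (b, b') \<in> \<rho> \<Longrightarrow>
    ae (\<lambda>k. int (lev (u k - a k)) + D \<le> int (lev (b k))) =
    ae (\<lambda>k. int (lev (w k - a' k)) + D \<le> int (lev (b' k)))"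
  by (rule same[unfolded same_type_def, rule_format])

lemma represents_if_eq:
  assumes a: "(a, a') \<in> \<rho>" "ae (\<lambda>k. u k = a k)"
  shows "represents \<rho> u w"
proof -
  have "ae (\<lambda>k. int (lev (u k - a k)) + 0 \<le> int (lev 0))" using a(2) by eventually_elim simp
  then have "ae (\<lambda>k. int (lev (w k - a' k)) + 0 \<le> int (lev 0))"
    using same_typeD[OF a(1) good_const[OF good]] by blast
  then have "ae (\<lambda>k. w k = a' k)" by eventually_elim (simp add: lev_eq_0_iff)
  then show ?thesis using a unfolding represents_def by blast
qed

text \<open>A bounded difference u - a is a constant g, and then a + g would represent u. The bound
  on the side of w follows by comparison with a constant of level n.\<close>

lemma large_if_not_represented:
  assumes nr: "\<not> represents \<rho> u w" and a: "(a, a') \<in> \<rho>"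
  shows "ae (\<lambda>k. n < lev (u k - a k)) \<and> ae (\<lambda>k. n < lev (w k - a' k))"
proof -
  have nle: "\<not> ae (\<lambda>k. lev (u k - a k) \<le> n)"
  proof
    assume "ae (\<lambda>k. lev (u k - a k) \<le> n)"
    from ae_bounded_const[OF this] obtain g where "ae (\<lambda>k. u k - a k = g)" by (elim exE)
    then have "ae (\<lambda>k. u k = a k + g)" by eventually_elim (simp add: algebra_simps)
    then show False using represents_if_eq[OF good_add[OF good a good_const[OF good, of g]]] nr by blast
  qed
  obtain g where g: "lev g = n" using lev_surj by blast
  have "ae (\<lambda>k. int (lev (u k - a k)) + 0 \<le> int (lev g)) =
      ae (\<lambda>k. int (lev (w k - a' k)) + 0 \<le> int (lev g))"
    by (rule same_typeD[OF a good_const[OF good]])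
  then have "\<not> ae (\<lambda>k. lev (w k - a' k) \<le> n)" using nle g by simp
  then have "ae (\<lambda>k. \<not> lev (w k - a' k) \<le> n)" "ae (\<lambda>k. \<not> lev (u k - a k) \<le> n)"
    using nle by (simp_all only: ae_not not_False_eq_True)
  then show ?thesis by (simp add: not_le)
qed

text \<open>A positive shift makes the inequality strict, so the larger of the two distances from u
  equals lev (a - b), the level of an old element. Nonpositive shifts are reached from here by
  negation.\<close>

lemma compare_differences_pos:
  assumes a: "(a, a') \<in> \<rho>" and b: "(b, b') \<in> \<rho>" and D: "D \<ge> 1"
  shows "ae (\<lambda>k. int (lev (u k - a k)) + D \<le> int (lev (u k - b k))) =
    ae (\<lambda>k. int (lev (w k - a' k)) + D \<le> int (lev (w k - b' k)))"
proof -
  have eq: "int (lev (x - y)) + D \<le> int (lev (x - z)) \<longleftrightarrow> int (lev (x - y)) + D \<le> int (lev (y - z))" for x y z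
  proof
    assume h: "int (lev (x - y)) + D \<le> int (lev (x - z))"
    then have "lev (x - y) < lev (x - z)" using D by linarith
    from lev_diff_eq[OF this] have "lev (y - z) = lev (x - z)"
      using lev_diff_commute[of y z] by simp
    then show "int (lev (x - y)) + D \<le> int (lev (y - z))" using h by simp
  next
    assume h: "int (lev (x - y)) + D \<le> int (lev (y - z))"
    then have "lev (x - y) < lev (z - y)" using D lev_diff_commute[of y z] by linarith
    from lev_diff_eq[OF this] have "lev (x - z) = lev (y - z)"
      using lev_diff_commute[of y z] by simp
    then show "int (lev (x - y)) + D \<le> int (lev (x - z))" using h by simp
  qed
  show ?thesis unfolding eq by (rule same_typeD[OF a good_diff[OF good a b]])
qed

lemma compare_differences:
  assumes a: "(a, a') \<in> \<rho>" and b: "(b, b') \<in> \<rho>"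
  shows "ae (\<lambda>k. int (lev (u k - a k)) + D \<le> int (lev (u k - b k))) =
    ae (\<lambda>k. int (lev (w k - a' k)) + D \<le> int (lev (w k - b' k)))"
proof (cases "D \<ge> 1")
  case True
  then show ?thesis by (rule compare_differences_pos[OF a b])
next
  case False
  have neg: "(s + D \<le> t) = (\<not> t + (1 - D) \<le> s)" for s t :: int by auto
  show ?thesis
    unfolding neg ae_not using compare_differences_pos[OF b a, of "1 - D"] False by simp
qed

lemma compare_element_difference:
  assumes a: "(a, a') \<in> \<rho>" and b: "(b, b') \<in> \<rho>"
  shows "ae (\<lambda>k. int (lev (b k)) + D \<le> int (lev (u k - a k))) =
    ae (\<lambda>k. int (lev (b' k)) + D \<le> int (lev (w k - a' k)))"
proof -
  have neg: "(s + D \<le> t) = (\<not> t + (1 - D) \<le> s)" for s t :: int by auto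
  show ?thesis unfolding neg ae_not using same_typeD[OF a b] by simp
qed

lemma extend_good:
  assumes nr: "\<not> represents \<rho> u w"
  shows "\<exists>\<rho>'. good \<rho>' \<and> \<rho> \<subseteq> \<rho>' \<and> (u, w) \<in> \<rho>'"
proof -
  \<comment> \<open>Adjoining \<open>u\<close> and \<open>w\<close> alone would destroy divisibility, so we adjoin chains \<open>V u\<close> and \<open>V w\<close> of
    successive quotients. Any choice of quotients works: the level of \<open>V u i + b\<close> is large, and hence
    determined by the level of its multiple \<open>u - a\<close>.\<close>
  from divisible_chain obtain n :: "nat \<Rightarrow> int" where n0: "\<forall>i. \<not> kills (n i)"
    and n': "\<forall>i c. \<not> kills c \<longrightarrow> \<bar>c\<bar> \<le> int i \<longrightarrow> c dvd n i" by (elim exE conjE)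
  note n = n0[rule_format] n'[rule_format]
  have div: "\<exists>y. \<forall>k. zmul (n i) (y k) = x k" for i and x :: "nat \<Rightarrow> 'a"
  proof -
    obtain y0 where "zmul (n i) y0 \<noteq> (0::'a)" using n(1)[of i] unfolding kills_def by blast
    then have "\<forall>k. \<exists>z. zmul (n i) z = x k" using zmul_surj by blast
    then show ?thesis by (rule choice)
  qed
  define next_el where "next_el i x = (SOME y. \<forall>k. zmul (n i) (y k) = x k)" for i and x :: "nat \<Rightarrow> 'a"
  have next_el: "zmul (n i) (next_el i x k) = x k" for i x k
    unfolding next_el_def by (rule someI_ex[OF div[of i x], THEN spec])
  define V where "V x = rec_nat x next_el" for x
  have V0: "V x 0 = x" and VS: "zmul (n i) (V x (Suc i) k) = V x i k" for x i k
    by (simp_all add: V_def next_el)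
  have V_le: "\<exists>M. \<not> kills M \<and> (\<forall>x k. V x i k = zmul M (V x j k))" if "i \<le> j" for i j
    using that
  proof (induction j rule: dec_induct)
    case base
    have "\<not> kills 1" using ex_nonzero by (simp add: kills_def)
    then show ?case by (intro exI[of _ 1]) simp
  next
    case (step j)
    then obtain M where M: "\<not> kills M" "\<forall>x k. V x i k = zmul M (V x j k)" by blast
    have "V x i k = zmul (M * n j) (V x (Suc j) k)" for x k
      using M(2) VS[of j x k] by (metis zmul.scale_scale)
    then show ?case using not_kills_mult[OF M(1) n(1)[of j]] by blast
  qed
  have V_div: "\<exists>j M. \<forall>x k. V x i k = zmul c (zmul M (V x j k))" if c: "\<not> kills c" for i c
  proof -
    define j where "j = max i (nat \<bar>c\<bar>)"
    obtain M where M: "\<forall>x k. V x i k = zmul M (V x j k)" using V_le[of i j] by (auto simp: j_def)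
    have "\<bar>c\<bar> \<le> int j" by (simp add: j_def)
    then obtain e where e: "n j = c * e" using n(2)[OF c] by (metis dvdE)
    have "V x i k = zmul c (zmul (M * e) (V x (Suc j) k))" for x k
    proof -
      have "V x i k = zmul (M * n j) (V x (Suc j) k)" using M VS[of j x k] by (metis zmul.scale_scale)
      also have "M * n j = c * (M * e)" using e by simp
      finally show ?thesis by simp
    qed
    then show ?thesis by blast
  qed
  \<comment> \<open>The new elements. Coefficient and stage are shared by the two sides; only the
    base sequence and the old summand change.\<close>
  define E where "E c i x a = (\<lambda>k. zmul c (V x i k) + a k)" for c i x and a :: "nat \<Rightarrow> 'a"
  define \<rho>' where "\<rho>' = {(E c i u a, E c i w a') |c i a a'. (a, a') \<in> \<rho>}"
  have mem: "(E c i u a, E c i w a') \<in> \<rho>'" if "(a, a') \<in> \<rho>" for c i a a'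
    using that by (auto simp: \<rho>'_def)
  have E0: "E 0 i x a = a" for i x a by (simp add: E_def)
  have sub: "\<rho> \<subseteq> \<rho>'" using mem[of _ _ 0 0] by (auto simp: E0)
  have E1: "E 1 0 x (\<lambda>_. 0) = x" for x by (simp add: E_def V0)
  have uw: "(u, w) \<in> \<rho>'" using mem[OF good_const[OF good, of 0], of 1 0] by (simp only: E1)
  have "\<rho>' = (\<lambda>(c, i, q). (E c i u (fst q), E c i w (snd q))) ` (UNIV \<times> UNIV \<times> \<rho>)"
    by (force simp: \<rho>'_def image_iff)
  then have countable: "countable \<rho>'" using good_countable[OF good] by simp
  have diff: "((\<lambda>k. e k - f k), (\<lambda>k. e' k - f' k)) \<in> \<rho>'" if ef: "(e, e') \<in> \<rho>'" "(f, f') \<in> \<rho>'" for e e' f f'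
  proof -
    obtain c i a a' where e: "e = E c i u a" "e' = E c i w a'" "(a, a') \<in> \<rho>" using ef by (auto simp: \<rho>'_def)
    obtain d j b b' where f: "f = E d j u b" "f' = E d j w b'" "(b, b') \<in> \<rho>" using ef by (auto simp: \<rho>'_def)
    obtain M where M: "\<forall>x k. V x i k = zmul M (V x (max i j) k)" using V_le[of i "max i j"] by auto
    obtain L where L: "\<forall>x k. V x j k = zmul L (V x (max i j) k)" using V_le[of j "max i j"] by auto
    have "(\<lambda>k. E c i x a k - E d j x b k) = E (c * M - d * L) (max i j) x (\<lambda>k. a k - b k)" for x a b
      using M L by (simp add: E_def fun_eq_iff zmul.scale_left_diff_distrib)
    then show ?thesis using mem[OF good_diff[OF good e(3) f(3)]] e f by simp
  qed
  have divide: "\<exists>f f'. (f, f') \<in> \<rho>' \<and> (\<forall>k. e k = zmul c (f k)) \<and> (\<forall>k. e' k = zmul c (f' k))"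
    if ee: "(e, e') \<in> \<rho>'" and c: "\<not> kills c" for e e' c
  proof -
    obtain d i a a' where e: "e = E d i u a" "e' = E d i w a'" "(a, a') \<in> \<rho>" using ee by (auto simp: \<rho>'_def)
    obtain b b' where b: "(b, b') \<in> \<rho>" "\<forall>k. a k = zmul c (b k)" "\<forall>k. a' k = zmul c (b' k)"
      using good_divide[OF good e(3) c] by blast
    obtain j M where M: "\<forall>x k. V x i k = zmul c (zmul M (V x j k))" using V_div[OF c] by blast
    have "E d i x (\<lambda>k. zmul c (b k)) k = zmul c (E (d * M) j x b k)" for x b k
      using M by (simp add: E_def zmul.scale_right_distrib mult.commute mult.left_commute)
    moreover have "a = (\<lambda>k. zmul c (b k))" "a' = (\<lambda>k. zmul c (b' k))" using b by auto
    ultimately show ?thesis using mem[OF b(1)] e by (intro exI[of _ "E (d * M) j u b"] exI[of _ "E (d * M) j w b'"]) simp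
  qed
  \<comment> \<open>Each element of the extension is old or has the level of some u - a up to an
    integer shift, with the same shift on both sides. All level comparisons thus reduce to the known
    ones.\<close>
  have classify: "(e, e') \<in> \<rho> \<or> (\<exists>a a' s. (a, a') \<in> \<rho> \<and>
      ae (\<lambda>k. int (lev (e k)) = int (lev (u k - a k)) + s) \<and>
      ae (\<lambda>k. int (lev (e' k)) = int (lev (w k - a' k)) + s))" if ee: "(e, e') \<in> \<rho>'" for e e'
  proof -
    obtain c i a a' where e: "e = E c i u a" "e' = E c i w a'" "(a, a') \<in> \<rho>" using ee by (auto simp: \<rho>'_def)
    show ?thesis
    proof (cases "kills c")
      case True
      then show ?thesis using e by (simp add: E_def kills_def)
    next
      case False
      obtain b b' where b: "(b, b') \<in> \<rho>" "\<forall>k. a k = zmul c (b k)" "\<forall>k. a' k = zmul c (b' k)"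
        using good_divide[OF good e(3) False] by blast
      obtain M where M: "\<not> kills M" "\<forall>x k. V x 0 k = zmul M (V x i k)" using V_le[of 0 i] by auto
      obtain dc where dc: "\<And>y. (\<And>n. ae (\<lambda>k. n < lev (y k))) \<Longrightarrow> ae (\<lambda>k. lev (zmul c (y k)) + dc = lev (y k))"
        using lev_zmul_large[OF False] by blast
      obtain dM where dM: "\<And>y. (\<And>n. ae (\<lambda>k. n < lev (y k))) \<Longrightarrow> ae (\<lambda>k. lev (zmul M (y k)) + dM = lev (y k))"
        using lev_zmul_large[OF M(1)] by blast
      \<comment> \<open>With a = c b, the new element is c y for y = V x i + b, while M y = x + M b
        = x - h. Levels drop by dc and dM respectively, whence the shift dM - dc.\<close>
      define h where "h = (\<lambda>k. zmul (- M) (b k))"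
      define h' where "h' = (\<lambda>k. zmul (- M) (b' k))"
      have h\<rho>: "(h, h') \<in> \<rho>" unfolding h_def h'_def by (rule good_zmul[OF good b(1)])
      have key: "ae (\<lambda>k. int (lev (E c i x a k)) = int (lev (x k - h k)) + (int dM - int dc))"
        if large: "\<And>n. ae (\<lambda>k. n < lev (x k - h k))" and a: "\<forall>k. a k = zmul c (b k)"
          and h: "h = (\<lambda>k. zmul (- M) (b k))" for x a b h
      proof -
        define y where "y k = V x i k + b k" for k
        have My: "zmul M (y k) = x k - h k" for k
          using M(2) V0 by (simp add: y_def h zmul.scale_right_distrib)
        \<comment> \<open>Multiples never raise the level, so y is at least as large as x - h and
          the exact shift laws apply to it.\<close>
        have "ae (\<lambda>k. n < lev (y k))" for n
          using large[of n] by eventually_elim (metis My lev_zmul less_le_trans)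
        then have "ae (\<lambda>k. lev (zmul c (y k)) + dc = lev (y k))" "ae (\<lambda>k. lev (zmul M (y k)) + dM = lev (y k))"
          using dc dM by blast+
        moreover have "E c i x a k = zmul c (y k)" for k
          using a by (simp add: E_def y_def zmul.scale_right_distrib)
        ultimately show ?thesis by (auto simp: My elim: eventually_elim2)
      qed
      have "ae (\<lambda>k. int (lev (e k)) = int (lev (u k - h k)) + (int dM - int dc))"
        unfolding e by (rule key[OF _ b(2) h_def]) (use large_if_not_represented[OF nr h\<rho>] in blast)
      moreover have "ae (\<lambda>k. int (lev (e' k)) = int (lev (w k - h' k)) + (int dM - int dc))"
        unfolding e by (rule key[OF _ b(3) h'_def]) (use large_if_not_represented[OF nr h\<rho>] in blast)
      ultimately show ?thesis using h\<rho> by blast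
    qed
  qed
  have shift_cong: "ae (\<lambda>k. (x k :: int) + D \<le> y k) = ae (\<lambda>k. x' k + (s + D - t) \<le> y' k)"
    if "ae (\<lambda>k. x k = x' k + s)" "ae (\<lambda>k. y k = y' k + t)" for x y x' y' s t D
  proof (rule ae_cong)
    show "ae (\<lambda>k. (x k + D \<le> y k) = (x' k + (s + D - t) \<le> y' k))"
      using that by eventually_elim auto
  qed
  have refl0: "ae (\<lambda>k. x k = x k + (0::int))" for x by simp
  have lev: "ae (\<lambda>k. int (lev (e k)) + D \<le> int (lev (f k))) = ae (\<lambda>k. int (lev (e' k)) + D \<le> int (lev (f' k)))"
    if ee: "(e, e') \<in> \<rho>'" and ff: "(f, f') \<in> \<rho>'" for e e' f f' D
    using classify[OF ee]
  proof (elim disjE exE conjE)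
    assume e: "(e, e') \<in> \<rho>"
    show ?thesis using classify[OF ff]
    proof (elim disjE exE conjE)
      assume f: "(f, f') \<in> \<rho>"
      show ?thesis by (rule good_lev[OF good e f])
    next
      fix b b' t assume b: "(b, b') \<in> \<rho>" and
        t: "ae (\<lambda>k. int (lev (f k)) = int (lev (u k - b k)) + t)"
           "ae (\<lambda>k. int (lev (f' k)) = int (lev (w k - b' k)) + t)"
      show ?thesis
        unfolding shift_cong[OF refl0 t(1)] shift_cong[OF refl0 t(2)]
        by (rule compare_element_difference[OF b e])
    qed
  next
    fix a a' s assume a: "(a, a') \<in> \<rho>" and
      s: "ae (\<lambda>k. int (lev (e k)) = int (lev (u k - a k)) + s)"
         "ae (\<lambda>k. int (lev (e' k)) = int (lev (w k - a' k)) + s)"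
    show ?thesis using classify[OF ff]
    proof (elim disjE exE conjE)
      assume f: "(f, f') \<in> \<rho>"
      show ?thesis
        unfolding shift_cong[OF s(1) refl0] shift_cong[OF s(2) refl0]
        by (rule same_typeD[OF a f])
    next
      fix b b' t assume b: "(b, b') \<in> \<rho>" and
        t: "ae (\<lambda>k. int (lev (f k)) = int (lev (u k - b k)) + t)"
           "ae (\<lambda>k. int (lev (f' k)) = int (lev (w k - b' k)) + t)"
      show ?thesis
        unfolding shift_cong[OF s(1) t(1)] shift_cong[OF s(2) t(2)]
        by (rule compare_differences[OF a b])
    qed
  qed
  have "good \<rho>'"
    unfolding good_def
  proof (intro conjI allI impI)
    show "((\<lambda>_. g), (\<lambda>_. g)) \<in> \<rho>'" for g using sub good_const[OF good] by blast
  qed (fact countable | rule diff divide lev; assumption)+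
  then show ?thesis using sub uw by blast
qed

lemma extend:
  "\<exists>\<rho>'. good \<rho>' \<and> \<rho> \<subseteq> \<rho>' \<and> represents \<rho>' u w"
proof (cases "represents \<rho> u w")
  case False
  then obtain \<rho>' where "good \<rho>'" "\<rho> \<subseteq> \<rho>'" "(u, w) \<in> \<rho>'" using extend_good by blast
  moreover from this(3) have "represents \<rho>' u w" by (rule represents_mem)
  ultimately show ?thesis by blast
qed (use good in blast)

end

end

section \<open>Transfer of formulas\<close>

context leveled_group_ultra begin

lemma represents_converse: "represents \<rho> u w \<Longrightarrow> represents (\<rho>\<inverse>) w u"
  unfolding represents_def converse_iff by blast

lemma represents_mono: "represents \<rho> u w \<Longrightarrow> \<rho> \<subseteq> \<rho>' \<Longrightarrow> represents \<rho>' u w"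
  unfolding represents_def by blast

text \<open>Values are represented by group elements having them, so that a move in the value sort
  becomes a move in the group.\<close>

definition represents_value ::
    "('a \<Rightarrow> 'g) \<Rightarrow> ((nat \<Rightarrow> 'a) \<times> (nat \<Rightarrow> 'a)) set \<Rightarrow> (nat \<Rightarrow> 'g) \<Rightarrow> (nat \<Rightarrow> 'g) \<Rightarrow> bool" where
  "represents_value v \<rho> \<beta> \<gamma> \<longleftrightarrow>
     (\<exists>a a'. (a, a') \<in> \<rho> \<and> ae (\<lambda>k. \<beta> k = v (a k)) \<and> ae (\<lambda>k. \<gamma> k = v (a' k)))"

lemma represents_value_converse: "represents_value v \<rho> u w \<Longrightarrow> represents_value v (\<rho>\<inverse>) w u"
  unfolding represents_value_def converse_iff by blast

lemma represents_value_mono: "represents_value v \<rho> u w \<Longrightarrow> \<rho> \<subseteq> \<rho>' \<Longrightarrow> represents_value v \<rho>' u w"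
  unfolding represents_value_def by blast

lemma represents_value_mem: "(a, a') \<in> \<rho> \<Longrightarrow> represents_value v \<rho> (\<lambda>k. v (a k)) (\<lambda>k. v (a' k))"
  unfolding represents_value_def by (intro exI[of _ a] exI[of _ a'] conjI) simp_all

lemma represents_imp_represents_value:
  assumes "represents \<rho> u w"
  shows "represents_value v \<rho> (\<lambda>k. v (u k)) (\<lambda>k. v (w k))"
proof -
  obtain a a' where a: "(a, a') \<in> \<rho>" "ae (\<lambda>k. u k = a k)" "ae (\<lambda>k. w k = a' k)"
    using assms unfolding represents_def by blast
  have "ae (\<lambda>k. v (u k) = v (a k))" using a(2) by eventually_elim simp
  moreover have "ae (\<lambda>k. v (w k) = v (a' k))" using a(3) by eventually_elim simp
  ultimately show ?thesis using a(1) unfolding represents_value_def by blast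
qed

context
  fixes v :: "'a \<Rightarrow> 'g::{linorder, order_top}"
  assumes v_le_iff: "\<And>x y. v x \<le> v y \<longleftrightarrow> lev y \<le> lev x"
    and surj_v: "surj v" and v_zero: "v 0 = top"
begin

text \<open>The invariant of the back and forth game: two sequences of assignments matched by one
  good correspondence.\<close>

definition position ::
    "((nat \<Rightarrow> 'a) \<times> (nat \<Rightarrow> 'a)) set \<Rightarrow> (nat \<Rightarrow> nat \<Rightarrow> 'a) \<Rightarrow> (nat \<Rightarrow> nat \<Rightarrow> 'a) \<Rightarrow>
      (nat \<Rightarrow> nat \<Rightarrow> 'g) \<Rightarrow> (nat \<Rightarrow> nat \<Rightarrow> 'g) \<Rightarrow> bool" where
  "position \<rho> s t \<beta> \<gamma> \<longleftrightarrow> good \<rho> \<and> (\<forall>i. represents \<rho> (\<lambda>k. s k i) (\<lambda>k. t k i)) \<and>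
     (\<forall>i. represents_value v \<rho> (\<lambda>k. \<beta> k i) (\<lambda>k. \<gamma> k i))"

lemma position_converse: "position \<rho> s t \<beta> \<gamma> \<Longrightarrow> position (\<rho>\<inverse>) t s \<gamma> \<beta>"
  unfolding position_def by (simp add: good_converse represents_converse represents_value_converse)

lemma position_upd_group:
  assumes "position \<rho> s t \<beta> \<gamma>" "good \<rho>'" "\<rho> \<subseteq> \<rho>'" "represents \<rho>' u w"
  shows "position \<rho>' (\<lambda>k. (s k)(i := u k)) (\<lambda>k. (t k)(i := w k)) \<beta> \<gamma>"
proof -
  have g: "represents \<rho>' (\<lambda>k. s k j) (\<lambda>k. t k j)" for j
    using assms(1) by (intro represents_mono[OF _ assms(3)]) (simp add: position_def)
  have v: "represents_value v \<rho>' (\<lambda>k. \<beta> k j) (\<lambda>k. \<gamma> k j)" for j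
    using assms(1) by (intro represents_value_mono[OF _ assms(3)]) (simp add: position_def)
  have "represents \<rho>' (\<lambda>k. ((s k)(i := u k)) j) (\<lambda>k. ((t k)(i := w k)) j)" for j
    using assms(4) g[of j] by (cases "j = i") simp_all
  then show ?thesis unfolding position_def using assms(2) v by blast
qed

lemma position_upd_value:
  assumes "position \<rho> s t \<beta> \<gamma>" "good \<rho>'" "\<rho> \<subseteq> \<rho>'" "represents_value v \<rho>' u w"
  shows "position \<rho>' s t (\<lambda>k. (\<beta> k)(i := u k)) (\<lambda>k. (\<gamma> k)(i := w k))"
proof -
  have g: "represents \<rho>' (\<lambda>k. s k j) (\<lambda>k. t k j)" for j
    using assms(1) by (intro represents_mono[OF _ assms(3)]) (simp add: position_def)
  have v: "represents_value v \<rho>' (\<lambda>k. \<beta> k j) (\<lambda>k. \<gamma> k j)" for j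
    using assms(1) by (intro represents_value_mono[OF _ assms(3)]) (simp add: position_def)
  have "represents_value v \<rho>' (\<lambda>k. ((\<beta> k)(i := u k)) j) (\<lambda>k. ((\<gamma> k)(i := w k)) j)" for j
    using assms(4) v[of j] by (cases "j = i") simp_all
  then show ?thesis unfolding position_def using assms(2) g by blast
qed

lemma represents_eval_g:
  assumes p: "position \<rho> s t \<beta> \<gamma>"
  shows "represents \<rho> (\<lambda>k. eval_g (s k) \<tau>) (\<lambda>k. eval_g (t k) \<tau>)"
proof -
  have good: "good \<rho>" using p by (simp add: position_def)
  show ?thesis
  proof (induction \<tau>)
    case (GVar i)
    then show ?case using p by (simp add: position_def)
  next
    case GZero
    then show ?case using represents_mem[OF good_const[OF good, of 0]] by simp
  next
    case (GAdd \<sigma> \<tau>)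
    obtain a a' where a: "(a, a') \<in> \<rho>" "ae (\<lambda>k. eval_g (s k) \<sigma> = a k)" "ae (\<lambda>k. eval_g (t k) \<sigma> = a' k)"
      using GAdd.IH(1) unfolding represents_def by blast
    obtain b b' where b: "(b, b') \<in> \<rho>" "ae (\<lambda>k. eval_g (s k) \<tau> = b k)" "ae (\<lambda>k. eval_g (t k) \<tau> = b' k)"
      using GAdd.IH(2) unfolding represents_def by blast
    have "ae (\<lambda>k. eval_g (s k) (GAdd \<sigma> \<tau>) = a k + b k)" using a(2) b(2) by eventually_elim simp
    moreover have "ae (\<lambda>k. eval_g (t k) (GAdd \<sigma> \<tau>) = a' k + b' k)" using a(3) b(3) by eventually_elim simp
    ultimately show ?case
      unfolding represents_def
      by (intro exI[of _ "\<lambda>k. a k + b k"] exI[of _ "\<lambda>k. a' k + b' k"] conjI good_add[OF good a(1) b(1)])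
  qed
qed

lemma represents_eval_v:
  assumes p: "position \<rho> s t \<beta> \<gamma>"
  shows "represents_value v \<rho> (\<lambda>k. eval_v v (s k) (\<beta> k) \<tau>) (\<lambda>k. eval_v v (t k) (\<gamma> k) \<tau>)"
proof (cases \<tau>)
  case (VVar i)
  then show ?thesis using p by (simp add: position_def)
next
  case VInfty
  have "((\<lambda>_. 0), (\<lambda>_. 0)) \<in> \<rho>" using p good_const by (simp add: position_def)
  then show ?thesis using VInfty represents_value_mem[of _ _ \<rho> v] v_zero by fastforce
next
  case (Val \<sigma>)
  then show ?thesis using represents_imp_represents_value[OF represents_eval_g[OF p]] by simp
qed

lemma represents_eq:
  assumes good: "good \<rho>" and r: "represents \<rho> u w" "represents \<rho> u' w'" and eq: "ae (\<lambda>k. u k = u' k)"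
  shows "ae (\<lambda>k. w k = w' k)"
proof -
  obtain a a' where a: "(a, a') \<in> \<rho>" "ae (\<lambda>k. u k = a k)" "ae (\<lambda>k. w k = a' k)"
    using r(1) unfolding represents_def by blast
  obtain b b' where b: "(b, b') \<in> \<rho>" "ae (\<lambda>k. u' k = b k)" "ae (\<lambda>k. w' k = b' k)"
    using r(2) unfolding represents_def by blast
  have "ae (\<lambda>k. int (lev (a k - b k)) + 0 \<le> int (lev 0))"
    using eq a(2) b(2) by eventually_elim simp
  then have "ae (\<lambda>k. int (lev (a' k - b' k)) + 0 \<le> int (lev 0))"
    using good_lev[OF good good_diff[OF good a(1) b(1)] good_const[OF good]] by blast
  then show ?thesis using a(3) b(3) by eventually_elim (simp add: lev_eq_0_iff)
qed

lemma represents_value_le: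
  assumes good: "good \<rho>" and r: "represents_value v \<rho> u w" "represents_value v \<rho> u' w'"
    and le: "ae (\<lambda>k. u k \<le> u' k)"
  shows "ae (\<lambda>k. w k \<le> w' k)"
proof -
  obtain a a' where a: "(a, a') \<in> \<rho>" "ae (\<lambda>k. u k = v (a k))" "ae (\<lambda>k. w k = v (a' k))"
    using r(1) unfolding represents_value_def by blast
  obtain b b' where b: "(b, b') \<in> \<rho>" "ae (\<lambda>k. u' k = v (b k))" "ae (\<lambda>k. w' k = v (b' k))"
    using r(2) unfolding represents_value_def by blast
  have "ae (\<lambda>k. int (lev (b k)) + 0 \<le> int (lev (a k)))"
    using le a(2) b(2) by eventually_elim (simp add: v_le_iff)
  then have "ae (\<lambda>k. int (lev (b' k)) + 0 \<le> int (lev (a' k)))"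
    using good_lev[OF good b(1) a(1)] by blast
  then show ?thesis using a(3) b(3) by eventually_elim (simp add: v_le_iff)
qed

text \<open>One implication suffices: negation applies the induction hypothesis to the converse
  correspondence. At a quantifier, the witnesses form a sequence u; a w of the same type is found by
  saturation, and the correspondence is extended to the pair.\<close>

lemma sat_transfer:
  "position \<rho> s t \<beta> \<gamma> \<Longrightarrow> ae (\<lambda>k. sat_vg v (s k) (\<beta> k) \<phi>) \<Longrightarrow> ae (\<lambda>k. sat_vg v (t k) (\<gamma> k) \<phi>)"
proof (induction \<phi> arbitrary: \<rho> s t \<beta> \<gamma>)
  case (GEq \<sigma> \<tau>)
  have "good \<rho>" using GEq.prems(1) by (simp add: position_def)
  from represents_eq[OF this represents_eval_g[OF GEq.prems(1)] represents_eval_g[OF GEq.prems(1)]]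
  show ?case using GEq.prems(2) by simp
next
  case (VLe \<sigma> \<tau>)
  have "good \<rho>" using VLe.prems(1) by (simp add: position_def)
  from represents_value_le[OF this represents_eval_v[OF VLe.prems(1)] represents_eval_v[OF VLe.prems(1)]]
  show ?case using VLe.prems(2) by simp
next
  case (VEq \<sigma> \<tau>)
  have "good \<rho>" using VEq.prems(1) by (simp add: position_def)
  note le = represents_value_le[OF this represents_eval_v[OF VEq.prems(1)] represents_eval_v[OF VEq.prems(1)]]
  have eq: "ae (\<lambda>k. eval_v v (s k) (\<beta> k) \<sigma> = eval_v v (s k) (\<beta> k) \<tau>)" using VEq.prems(2) by simp
  have "ae (\<lambda>k. eval_v v (t k) (\<gamma> k) \<sigma> \<le> eval_v v (t k) (\<gamma> k) \<tau>)"
    by (rule le) (use eq in \<open>eventually_elim; simp\<close>)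
  moreover have "ae (\<lambda>k. eval_v v (t k) (\<gamma> k) \<tau> \<le> eval_v v (t k) (\<gamma> k) \<sigma>)"
    by (rule le) (use eq in \<open>eventually_elim; simp\<close>)
  ultimately have "ae (\<lambda>k. eval_v v (t k) (\<gamma> k) \<sigma> = eval_v v (t k) (\<gamma> k) \<tau>)" by eventually_elim simp
  then show ?case by simp
next
  case (VgNot \<phi>)
  have "ae (\<lambda>k. \<not> sat_vg v (s k) (\<beta> k) \<phi>)" using VgNot.prems(2) by simp
  then have "\<not> ae (\<lambda>k. sat_vg v (s k) (\<beta> k) \<phi>)" by (rule ae_not[THEN iffD1])
  then have "\<not> ae (\<lambda>k. sat_vg v (t k) (\<gamma> k) \<phi>)"
    using VgNot.IH[OF position_converse[OF VgNot.prems(1)]] by blast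
  then have "ae (\<lambda>k. \<not> sat_vg v (t k) (\<gamma> k) \<phi>)" by (rule ae_not[THEN iffD2])
  then show ?case by simp
next
  case (VgAnd \<phi> \<psi>)
  then show ?case by (simp add: eventually_conj_iff)
next
  case (ExG i \<phi>)
  have good: "good \<rho>" using ExG.prems(1) by (simp add: position_def)
  have "ae (\<lambda>k. \<exists>x. sat_vg v ((s k)(i := x)) (\<beta> k) \<phi>)" using ExG.prems(2) by simp
  then obtain u where u: "ae (\<lambda>k. sat_vg v ((s k)(i := u k)) (\<beta> k) \<phi>)"
    unfolding ae_ex by (elim exE)
  obtain w where "same_type \<rho> u w" using ex_same_type[OF good] by blast
  from extend[OF good this] obtain \<rho>' where \<rho>': "good \<rho>'" "\<rho> \<subseteq> \<rho>'" "represents \<rho>' u w" by blast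
  from ExG.IH[OF position_upd_group[OF ExG.prems(1) \<rho>'] u]
  have "\<exists>w. ae (\<lambda>k. sat_vg v ((t k)(i := w k)) (\<gamma> k) \<phi>)" by (rule exI[where x = w])
  then have "ae (\<lambda>k. \<exists>x. sat_vg v ((t k)(i := x)) (\<gamma> k) \<phi>)" unfolding ae_ex .
  then show ?case by simp
next
  case (ExV i \<phi>)
  have good: "good \<rho>" using ExV.prems(1) by (simp add: position_def)
  have "ae (\<lambda>k. \<exists>x. sat_vg v (s k) ((\<beta> k)(i := x)) \<phi>)" using ExV.prems(2) by simp
  then obtain \<delta> where \<delta>: "ae (\<lambda>k. sat_vg v (s k) ((\<beta> k)(i := \<delta> k)) \<phi>)"
    unfolding ae_ex by (elim exE)
  define u where "u k = inv v (\<delta> k)" for k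
  have u: "v (u k) = \<delta> k" for k using surj_v by (simp add: u_def surj_f_inv_f)
  obtain w where "same_type \<rho> u w" using ex_same_type[OF good] by blast
  from extend[OF good this] obtain \<rho>' where \<rho>': "good \<rho>'" "\<rho> \<subseteq> \<rho>'" "represents \<rho>' u w" by blast
  have "represents_value v \<rho>' \<delta> (\<lambda>k. v (w k))"
    using represents_imp_represents_value[OF \<rho>'(3), of v] by (simp add: u)
  from ExV.IH[OF position_upd_value[OF ExV.prems(1) \<rho>'(1,2) this] \<delta>]
  have "\<exists>w. ae (\<lambda>k. sat_vg v (t k) ((\<gamma> k)(i := w k)) \<phi>)" by (rule exI[where x = "\<lambda>k. v (w k)"])
  then have "ae (\<lambda>k. \<exists>x. sat_vg v (t k) ((\<gamma> k)(i := x)) \<phi>)" unfolding ae_ex .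
  then show ?case by simp
qed

end

definition diagonal :: "((nat \<Rightarrow> 'a) \<times> (nat \<Rightarrow> 'a)) set" where
  "diagonal = range (\<lambda>g. ((\<lambda>_. g), (\<lambda>_. g)))"

lemma good_diagonal: "good diagonal"
  unfolding good_def
proof (intro conjI allI impI)
  have "(UNIV :: 'a set) = (\<Union>n. {x. lev x \<le> n})" by auto
  moreover have "countable (\<Union>n. {x. lev x \<le> n})" using finite_lev by (intro countable_UN) (auto intro: countable_finite)
  ultimately have "countable (UNIV :: 'a set)" by metis
  then show "countable diagonal" unfolding diagonal_def by (rule countable_image)
next
  fix a a' c assume "(a, a') \<in> diagonal" "\<not> kills c"
  then obtain g z where "a = (\<lambda>_. g)" "a' = (\<lambda>_. g)" "zmul c z = g"
    unfolding diagonal_def kills_def using zmul_surj by blast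
  then show "\<exists>b b'. (b, b') \<in> diagonal \<and> (\<forall>k. a k = zmul c (b k)) \<and> (\<forall>k. a' k = zmul c (b' k))"
    unfolding diagonal_def by auto
qed (auto simp: diagonal_def)

text \<open>Subtracting a constant does not change a large level, and a level tending to infinity
  eventually exceeds every constant bound. So every inequality in the type is false on both
  sides.\<close>

lemma same_type_diagonal:
  assumes "\<And>k. k < lev (x k)" "\<And>k. k < lev (y k)"
  shows "same_type diagonal x y"
proof -
  have *: "\<not> ae (\<lambda>k. int (lev (z k - g)) + D \<le> int (lev h))" if z: "\<And>k. k < lev (z k)" for z g h D
  proof -
    have "ae (\<lambda>k. \<not> int (lev (z k - g)) + D \<le> int (lev h))"
      using ae_ge[of "max (lev g) (nat (int (lev h) - D))"]
    proof eventually_elim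
      case (elim k)
      then have "lev g < lev (z k)" using z[of k] by simp
      then have "lev (z k - g) = lev (z k)" by (rule lev_diff_eq')
      then show ?case using z[of k] elim by linarith
    qed
    then show ?thesis by (rule ae_not[THEN iffD1])
  qed
  show ?thesis unfolding same_type_def diagonal_def using *[OF assms(1)] *[OF assms(2)] by auto
qed

end

section \<open>Minimality of levelled groups\<close>

context leveled_group begin

lemma minimal_valued_group:
  fixes v :: "'a \<Rightarrow> 'g::{linorder, order_top}"
  assumes v_le_iff: "\<And>x y. v x \<le> v y \<longleftrightarrow> lev y \<le> lev x"
    and surj_v: "surj v" and v_zero: "v 0 = top"
  shows "minimal_valued_group v"
  unfolding minimal_valued_group_def minimal_wrt_def
proof (intro conjI allI impI)
  have "lev ` UNIV = UNIV" using lev_surj by (metis surjI surj_def)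
  then show "infinite (UNIV :: 'a set)" using infinite_UNIV_nat by (metis finite_imageI)
next
  fix A assume "vg_definable v A"
  then obtain \<phi> a b where A: "A = {x. sat_vg v (a(0 := x)) b \<phi>}" unfolding vg_definable_def by blast
  obtain U where "U \<le> sequentially" "U \<noteq> bot" "\<And>P. eventually P U \<or> eventually (\<lambda>k::nat. \<not> P k) U"
    using ex_ultrafilter[of sequentially] by auto
  then interpret leveled_group_ultra lev U by unfold_locales auto
  show "finite A \<or> finite (- A)"
  proof (rule ccontr)
    assume inf: "\<not> (finite A \<or> finite (- A))"
    \<comment> \<open>Balls being finite, every infinite set contains elements of arbitrarily large
      level; this supplies sequences in A and in its complement.\<close>
    have large: "\<exists>x\<in>B. k < lev x" if B: "infinite B" for B k
    proof (rule ccontr)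
      assume "\<not> ?thesis"
      then have "B \<subseteq> {x. lev x \<le> k}" by (auto simp: not_less)
      then show False using B finite_lev finite_subset by blast
    qed
    have "\<forall>k. \<exists>x. x \<in> A \<and> k < lev x" "\<forall>k. \<exists>x. x \<in> - A \<and> k < lev x" using large inf by blast+
    then obtain x y where x: "\<And>k. x k \<in> A" "\<And>k. k < lev (x k)" and y: "\<And>k. y k \<in> - A" "\<And>k. k < lev (y k)"
      by metis
    obtain \<rho> where \<rho>: "good \<rho>" "diagonal \<subseteq> \<rho>" "represents \<rho> x y"
      using extend[OF good_diagonal same_type_diagonal[OF x(2) y(2)]] by blast
    have const: "((\<lambda>_. g), (\<lambda>_. g)) \<in> \<rho>" for g using good_const[OF \<rho>(1)] .
    have "represents_value v \<rho> (\<lambda>_. b i) (\<lambda>_. b i)" for i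
    proof -
      obtain g where "b i = v g" using surj_v by blast
      then show ?thesis using represents_value_mem[OF const[of g], of v] by simp
    qed
    moreover have "represents \<rho> (\<lambda>k. (a(0 := x k)) i) (\<lambda>k. (a(0 := y k)) i)" for i
      using \<rho>(3) represents_mem[OF const[of "a i"]] by (cases "i = 0") simp_all
    ultimately have "position v \<rho> (\<lambda>k. a(0 := x k)) (\<lambda>k. a(0 := y k)) (\<lambda>_. b) (\<lambda>_. b)"
      using \<rho>(1) position_def[OF assms] by simp
    then have "ae (\<lambda>k. sat_vg v (a(0 := y k)) b \<phi>)"
      by (rule sat_transfer[OF assms]) (use x(1) A in simp)
    moreover have "\<not> sat_vg v (a(0 := y k)) b \<phi>" for k using y(1)[of k] A by simp
    ultimately show False using U_proper by (simp add: trivial_limit_def)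
  qed
qed

end

section \<open>Value sets of order type omega star\<close>

text \<open>By Bezout, m is invertible modulo p^k, which annihilates x.\<close>

lemma zmul_inverse_coprime:
  assumes "prime p" "\<not> p dvd m" "nmul (p ^ k) x = 0"
  shows "\<exists>u. zmul u (nmul m x) = x"
proof -
  have "coprime (int (p ^ k)) (int m)"
    unfolding coprime_int_iff using assms(1,2)
    by (intro coprime_power_left_iff[THEN iffD2] disjI1 prime_imp_coprime)
  then obtain a u where au: "a * int (p ^ k) + u * int m = 1" by (metis bezout_int coprime_imp_gcd_eq_1)
  have "x = zmul (a * int (p ^ k) + u * int m) x" by (simp only: au zmul.scale_one)
  also have "\<dots> = zmul a (zmul (int (p ^ k)) x) + zmul u (zmul (int m) x)"
    by (simp only: zmul.scale_left_distrib zmul.scale_scale)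
  finally show ?thesis
    using assms(3) by (intro exI[of _ u]) (simp only: zmul_int zmul.scale_zero_right add_0_left)
qed

locale omega_valued_group = valued_abelian_group v
  for v :: "'a::ab_group_add \<Rightarrow> 'g::{linorder, order_top}" +
  fixes h :: "nat \<Rightarrow> 'g"
  assumes bij_h: "bij h"
    and h_le_iff: "h i \<le> h j \<longleftrightarrow> j \<le> i"
    and finite_fibre: "finite (v -` {\<gamma>})"
begin

definition lev :: "'a \<Rightarrow> nat" where
  "lev x = inv h (v x)"

lemma h_lev: "h (lev x) = v x"
  using bij_h by (simp add: lev_def bij_is_surj surj_f_inv_f)

lemma h_eq_iff: "h i = h j \<longleftrightarrow> i = j"
  using bij_h by (auto dest: bij_is_inj injD)

lemma h_less_iff: "h i < h j \<longleftrightarrow> j < i"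
  by (simp add: less_le h_le_iff h_eq_iff) auto

lemma v_eq_h_iff: "v x = h n \<longleftrightarrow> lev x = n"
  by (metis h_eq_iff h_lev)

lemma h_le_v_iff: "h n \<le> v x \<longleftrightarrow> lev x \<le> n"
  by (metis h_le_iff h_lev)

lemma h_cases: "\<exists>n. \<gamma> = h n"
  using bij_h by (metis bij_pointE)

lemma h_0: "h 0 = top"
  using h_cases[of top] by (metis h_le_iff le0 top.extremum_uniqueI)

lemma v_le_iff: "v x \<le> v y \<longleftrightarrow> lev y \<le> lev x"
  by (metis h_le_iff h_lev)

lemma v_less_iff: "v x < v y \<longleftrightarrow> lev y < lev x"
  by (simp add: v_le_iff flip: not_le)

lemma lev_eq_0_iff: "lev x = 0 \<longleftrightarrow> x = 0"
  by (metis h_0 h_eq_iff h_lev v_eq_top_iff)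

lemma lev_diff: "lev (x - y) \<le> max (lev x) (lev y)"
  using v_diff[of x y] by (auto simp: min_def max_def v_le_iff split: if_splits)

lemma lev_zmul: "lev (zmul c x) \<le> lev x"
  using v_zmul[of x c] by (simp add: v_le_iff)

lemma lev_eq_if_zmul_inverse: "zmul u (zmul c x) = x \<Longrightarrow> lev (zmul c x) = lev x"
  by (metis lev_zmul le_antisym)

lemma lev_nmul: "lev (nmul n x) \<le> lev x"
  using v_nmul[of x n] by (simp add: v_le_iff)

lemma lev_nmul_coprime:
  assumes "prime p" "\<not> p dvd m" "nmul (p ^ k) x = 0"
  shows "lev (nmul m x) = lev x"
proof -
  obtain u where "zmul u (nmul m x) = x" using zmul_inverse_coprime[OF assms] by blast
  then have "lev x \<le> lev (nmul m x)" using lev_zmul[of u "nmul m x"] by simp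
  then show ?thesis using lev_nmul[of m x] by simp
qed

lemma lev_surj: "\<exists>x. lev x = n"
  using surj_v by (metis h_eq_iff h_lev surjD)

lemma finite_lev: "finite {x. lev x \<le> n}"
proof -
  have "{x. lev x \<le> n} = (\<Union>i\<in>{..n}. v -` {h i})"
    by (auto simp: v_eq_h_iff)
  then show ?thesis using finite_fibre by simp
qed

lemma finite_values: "finite A \<longleftrightarrow> (\<exists>N. \<forall>n>N. h n \<notin> A)"
proof -
  have "h ` {n. h n \<in> A} = A" using h_cases by (auto simp: image_iff) metis
  moreover have "finite (h ` {n. h n \<in> A}) \<longleftrightarrow> finite {n. h n \<in> A}"
    by (rule finite_image_iff) (rule inj_on_subset[OF bij_is_inj[OF bij_h] subset_UNIV])
  ultimately have "finite A \<longleftrightarrow> finite {n. h n \<in> A}" by (simp only:)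
  also have "\<dots> \<longleftrightarrow> (\<exists>N. \<forall>n>N. h n \<notin> A)"
    unfolding finite_nat_set_iff_bounded_le by (intro iff_exI) (use not_le in blast)
  finally show ?thesis .
qed

lemma separated_iff_R_rel:
  assumes "n > 0"
  shows "separated lev m n \<longleftrightarrow> R_rel v m (h n)"
proof -
  have "h n \<noteq> top" using assms h_0 h_eq_iff[of n 0] by simp
  then show ?thesis
    unfolding separated_def R_rel_iff by (simp add: h_le_v_iff v_eq_h_iff)
qed

lemma is_successor_iff: "is_successor (h i) (h j) \<longleftrightarrow> i = Suc j"
proof
  assume s: "is_successor (h i) (h j)"
  then have "j < i" by (simp add: is_successor_def h_less_iff)
  moreover have "\<not> (Suc j < i)"
    using s unfolding is_successor_def by (metis h_less_iff lessI)
  ultimately show "i = Suc j" by simp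
next
  assume "i = Suc j"
  then show "is_successor (h i) (h j)"
    unfolding is_successor_def using h_cases by (metis h_less_iff lessI not_less_eq)
qed

text \<open>The enumeration h is decreasing, so a right shift in \<Gamma> lowers levels.\<close>

lemma is_successor_pow_iff: "(is_successor ^^ l) (h i) (h j) \<longleftrightarrow> i = j + l"
proof (induction l arbitrary: j)
  case 0
  then show ?case by (simp add: h_eq_iff)
next
  case (Suc l)
  have "(is_successor ^^ Suc l) (h i) (h j) \<longleftrightarrow> (\<exists>m. (is_successor ^^ l) (h i) (h m) \<and> is_successor (h m) (h j))"
    by (simp add: relcompp_apply) (metis h_cases)
  then show ?case by (simp add: Suc is_successor_iff)
qed

text \<open>The set defined by R_m is finite or cofinite in \<Gamma>, which along the enumeration
  means eventually constant. The case m = 0 is separate because the language starts with R_1; a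
  single element is always a separated system.\<close>

lemma leveled_groupI:
  assumes min: "minimal_value_set v"
    and surj: "\<And>c y x. zmul c y \<noteq> (0::'a) \<Longrightarrow> \<exists>z. zmul c z = (x::'a)"
    and shift: "\<And>c y. zmul c y \<noteq> (0::'a) \<Longrightarrow> \<exists>d N. \<forall>x. N < lev x \<longrightarrow> lev (zmul c x) + d = lev x"
  shows "leveled_group lev"
proof
  fix m show "(\<exists>N. \<forall>n>N. separated lev m n) \<or> (\<exists>N. \<forall>n>N. \<not> separated lev m n)"
  proof (cases m)
    case 0
    have "separated lev 0 n" for n
    proof -
      obtain x where "lev x = n" using lev_surj by blast
      then show ?thesis unfolding separated_def by (intro exI[of _ "{x}"]) simp
    qed
    then show ?thesis using 0 by blast
  next
    case (Suc m')
    define A where "A = {\<gamma>. R_rel v m \<gamma>}"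
    have "lv_definable v A"
      unfolding lv_definable_def by (intro exI[of _ "LR m' (LVar 0)"]) (simp add: A_def Suc)
    then have "finite A \<or> finite (- A)"
      using min by (simp add: minimal_value_set_def minimal_wrt_def)
    then obtain N where "(\<forall>n>N. h n \<notin> A) \<or> (\<forall>n>N. h n \<in> A)"
      unfolding finite_values by auto
    moreover have "separated lev m n \<longleftrightarrow> h n \<in> A" if "n > N" for n
      using separated_iff_R_rel[of n m] that by (simp add: A_def)
    ultimately show ?thesis by blast
  qed
qed (fact lev_eq_0_iff lev_diff finite_lev lev_surj | rule surj shift; assumption)+

lemma minimal_if_leveled: "leveled_group lev \<Longrightarrow> minimal_valued_group v"
  by (rule leveled_group.minimal_valued_group[OF _ v_le_iff surj_v v_zero])

text \<open>An integer that does not annihilate G is invertible modulo q, so multiplication by it is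
  bijective and preserves levels: the shift is 0.\<close>

lemma minimal_if_elementary_abelian:
  assumes min: "minimal_value_set v" and el: "elementary_abelian TYPE('a)"
  shows "minimal_valued_group v"
proof (rule minimal_if_leveled, rule leveled_groupI[OF min])
  obtain q where q: "prime q" "\<And>x::'a. nmul q x = 0" using el unfolding elementary_abelian_def by blast
  have inverse: "\<exists>u. \<forall>x::'a. zmul u (zmul c x) = x" if c: "zmul c y \<noteq> (0::'a)" for c y
  proof -
    have "\<not> int q dvd c" using c zmul_eq_0_dvd[of "int q" y c] q(2)[of y] by (auto simp: zmul_int)
    then have "coprime (int q) c" using q(1) by (simp add: prime_imp_coprime)
    then obtain a u where au: "a * int q + u * c = 1" by (metis bezout_int coprime_imp_gcd_eq_1)
    have "zmul u (zmul c x) = x" for x :: 'a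
    proof -
      have "x = zmul (a * int q + u * c) x" by (simp add: au)
      also have "\<dots> = zmul a (zmul (int q) x) + zmul u (zmul c x)"
        by (simp only: zmul.scale_left_distrib zmul.scale_scale)
      also have "zmul (int q) x = 0" using q(2) by (simp add: zmul_int)
      finally show ?thesis by simp
    qed
    then show ?thesis by blast
  qed
  fix c and y :: 'a assume "zmul c y \<noteq> 0"
  then obtain u where u: "\<And>x::'a. zmul u (zmul c x) = x" using inverse by blast
  show "\<exists>z. zmul c z = x" for x :: 'a
    using u[of x] by (intro exI[of _ "zmul u x"]) (simp add: mult.commute)
  show "\<exists>d N. \<forall>x. N < lev x \<longrightarrow> lev (zmul c x) + d = lev x"
    using lev_eq_if_zmul_inverse[OF u] by (intro exI[of _ 0]) simp
qed

text \<open>Surjectivity with an eventual constant drop of levels is stable under composition. It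
  holds for p by the right shift, and for m prime to p since m acts invertibly on p-torsion; every
  positive n is a product of these.\<close>

lemma minimal_if_pruefer:
  assumes min: "minimal_value_set v" and p: "prime p"
    and G: "finite_product_of_pruefer p TYPE('a)" and ev: "eventually_right_shift_iso v p"
  shows "minimal_valued_group v"
proof (rule minimal_if_leveled, rule leveled_groupI[OF min])
  define ok where "ok n \<longleftrightarrow> (\<forall>x::'a. \<exists>z. nmul n z = x) \<and>
      (\<exists>d N. \<forall>x. N < lev x \<longrightarrow> lev (nmul n x) + d = lev x)" for n
  have ok_mult: "ok (m * n)" if m: "ok m" and n: "ok n" for m n
  proof -
    have "\<exists>z. nmul (m * n) z = x" for x :: 'a
    proof -
      obtain y where y: "nmul m y = x" using m unfolding ok_def by blast
      obtain z where "nmul n z = y" using n unfolding ok_def by blast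
      then show ?thesis using y by (intro exI[of _ z]) (simp add: nmul_mult)
    qed
    moreover obtain d N where 1: "\<And>x. N < lev x \<Longrightarrow> lev (nmul m x) + d = lev x" using m unfolding ok_def by blast
    obtain e M where 2: "\<And>x. M < lev x \<Longrightarrow> lev (nmul n x) + e = lev x" using n unfolding ok_def by blast
    \<comment> \<open>Beyond \<open>M + N + e\<close> the level of n x is still above N after the
      drop by e.\<close>
    have "lev (nmul (m * n) x) + (d + e) = lev x" if "M + N + e < lev x" for x
      using 2[of x] 1[of "nmul n x"] that by (simp add: nmul_mult)
    ultimately show ?thesis
      unfolding ok_def by (intro conjI allI exI[of _ "d + e"] exI[of _ "M + N + e"]) simp_all
  qed
  have ok_p: "ok p"
  proof -
    from ev obtain I l where fin: "finite (- I)" and def: "\<forall>\<gamma>\<in>I. f_defined_at v p \<gamma>"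
      and shift: "\<forall>\<gamma>\<in>I. (is_successor ^^ l) \<gamma> (f_fun v p \<gamma>)"
      unfolding eventually_right_shift_iso_def by (elim exE conjE)
    note I = fin def[rule_format] shift[rule_format]
    obtain N where N: "\<And>n. n > N \<Longrightarrow> h n \<in> I" using I(1) unfolding finite_values by blast
    have "lev (nmul p x) + l = lev x" if "N < lev x" for x
    proof -
      have "v x \<in> I" using N[OF that] by (simp add: h_lev)
      then have "(is_successor ^^ l) (v x) (v (nmul p x))"
        using I(3)[of "v x"] f_fun_eq[OF I(2)[of "v x"]] by simp
      then show ?thesis using is_successor_pow_iff[of l "lev x" "lev (nmul p x)"] by (simp add: h_lev)
    qed
    then show ?thesis
      unfolding ok_def
      by (intro conjI allI exI[of _ l] exI[of _ N] finite_product_of_prueferD(2)[OF p G]) simp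
  qed
  have ok_coprime: "ok m" if m: "\<not> p dvd m" for m
  proof -
    have inverse: "\<exists>u. zmul u (nmul m x) = x" for x :: 'a
      using finite_product_of_prueferD(1)[OF p G, of x] zmul_inverse_coprime[OF p m] by blast
    have "\<exists>z. nmul m z = x" for x :: 'a
    proof -
      obtain u where "zmul u (nmul m x) = x" using inverse by blast
      then have "nmul m (zmul u x) = x" by (simp add: mult.commute flip: zmul_int)
      then show ?thesis by blast
    qed
    moreover have "lev (nmul m x) = lev x" for x
      using finite_product_of_prueferD(1)[OF p G, of x] lev_nmul_coprime[OF p m] by blast
    then have "\<exists>d N. \<forall>x. N < lev x \<longrightarrow> lev (nmul m x) + d = lev x"
      by (intro exI[of _ 0]) simp
    ultimately show ?thesis unfolding ok_def by simp
  qed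
  have ok_pow: "ok (p ^ k * m)" if "\<not> p dvd m" for k m
    by (induction k) (use that in \<open>auto intro: ok_coprime ok_mult[OF ok_p] simp: mult.assoc\<close>)
  have ok: "ok n" if "n > 0" for n
  proof -
    obtain k m where "\<not> p dvd m" "n = m * p ^ k" using prime_power_canonical[OF p \<open>n > 0\<close>] by blast
    then show ?thesis using ok_pow by (simp add: mult.commute)
  qed
  fix c and y :: 'a assume "zmul c y \<noteq> 0"
  then have "c \<noteq> 0" by auto
  then have okc: "ok (nat \<bar>c\<bar>)" by (intro ok) simp
  have c: "zmul c x = (if c > 0 then nmul (nat \<bar>c\<bar>) x else - nmul (nat \<bar>c\<bar>) x)" for x :: 'a
    using \<open>c \<noteq> 0\<close> by (simp add: zmul_def)
  show "\<exists>z. zmul c z = x" for x :: 'a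
  proof -
    obtain z where z: "nmul (nat \<bar>c\<bar>) z = x" using okc unfolding ok_def by blast
    show ?thesis
      using z by (intro exI[of _ "if c > 0 then z else - z"]) (auto simp: c nmul_uminus abs_if)
  qed
  have "lev (zmul c x) = lev (nmul (nat \<bar>c\<bar>) x)" for x
    unfolding c by (simp add: lev_def)
  then show "\<exists>d N. \<forall>x. N < lev x \<longrightarrow> lev (zmul c x) + d = lev x" using okc unfolding ok_def by simp
qed

end

section \<open>Expressible relations\<close>

text \<open>Formulas are treated semantically, through predicates on assignments closed under the
  logical operations, so that they need not be written out.\<close>

definition expressible ::
    "('a::ab_group_add \<Rightarrow> 'g::{linorder, order_top}) \<Rightarrow> ((nat \<Rightarrow> 'a) \<Rightarrow> (nat \<Rightarrow> 'g) \<Rightarrow> bool) \<Rightarrow> bool" where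
  "expressible v P \<longleftrightarrow> (\<exists>\<phi>. \<forall>a b. sat_vg v a b \<phi> \<longleftrightarrow> P a b)"

definition group_expression :: "((nat \<Rightarrow> 'a::ab_group_add) \<Rightarrow> 'a) \<Rightarrow> bool" where
  "group_expression s \<longleftrightarrow> (\<exists>\<tau>. \<forall>a. eval_g a \<tau> = s a)"

definition value_expression ::
    "('a::ab_group_add \<Rightarrow> 'g::{linorder, order_top}) \<Rightarrow> ((nat \<Rightarrow> 'a) \<Rightarrow> (nat \<Rightarrow> 'g) \<Rightarrow> 'g) \<Rightarrow> bool" where
  "value_expression v s \<longleftrightarrow> (\<exists>\<tau>. \<forall>a b. eval_v v a b \<tau> = s a b)"

lemma group_expression_var: "group_expression (\<lambda>a. a i)"
  unfolding group_expression_def by (intro exI[of _ "GVar i"]) simp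

lemma group_expression_zero: "group_expression (\<lambda>a. 0)"
  unfolding group_expression_def by (intro exI[of _ GZero]) simp

lemma group_expression_add:
  assumes "group_expression s" "group_expression t"
  shows "group_expression (\<lambda>a. s a + t a)"
proof -
  obtain \<sigma> \<tau> where "\<forall>a. eval_g a \<sigma> = s a" "\<forall>a. eval_g a \<tau> = t a"
    using assms unfolding group_expression_def by blast
  then show ?thesis unfolding group_expression_def by (intro exI[of _ "GAdd \<sigma> \<tau>"]) simp
qed

lemma group_expression_nmul:
  assumes "group_expression s"
  shows "group_expression (\<lambda>a. nmul n (s a))"
  by (induction n) (simp_all add: nmul_Suc group_expression_zero group_expression_add assms)

lemma value_expression_var: "value_expression v (\<lambda>a b. b i)"
  unfolding value_expression_def by (intro exI[of _ "VVar i"]) simp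

lemma value_expression_top: "value_expression v (\<lambda>a b. top)"
  unfolding value_expression_def by (intro exI[of _ VInfty]) simp

lemma value_expression_val:
  assumes "group_expression s"
  shows "value_expression v (\<lambda>a b. v (s a))"
proof -
  obtain \<sigma> where "\<forall>a. eval_g a \<sigma> = s a" using assms unfolding group_expression_def by blast
  then show ?thesis unfolding value_expression_def by (intro exI[of _ "Val \<sigma>"]) simp
qed

lemma expressible_group_eq:
  assumes "group_expression s" "group_expression t"
  shows "expressible v (\<lambda>a b. s a = t a)"
proof -
  obtain \<sigma> \<tau> where "\<forall>a. eval_g a \<sigma> = s a" "\<forall>a. eval_g a \<tau> = t a"
    using assms unfolding group_expression_def by blast
  then show ?thesis unfolding expressible_def by (intro exI[of _ "GEq \<sigma> \<tau>"]) simp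
qed

lemma expressible_value_eq:
  assumes "value_expression v s" "value_expression v t"
  shows "expressible v (\<lambda>a b. s a b = t a b)"
proof -
  obtain \<sigma> \<tau> where "\<forall>a b. eval_v v a b \<sigma> = s a b" "\<forall>a b. eval_v v a b \<tau> = t a b"
    using assms unfolding value_expression_def by blast
  then show ?thesis unfolding expressible_def by (intro exI[of _ "VEq \<sigma> \<tau>"]) simp
qed

lemma expressible_value_le:
  assumes "value_expression v s" "value_expression v t"
  shows "expressible v (\<lambda>a b. s a b \<le> t a b)"
proof -
  obtain \<sigma> \<tau> where "\<forall>a b. eval_v v a b \<sigma> = s a b" "\<forall>a b. eval_v v a b \<tau> = t a b"
    using assms unfolding value_expression_def by blast
  then show ?thesis unfolding expressible_def by (intro exI[of _ "VLe \<sigma> \<tau>"]) simp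
qed

lemma expressible_not:
  assumes "expressible v P"
  shows "expressible v (\<lambda>a b. \<not> P a b)"
proof -
  obtain \<phi> where "\<forall>a b. sat_vg v a b \<phi> \<longleftrightarrow> P a b" using assms unfolding expressible_def by blast
  then show ?thesis unfolding expressible_def by (intro exI[of _ "VgNot \<phi>"]) simp
qed

lemma expressible_conj:
  assumes "expressible v P" "expressible v Q"
  shows "expressible v (\<lambda>a b. P a b \<and> Q a b)"
proof -
  obtain \<phi> \<psi> where "\<forall>a b. sat_vg v a b \<phi> \<longleftrightarrow> P a b" "\<forall>a b. sat_vg v a b \<psi> \<longleftrightarrow> Q a b"
    using assms unfolding expressible_def by blast
  then show ?thesis unfolding expressible_def by (intro exI[of _ "VgAnd \<phi> \<psi>"]) simp
qed

lemma expressible_ex_group: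
  assumes "expressible v P"
  shows "expressible v (\<lambda>a b. \<exists>x. P (a(i := x)) b)"
proof -
  obtain \<phi> where "\<forall>a b. sat_vg v a b \<phi> \<longleftrightarrow> P a b" using assms unfolding expressible_def by blast
  then show ?thesis unfolding expressible_def by (intro exI[of _ "ExG i \<phi>"]) simp
qed

lemma expressible_ex_value:
  assumes "expressible v P"
  shows "expressible v (\<lambda>a b. \<exists>\<gamma>. P a (b(i := \<gamma>)))"
proof -
  obtain \<phi> where "\<forall>a b. sat_vg v a b \<phi> \<longleftrightarrow> P a b" using assms unfolding expressible_def by blast
  then show ?thesis unfolding expressible_def by (intro exI[of _ "ExV i \<phi>"]) simp
qed

lemma expressible_imp:
  assumes "expressible v P" "expressible v Q"
  shows "expressible v (\<lambda>a b. P a b \<longrightarrow> Q a b)"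
  using expressible_not[OF expressible_conj[OF assms(1) expressible_not[OF assms(2)]]] by simp

lemma expressible_disj:
  assumes "expressible v P" "expressible v Q"
  shows "expressible v (\<lambda>a b. P a b \<or> Q a b)"
  using expressible_not[OF expressible_conj[OF expressible_not[OF assms(1)] expressible_not[OF assms(2)]]]
  by simp

lemma expressible_all_group:
  assumes "expressible v P"
  shows "expressible v (\<lambda>a b. \<forall>x. P (a(i := x)) b)"
  using expressible_not[OF expressible_ex_group[OF expressible_not[OF assms], of i]] by simp

lemma expressible_value_less:
  assumes "value_expression v s" "value_expression v t"
  shows "expressible v (\<lambda>a b. s a b < t a b)"
  using expressible_not[OF expressible_value_le[OF assms(2,1)]] by (simp add: not_le)

text \<open>The syntax has no truth constants; a tautology and its negation replace them.\<close>

lemma expressible_const: "expressible v (\<lambda>a b. c)"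
proof -
  have "expressible v (\<lambda>a b. top = b 0 \<or> \<not> top = b 0)" "expressible v (\<lambda>a b. \<not> (top = b 0 \<or> \<not> top = b 0))"
    by (intro expressible_disj expressible_not expressible_value_eq value_expression_var value_expression_top)+
  then show ?thesis by (cases c) simp_all
qed

lemma expressible_all_less:
  assumes "\<And>k::nat. expressible v (P k)"
  shows "expressible v (\<lambda>a b. \<forall>k<n. P k a b)"
proof (induction n)
  case 0
  then show ?case using expressible_const[of v True] by simp
next
  case (Suc n)
  have "expressible v (\<lambda>a b. P n a b \<and> (\<forall>k<n. P k a b))" by (rule expressible_conj[OF assms Suc])
  then show ?case by (simp add: All_less_Suc)
qed

text \<open>Binds the first n group variables at once; used to quantify over a system of
  representatives.\<close>

lemma expressible_ex_block:
  assumes "expressible v P"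
  shows "expressible v (\<lambda>a b. \<exists>xs. P (\<lambda>k. if k < n then xs k else a k) b)"
proof (induction n)
  case 0
  then show ?case using assms by simp
next
  case (Suc n)
  have eq: "(\<exists>xs. P (\<lambda>k. if k < Suc n then xs k else a k) b) \<longleftrightarrow>
      (\<exists>x xs. P (\<lambda>k. if k < n then xs k else (a(n := x)) k) b)" for a b
  proof
    assume "\<exists>xs. P (\<lambda>k. if k < Suc n then xs k else a k) b"
    then obtain xs where "P (\<lambda>k. if k < Suc n then xs k else a k) b" by blast
    moreover have "(\<lambda>k. if k < Suc n then xs k else a k) = (\<lambda>k. if k < n then xs k else (a(n := xs n)) k)"
      by (auto simp: fun_eq_iff less_Suc_eq)
    ultimately have "P (\<lambda>k. if k < n then xs k else (a(n := xs n)) k) b" by simp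
    then show "\<exists>x xs. P (\<lambda>k. if k < n then xs k else (a(n := x)) k) b" by blast
  next
    assume "\<exists>x xs. P (\<lambda>k. if k < n then xs k else (a(n := x)) k) b"
    then obtain x xs where "P (\<lambda>k. if k < n then xs k else (a(n := x)) k) b" by blast
    moreover have "(\<lambda>k. if k < n then xs k else (a(n := x)) k) =
        (\<lambda>k. if k < Suc n then (xs(n := x)) k else a k)"
      by (auto simp: fun_eq_iff less_Suc_eq)
    ultimately have "P (\<lambda>k. if k < Suc n then (xs(n := x)) k else a k) b" by simp
    then show "\<exists>xs. P (\<lambda>k. if k < Suc n then xs k else a k) b" by blast
  qed
  show ?case unfolding eq by (rule expressible_ex_group[OF Suc])
qed

lemmas expressible_intros =
  expressible_not expressible_conj expressible_imp expressible_disj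
  expressible_group_eq expressible_value_eq expressible_value_le expressible_value_less
  value_expression_var value_expression_top value_expression_val
  group_expression_var group_expression_zero group_expression_add group_expression_nmul

lemma minimal_valued_groupD:
  assumes "minimal_valued_group v" "expressible v P"
  shows "finite {x. P (a(0 := x)) b} \<or> finite {x. \<not> P (a(0 := x)) b}"
proof -
  obtain \<phi> where "\<forall>a b. sat_vg v a b \<phi> \<longleftrightarrow> P a b" using assms(2) unfolding expressible_def by blast
  then have "vg_definable v {x. P (a(0 := x)) b}"
    unfolding vg_definable_def by (intro exI[of _ \<phi>] exI[of _ a] exI[of _ b]) simp
  then have "finite {x. P (a(0 := x)) b} \<or> finite (- {x. P (a(0 := x)) b})"
    using assms(1)[unfolded minimal_valued_group_def minimal_wrt_def, THEN conjunct2] by simp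
  then show ?thesis by (simp only: Collect_neg_eq)
qed

text \<open>All function symbols are unary, so a term is a chain of functions applied to a single
  variable; \<open>lv_var\<close> and \<open>lv_fun\<close> separate the two.\<close>

primrec lv_var :: "lv_term \<Rightarrow> nat" where
  "lv_var (LVar i) = i"
| "lv_var (LF k t) = lv_var t"

primrec lv_fun :: "('a::ab_group_add \<Rightarrow> 'g::{linorder, order_top}) \<Rightarrow> lv_term \<Rightarrow> 'g \<Rightarrow> 'g" where
  "lv_fun v (LVar i) \<gamma> = \<gamma>"
| "lv_fun v (LF k t) \<gamma> = f_fun v (Suc k) (lv_fun v t \<gamma>)"

lemma eval_lv_eq: "eval_lv v b t = lv_fun v t (b (lv_var t))"
  by (induction t) simp_all

section \<open>Interpreting the structure on the value set inside the valued group\<close>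

context valued_abelian_group begin

text \<open>The graph of f_n in first-order form. The second disjunct is the default \<infinity>
  where f_n is not well defined.\<close>

lemma f_fun_eq_iff:
  "\<delta> = f_fun v n \<gamma> \<longleftrightarrow>
    ((\<exists>\<epsilon>. \<forall>x. v x = \<gamma> \<longrightarrow> v (nmul n x) = \<epsilon>) \<and> (\<forall>x. v x = \<gamma> \<longrightarrow> v (nmul n x) = \<delta>)) \<or>
    (\<not> (\<exists>\<epsilon>. \<forall>x. v x = \<gamma> \<longrightarrow> v (nmul n x) = \<epsilon>) \<and> \<delta> = top)"
proof (cases "f_defined_at v n \<gamma>")
  case True
  then obtain \<epsilon> where \<epsilon>: "\<forall>x. v x = \<gamma> \<longrightarrow> v (nmul n x) = \<epsilon>"
    unfolding f_defined_at_def by (elim exE)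
  obtain y where y: "v y = \<gamma>" using surjD[OF surj_v, of \<gamma>] by auto
  have "f_fun v n \<gamma> = \<epsilon>" using f_fun_eq[of n y] True y \<epsilon> by simp
  moreover have "(\<forall>x. v x = \<gamma> \<longrightarrow> v (nmul n x) = \<delta>) \<longleftrightarrow> \<delta> = \<epsilon>"
    using \<epsilon> y by metis
  ultimately have "\<delta> = f_fun v n \<gamma> \<longleftrightarrow> (\<forall>x. v x = \<gamma> \<longrightarrow> v (nmul n x) = \<delta>)" by simp
  then show ?thesis using True[unfolded f_defined_at_def] by (simp only: simp_thms)
next
  case False
  then have "\<not> (\<exists>\<epsilon>. \<forall>x. v x = \<gamma> \<longrightarrow> v (nmul n x) = \<epsilon>)" "f_fun v n \<gamma> = top"
    by (simp_all only: f_fun_def f_defined_at_def if_False not_False_eq_True)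
  then show ?thesis by (simp only: simp_thms)
qed

lemma expressible_f_fun:
  assumes "i \<noteq> j"
  shows "expressible v (\<lambda>a b. b j = f_fun v n (b i))"
proof -
  define l where "l = Suc (i + j)"
  define E where "E m a b = (\<forall>x. v x = b i \<longrightarrow> v (nmul n x) = b m)" for m and a :: "nat \<Rightarrow> 'a" and b :: "nat \<Rightarrow> 'g"
  have E: "expressible v (E m)" for m
  proof -
    have "expressible v (\<lambda>a b. v (a 0) = b i \<longrightarrow> v (nmul n (a 0)) = b m)" by (intro expressible_intros)
    from expressible_all_group[OF this, of 0] show ?thesis by (simp add: E_def[abs_def])
  qed
  have D: "expressible v (\<lambda>a b. \<exists>\<epsilon>. E l a (b(l := \<epsilon>)))" by (rule expressible_ex_value[OF E])
  have "expressible v (\<lambda>a b. ((\<exists>\<epsilon>. E l a (b(l := \<epsilon>))) \<and> E j a b) \<or> (\<not> (\<exists>\<epsilon>. E l a (b(l := \<epsilon>))) \<and> b j = top))"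
    by (intro expressible_intros D E)
  then show ?thesis unfolding f_fun_eq_iff by (simp add: E_def l_def)
qed

text \<open>The language has no subtraction, so a difference is named by a witness z. Indexed
  families can be quantified variable by variable; their entries are distinct automatically, since
  equal ones would differ by an element of value \<infinity>.\<close>

lemma R_rel_iff_family:
  "R_rel v m \<gamma> \<longleftrightarrow> \<gamma> \<noteq> top \<and>
    (\<exists>xs. (\<forall>k<Suc m. \<gamma> \<le> v (xs k)) \<and>
      (\<forall>k<Suc m. \<forall>l<Suc m. k \<noteq> l \<longrightarrow> (\<exists>z. xs k = z + xs l \<and> v z = \<gamma>)))"
proof (cases "\<gamma> = top")
  case False
  have diff: "(\<exists>z. x = z + y \<and> v z = \<gamma>) \<longleftrightarrow> v (x - y) = \<gamma>" for x y
    by (metis add_diff_cancel diff_add_cancel)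
  show ?thesis unfolding diff R_rel_iff
  proof (intro conj_cong refl iffI)
    assume "\<exists>X. finite X \<and> card X = Suc m \<and> (\<forall>x\<in>X. \<gamma> \<le> v x) \<and> (\<forall>x\<in>X. \<forall>y\<in>X. x \<noteq> y \<longrightarrow> v (x - y) = \<gamma>)"
    then obtain X where X: "finite X" "card X = Suc m" "\<forall>x\<in>X. \<gamma> \<le> v x"
      "\<forall>x\<in>X. \<forall>y\<in>X. x \<noteq> y \<longrightarrow> v (x - y) = \<gamma>" by blast
    obtain xs where "bij_betw xs {0..<card X} X" using ex_bij_betw_nat_finite[OF X(1)] by blast
    then have xs: "inj_on xs {0..<Suc m}" "\<And>k. k < Suc m \<Longrightarrow> xs k \<in> X" using X(2) by (auto simp: bij_betw_def)
    have "xs k \<noteq> xs l" if "k < Suc m" "l < Suc m" "k \<noteq> l" for k l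
      using inj_onD[OF xs(1), of k l] that by auto
    then show "\<exists>xs. (\<forall>k<Suc m. \<gamma> \<le> v (xs k)) \<and> (\<forall>k<Suc m. \<forall>l<Suc m. k \<noteq> l \<longrightarrow> v (xs k - xs l) = \<gamma>)"
      using xs(2) X(3,4) by (intro exI[of _ xs]) blast
  next
    assume "\<exists>xs. (\<forall>k<Suc m. \<gamma> \<le> v (xs k)) \<and> (\<forall>k<Suc m. \<forall>l<Suc m. k \<noteq> l \<longrightarrow> v (xs k - xs l) = \<gamma>)"
    then obtain xs where xs: "\<And>k. k < Suc m \<Longrightarrow> \<gamma> \<le> v (xs k)"
      "\<And>k l. k < Suc m \<Longrightarrow> l < Suc m \<Longrightarrow> k \<noteq> l \<Longrightarrow> v (xs k - xs l) = \<gamma>" by blast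
    have "inj_on xs {..<Suc m}"
    proof (rule inj_onI, rule ccontr)
      fix k l assume "k \<in> {..<Suc m}" "l \<in> {..<Suc m}" "xs k = xs l" "k \<noteq> l"
      then show False using xs(2)[of k l] False by simp
    qed
    then have "card (xs ` {..<Suc m}) = Suc m" by (simp add: card_image)
    moreover have "v (x - y) = \<gamma>" if "x \<in> xs ` {..<Suc m}" "y \<in> xs ` {..<Suc m}" "x \<noteq> y" for x y
      using that xs(2) by blast
    ultimately show "\<exists>X. finite X \<and> card X = Suc m \<and> (\<forall>x\<in>X. \<gamma> \<le> v x) \<and> (\<forall>x\<in>X. \<forall>y\<in>X. x \<noteq> y \<longrightarrow> v (x - y) = \<gamma>)"
      using xs(1) by (intro exI[of _ "xs ` {..<Suc m}"]) auto
  qed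
qed (simp add: R_rel_def)

lemma expressible_R_rel: "expressible v (\<lambda>a b. R_rel v m (b i))"
proof -
  define M where "M = Suc m"
  define apart where "apart k l a b = (\<exists>z. a k = z + a l \<and> v z = b i)"
    for k l and a :: "nat \<Rightarrow> 'a" and b :: "nat \<Rightarrow> 'g"
  have apart: "expressible v (apart k l)" for k l
  proof -
    define z where "z = Suc (k + l)"
    have "expressible v (\<lambda>a b. a k = a z + a l \<and> v (a z) = b i)" by (intro expressible_intros)
    from expressible_ex_group[OF this, of z] show ?thesis by (simp add: apart_def[abs_def] z_def)
  qed
  have "expressible v (\<lambda>a b. (\<forall>k<M. b i \<le> v (a k)) \<and> (\<forall>k<M. \<forall>l<M. k \<noteq> l \<longrightarrow> apart k l a b))"
    by (intro expressible_intros expressible_all_less expressible_const apart)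
  from expressible_ex_block[OF this, of M]
  have "expressible v (\<lambda>a b. b i \<noteq> top \<and> (\<exists>xs. (\<forall>k<M. b i \<le> v (xs k)) \<and>
      (\<forall>k<M. \<forall>l<M. k \<noteq> l \<longrightarrow> (\<exists>z. xs k = z + xs l \<and> v z = b i))))"
    by (intro expressible_intros) (simp add: apart_def cong: conj_cong imp_cong)
  then show ?thesis unfolding R_rel_iff_family M_def .
qed

text \<open>The functions f_n are available only through their graphs, so nested terms are unfolded
  with an intermediate value variable.\<close>

lemma expressible_lv_fun: "i \<noteq> j \<Longrightarrow> expressible v (\<lambda>a b. b j = lv_fun v t (b i))"
proof (induction t arbitrary: i j)
  case (LVar k)
  then show ?case by (simp add: expressible_intros)
next
  case (LF k t)
  define l where "l = Suc (i + j)"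
  have l: "l \<noteq> i" "l \<noteq> j" by (auto simp: l_def)
  have "expressible v (\<lambda>a b. b l = lv_fun v t (b i) \<and> b j = f_fun v (Suc k) (b l))"
    using l by (intro expressible_conj LF.IH expressible_f_fun) auto
  from expressible_ex_value[OF this, of l] show ?case using l by simp
qed

lemma expressible_sat_lv: "expressible v (\<lambda>a b. sat_lv v b \<phi>)"
proof (induction \<phi>)
  case (LEq s t)
  define i j where "i = Suc (lv_var s + lv_var t)" and "j = Suc i"
  have ij: "i \<noteq> lv_var s" "i \<noteq> lv_var t" "j \<noteq> lv_var s" "j \<noteq> lv_var t" "i \<noteq> j" by (auto simp: i_def j_def)
  have "expressible v (\<lambda>a b. (b i = lv_fun v s (b (lv_var s)) \<and> b j = lv_fun v t (b (lv_var t))) \<and> b i = b j)"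
    using ij by (intro expressible_intros expressible_lv_fun) auto
  from expressible_ex_value[OF expressible_ex_value[OF this, of j], of i]
  show ?case using ij by (simp add: eval_lv_eq)
next
  case (LLe s t)
  define i j where "i = Suc (lv_var s + lv_var t)" and "j = Suc i"
  have ij: "i \<noteq> lv_var s" "i \<noteq> lv_var t" "j \<noteq> lv_var s" "j \<noteq> lv_var t" "i \<noteq> j" by (auto simp: i_def j_def)
  have "expressible v (\<lambda>a b. (b i = lv_fun v s (b (lv_var s)) \<and> b j = lv_fun v t (b (lv_var t))) \<and> b i \<le> b j)"
    using ij by (intro expressible_intros expressible_lv_fun) auto
  from expressible_ex_value[OF expressible_ex_value[OF this, of j], of i]
  show ?case using ij by (simp add: eval_lv_eq)
next
  case (LR k t)
  define i where "i = Suc (lv_var t)"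
  have "expressible v (\<lambda>a b. b i = lv_fun v t (b (lv_var t)) \<and> R_rel v (Suc k) (b i))"
    by (intro expressible_conj expressible_lv_fun expressible_R_rel) (simp add: i_def)
  from expressible_ex_value[OF this, of i] show ?case by (simp add: eval_lv_eq i_def)
next
  case (LNot \<phi>)
  then show ?case by (simp add: expressible_not)
next
  case (LAnd \<phi> \<psi>)
  then show ?case by (simp add: expressible_conj)
next
  case (LEx i \<phi>)
  show ?case using expressible_ex_value[OF LEx.IH, of i] by (simp only: sat_lv.simps)
qed

text \<open>The preimage under v of a definable set of values is definable in G, and v maps it and
  its complement onto the given set and its complement.\<close>

lemma minimal_value_set_if_minimal:
  assumes min: "minimal_valued_group v" and inf: "infinite (UNIV :: 'g set)"
  shows "minimal_value_set v"
  unfolding minimal_value_set_def minimal_wrt_def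
proof (intro conjI allI impI inf)
  fix A assume "lv_definable v A"
  then obtain \<phi> b where A: "A = {\<gamma>. sat_lv v (b(0 := \<gamma>)) \<phi>}" unfolding lv_definable_def by blast
  have "expressible v (\<lambda>a b. b 0 = v (a 0) \<and> sat_lv v b \<phi>)"
    by (intro expressible_conj expressible_intros expressible_sat_lv)
  from minimal_valued_groupD[OF min expressible_ex_value[OF this, of 0],
      where a = "\<lambda>_. 0" and b = b]
  have "finite {x. v x \<in> A} \<or> finite {x. v x \<notin> A}" by (simp add: A)
  moreover have "v ` {x. v x \<in> A} = A" "v ` {x. v x \<notin> A} = - A"
    using surjD[OF surj_v] by (auto simp: image_iff) metis+
  ultimately show "finite A \<or> finite (- A)" by (metis finite_imageI)
qed

end

section \<open>Minimal valued groups\<close>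

text \<open>The rank of \<gamma> counts the elements above it. Passing to the next larger element
  lowers the rank by exactly one, so no rank is skipped.\<close>

lemma order_type_omega_starI:
  assumes inf: "infinite (UNIV :: 'g::linorder set)" and fin: "\<And>\<gamma>::'g. finite {\<delta>. \<gamma> \<le> \<delta>}"
  shows "order_type_omega_star TYPE('g)"
proof -
  define rank where "rank \<gamma> = card {\<delta>. \<gamma> < \<delta>}" for \<gamma> :: 'g
  have fin': "finite {\<delta>. \<gamma> < \<delta>}" for \<gamma> :: 'g by (rule finite_subset[OF _ fin[of \<gamma>]]) auto
  have less: "rank \<delta> < rank \<gamma>" if "\<gamma> < \<delta>" for \<gamma> \<delta>
    unfolding rank_def by (rule psubset_card_mono[OF fin']) (use that in auto)
  have le_iff: "rank \<gamma> \<le> rank \<delta> \<longleftrightarrow> \<delta> \<le> \<gamma>" for \<gamma> \<delta>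
    using less[of \<gamma> \<delta>] less[of \<delta> \<gamma>] by (cases \<gamma> \<delta> rule: linorder_cases) simp_all
  have inj: "inj rank"
  proof (rule injI)
    fix \<gamma> \<delta> assume "rank \<gamma> = rank \<delta>"
    then have "\<delta> \<le> \<gamma>" "\<gamma> \<le> \<delta>" using le_iff[of \<gamma> \<delta>] le_iff[of \<delta> \<gamma>] by simp_all
    then show "\<gamma> = \<delta>" by simp
  qed
  have down: "\<exists>\<delta>. rank \<delta> = m" if "m \<le> rank \<gamma>" for m \<gamma>
    using that
  proof (induction "rank \<gamma>" arbitrary: \<gamma>)
    case 0
    then show ?case by (intro exI[of _ \<gamma>]) simp
  next
    case (Suc n)
    have "card {\<delta>. \<gamma> < \<delta>} \<noteq> 0" using Suc.hyps(2) by (simp add: rank_def)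
    then have ne: "{\<delta>. \<gamma> < \<delta>} \<noteq> {}" by (metis card.empty)
    define \<mu> where "\<mu> = Min {\<delta>. \<gamma> < \<delta>}"
    have \<mu>: "\<gamma> < \<mu>" "\<And>\<delta>. \<gamma> < \<delta> \<Longrightarrow> \<mu> \<le> \<delta>"
      using Min_in[OF fin' ne] Min_le[OF fin'] by (auto simp: \<mu>_def)
    have "{\<delta>. \<mu> < \<delta>} = {\<delta>. \<gamma> < \<delta>} - {\<mu>}" using \<mu> by (auto simp: less_le)
    then have "rank \<mu> = n" using Suc.hyps(2) \<mu>(1) fin' by (simp add: rank_def)
    show ?case
    proof (cases "m = rank \<gamma>")
      case False
      then have "m \<le> rank \<mu>" using Suc.prems Suc.hyps(2) \<open>rank \<mu> = n\<close> by simp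
      then show ?thesis using Suc.hyps(1)[of \<mu>] \<open>rank \<mu> = n\<close> by simp
    qed auto
  qed
  have "infinite (range rank)" using inf inj finite_imageD by blast
  have "\<exists>\<delta>. rank \<delta> = m" for m
  proof -
    obtain \<gamma> where "m \<le> rank \<gamma>"
      using \<open>infinite (range rank)\<close> unfolding infinite_nat_iff_unbounded_le by blast
    then show ?thesis by (rule down)
  qed
  then have "surj rank" unfolding surj_def by metis
  with inj have bij: "bij rank" by (rule bijI)
  have h: "rank (inv rank i) = i" for i using bij by (simp add: bij_is_surj surj_f_inv_f)
  have "inv rank i \<le> inv rank j \<longleftrightarrow> j \<le> i" for i j using le_iff[of "inv rank j" "inv rank i"] by (simp add: h)
  then show ?thesis unfolding order_type_omega_star_def using bij_imp_bij_inv[OF bij] by blast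
qed

text \<open>A coset of H other than H lies in the finite complement, so H would be finite as
  well.\<close>

lemma cofinite_subgroup:
  fixes H :: "'a::ab_group_add set"
  assumes inf: "infinite (UNIV :: 'a set)" and diff: "\<And>x y. x \<in> H \<Longrightarrow> y \<in> H \<Longrightarrow> x - y \<in> H"
    and fin: "finite (- H)"
  shows "H = UNIV"
proof (rule ccontr)
  assume "H \<noteq> UNIV"
  then obtain g where g: "g \<notin> H" by blast
  have "(\<lambda>x. g + x) ` H \<subseteq> - H"
  proof clarify
    fix x assume "x \<in> H" "g + x \<in> H"
    then have "g + x - x \<in> H" using diff by blast
    then show False using g by simp
  qed
  then have "finite ((\<lambda>x. g + x) ` H)" using fin finite_subset by blast
  then have "finite H" by (rule finite_imageD) (simp add: inj_on_def)
  then have "finite (H \<union> - H)" using fin by blast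
  then show False using inf by simp
qed

text \<open>Split a prime off n = p m: either m already annihilates x, or m x is nonzero and
  annihilated by p.\<close>

lemma ex_prime_torsion:
  fixes x :: "'a::ab_group_add"
  assumes "n > 0" "nmul n x = 0" "x \<noteq> 0"
  shows "\<exists>p (y::'a). prime p \<and> p dvd n \<and> y \<noteq> 0 \<and> nmul p y = 0"
  using assms
proof (induction n arbitrary: x rule: less_induct)
  case (less n)
  have "n \<noteq> 1" using less.prems by auto
  then obtain p where p: "prime p" "p dvd n" using prime_factor_nat by blast
  then obtain m where m: "n = p * m" by (auto elim: dvdE)
  show ?case
  proof (cases "nmul m x = 0")
    case True
    have "m < n" "m > 0" using m less.prems(1) prime_gt_1_nat[OF p(1)] by auto
    from less.IH[OF this True less.prems(3)] obtain q and y :: 'a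
      where "prime q" "q dvd m" "y \<noteq> 0" "nmul q y = 0" by (elim exE conjE)
    then show ?thesis using m by (intro exI[of _ q] exI[of _ y]) simp
  next
    case False
    then show ?thesis using p less.prems(2) m
      by (intro exI[of _ p] exI[of _ "nmul m x"]) (simp add: nmul_mult)
  qed
qed

section \<open>Definable subgroups and torsion in a minimal valued group\<close>

locale minimal_group = valued_abelian_group v
  for v :: "'a::ab_group_add \<Rightarrow> 'g::{linorder, order_top}" +
  assumes minimal: "minimal_valued_group v" and infinite_values: "infinite (UNIV :: 'g set)"
begin

lemma infinite_group: "infinite (UNIV :: 'a set)"
  using minimal unfolding minimal_valued_group_def minimal_wrt_def by (rule conjunct1)

lemma subgroup_finite_or_UNIV:
  assumes "expressible v P" and H: "H = {x. P (a(0 := x)) b}"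
    and diff: "\<And>x y. x \<in> H \<Longrightarrow> y \<in> H \<Longrightarrow> x - y \<in> H"
  shows "finite H \<or> H = UNIV"
proof -
  have "finite H \<or> finite (- H)"
    using minimal_valued_groupD[OF minimal assms(1), where a = a and b = b] unfolding H by (simp only: Collect_neg_eq)
  then show ?thesis using cofinite_subgroup[OF infinite_group diff] by blast
qed

text \<open>An infinite closed ball would be all of G, making \<gamma> the least value. The open
  ball is then a proper definable subgroup, hence finite, so there would be only finitely many
  values.\<close>

lemma finite_ball: "finite {x. \<gamma> \<le> v x}"
proof (rule ccontr)
  assume inf: "infinite {x. \<gamma> \<le> v x}"
  have "expressible v (\<lambda>a b. b 0 \<le> v (a 0))" by (intro expressible_intros)
  moreover have "{x. \<gamma> \<le> v x} = {x. (\<lambda>_. \<gamma>) 0 \<le> v (((\<lambda>_. 0)(0 := x)) 0)}" by simp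
  ultimately have "finite {x. \<gamma> \<le> v x} \<or> {x. \<gamma> \<le> v x} = UNIV"
    by (rule subgroup_finite_or_UNIV) (auto intro: order_trans[OF _ v_diff])
  then have min: "\<gamma> \<le> v x" for x using inf by auto
  obtain x0 where x0: "v x0 = \<gamma>" using surj_v by (metis surjD)
  have "expressible v (\<lambda>a b. b 0 < v (a 0))" by (intro expressible_intros)
  moreover have "{x. \<gamma> < v x} = {x. (\<lambda>_. \<gamma>) 0 < v (((\<lambda>_. 0)(0 := x)) 0)}" by simp
  ultimately have "finite {x. \<gamma> < v x} \<or> {x. \<gamma> < v x} = UNIV"
    by (rule subgroup_finite_or_UNIV) (auto intro: less_le_trans[OF _ v_diff])
  then have "finite {x. \<gamma> < v x}" using x0 by auto
  moreover have "UNIV = insert \<gamma> (v ` {x. \<gamma> < v x})"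
    using min surjD[OF surj_v] by (auto simp: less_le image_iff)
  ultimately show False using infinite_values by (metis finite_imageI finite_insert)
qed

lemma finite_fibre: "finite (v -` {\<gamma>})"
  by (rule finite_subset[OF _ finite_ball[of \<gamma>]]) auto

lemma order_type: "order_type_omega_star TYPE('g)"
proof (rule order_type_omega_starI[OF infinite_values])
  fix \<gamma> :: 'g
  have "{\<delta>. \<gamma> \<le> \<delta>} = v ` {x. \<gamma> \<le> v x}" using surjD[OF surj_v] by (auto simp: image_iff) metis
  then show "finite {\<delta>. \<gamma> \<le> \<delta>}" using finite_ball by simp
qed

text \<open>The multiples of x lie in the finite ball of v x, so two of them coincide.\<close>

lemma torsion:
  fixes x :: 'a
  shows "\<exists>n>0. nmul n x = 0"
proof -
  have "range (\<lambda>n. nmul n x) \<subseteq> {y. v x \<le> v y}" using v_nmul by auto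
  then have "finite (range (\<lambda>n. nmul n x))" using finite_ball finite_subset by blast
  then have "\<not> inj (\<lambda>n. nmul n x)" using finite_imageD infinite_UNIV_nat by blast
  then obtain i j where ij: "nmul i x = nmul j x" "i \<noteq> j" by (auto simp: inj_on_def)
  have *: "\<exists>n>0. nmul n x = 0" if "nmul i x = nmul j x" "i < j" for i j
  proof -
    have "nmul j x = nmul (j - i) x + nmul i x" using that(2) by (simp flip: nmul_add_left)
    then show ?thesis using that by (intro exI[of _ "j - i"]) simp
  qed
  show ?thesis using ij *[of i j] *[of j i] by (cases "i < j") auto
qed

lemma finite_kernel_or_killed: "finite {x::'a. nmul n x = 0} \<or> (\<forall>x::'a. nmul n x = 0)"
proof -
  have "expressible v (\<lambda>a b. nmul n (a 0) = 0)" by (intro expressible_intros)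
  moreover have "{x::'a. nmul n x = 0} = {x. nmul n (((\<lambda>_. 0)(0 := x)) 0) = 0}" by simp
  ultimately have "finite {x::'a. nmul n x = 0} \<or> {x::'a. nmul n x = 0} = UNIV"
    by (rule subgroup_finite_or_UNIV) (auto simp: nmul_diff)
  then show ?thesis by auto
qed

text \<open>The image is a definable subgroup. It cannot be finite, for then G would be a finite
  union of finite fibres.\<close>

lemma divisible:
  fixes x :: 'a
  assumes ker: "finite {x::'a. nmul n x = 0}"
  shows "\<exists>y. nmul n y = x"
proof -
  let ?R = "{x::'a. \<exists>y. nmul n y = x}"
  have "expressible v (\<lambda>a b. nmul n (a (Suc 0)) = a 0)" by (intro expressible_intros)
  from expressible_ex_group[OF this, of "Suc 0"]
  have "expressible v (\<lambda>a b. \<exists>y. nmul n y = a 0)" by simp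
  moreover have "?R = {x. \<exists>y. nmul n y = ((\<lambda>_. 0)(0 := x)) 0}" by simp
  moreover have "u - w \<in> ?R" if "u \<in> ?R" "w \<in> ?R" for u w
  proof -
    from that obtain y z where "nmul n y = u" "nmul n z = w" by auto
    then have "nmul n (y - z) = u - w" by (simp add: nmul_diff)
    then show ?thesis by auto
  qed
  ultimately have R: "finite ?R \<or> ?R = UNIV" by (rule subgroup_finite_or_UNIV)
  have "infinite ?R"
  proof (rule notI)
    assume fin: "finite ?R"
    have "finite {y. nmul n y = z}" for z :: 'a
    proof (cases "\<exists>y. nmul n y = z")
      case True
      then obtain y0 where y0: "nmul n y0 = z" by blast
      have "{y. nmul n y = z} \<subseteq> (\<lambda>k. y0 + k) ` {x. nmul n x = 0}"
      proof
        fix y assume "y \<in> {y. nmul n y = z}"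
        then have "nmul n (y - y0) = 0" using y0 by (simp add: nmul_diff)
        then show "y \<in> (\<lambda>k. y0 + k) ` {x. nmul n x = 0}"
          by (intro image_eqI[of _ _ "y - y0"]) simp_all
      qed
      then show ?thesis by (rule finite_subset) (rule finite_imageI[OF ker])
    next
      case False
      then have "{y. nmul n y = z} = {}" by simp
      then show ?thesis by (simp only: finite.emptyI)
    qed
    with fin have "finite (\<Union>z\<in>?R. {y. nmul n y = z})" by (rule finite_UN_I)
    moreover have "(\<Union>z\<in>?R. {y. nmul n y = z}) = UNIV" by auto
    ultimately show False using infinite_group by simp
  qed
  with R have "x \<in> ?R" by simp
  then show ?thesis by simp
qed

text \<open>The n-power torsion T is infinite: multiplication by n maps T onto T, and on a finite
  set it would be injective, against y0. Since T meets infinitely many fibres, it remains to find in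
  each of its values other than \<infinity> an element on which n raises the value.\<close>

lemma cofinite_value_increasing:
  assumes ker: "finite {x::'a. nmul n x = 0}" and y0: "y0 \<noteq> 0" "nmul n y0 = (0::'a)"
  shows "finite {x. \<not> v x < v (nmul n x)}"
proof -
  let ?S = "{x. v x < v (nmul n x)}"
  define T where "T = {x::'a. \<exists>k. nmul (n ^ k) x = 0}"
  have infT: "infinite T"
  proof
    assume fin: "finite T"
    have "nmul n ` T = T"
    proof (intro equalityI subsetI)
      fix y assume "y \<in> nmul n ` T"
      then obtain x k where x: "y = nmul n x" "nmul (n ^ k) x = 0" by (auto simp: T_def)
      have "nmul (n ^ k) y = nmul n (nmul (n ^ k) x)" unfolding x(1) by (simp flip: nmul_mult add: mult.commute)
      then show "y \<in> T" using x(2) by (auto simp: T_def)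
    next
      fix y assume "y \<in> T"
      then obtain k where k: "nmul (n ^ k) y = 0" by (auto simp: T_def)
      obtain x where x: "nmul n x = y" using divisible[OF ker] by blast
      have "nmul (n ^ Suc k) x = nmul (n ^ k) (nmul n x)" by (simp flip: nmul_mult add: mult.commute)
      then have "nmul (n ^ Suc k) x = 0" using x k by simp
      then have "x \<in> T" unfolding T_def by blast
      then show "y \<in> nmul n ` T" using x by blast
    qed
    then have "inj_on (nmul n) T" using fin by (metis eq_card_imp_inj_on)
    moreover have "nmul (n ^ 0) 0 = (0::'a)" "nmul (n ^ 1) y0 = 0" using y0 by simp_all
    then have "0 \<in> T" "y0 \<in> T" unfolding T_def by blast+
    ultimately have "y0 = 0" using y0(2) by (metis inj_onD nmul_zero_right)
    then show False using y0(1) by simp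
  qed
  \<comment> \<open>The multiples of x by powers of n end at 0, so the value changes somewhere. The
    last multiple before the first change still has value v x and lies in the set.\<close>
  have "v ` (T - {0}) \<subseteq> v ` ?S"
  proof (rule image_subsetI)
    fix x assume "x \<in> T - {0}"
    then have x: "x \<in> T" "x \<noteq> 0" by simp_all
    from x(1) obtain k where "nmul (n ^ k) x = 0" by (auto simp: T_def)
    then have k: "v (nmul (n ^ k) x) \<noteq> v x" using x(2) by (metis v_zero v_eq_top_iff)
    define j where "j = (LEAST k. v (nmul (n ^ k) x) \<noteq> v x)"
    have j: "v (nmul (n ^ j) x) \<noteq> v x" unfolding j_def using k by (rule LeastI)
    then obtain i where i: "j = Suc i" by (cases j) simp_all
    have vi: "v (nmul (n ^ i) x) = v x"
      using not_less_Least[of i "\<lambda>k. v (nmul (n ^ k) x) \<noteq> v x"] i unfolding j_def by simp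
    have "nmul (n ^ j) x = nmul n (nmul (n ^ i) x)" by (simp add: i nmul_mult)
    then have "nmul (n ^ i) x \<in> ?S"
      using j vi v_nmul[of "nmul (n ^ i) x" n] by (simp add: less_le)
    with vi[symmetric] show "v x \<in> v ` ?S" by (rule image_eqI)
  qed
  moreover have "infinite (v ` (T - {0}))"
  proof
    assume "finite (v ` (T - {0}))"
    then have "finite (\<Union>\<gamma>\<in>v ` (T - {0}). v -` {\<gamma>})" using finite_fibre by (intro finite_UN_I)
    moreover have "T - {0} \<subseteq> (\<Union>\<gamma>\<in>v ` (T - {0}). v -` {\<gamma>})" by auto
    ultimately have "finite (T - {0})" by (rule finite_subset[rotated])
    then show False using infT by simp
  qed
  ultimately have inf: "infinite ?S" by (metis finite_imageI finite_subset)
  have "expressible v (\<lambda>a b. v (a 0) < v (nmul n (a 0)))" by (intro expressible_intros)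
  from minimal_valued_groupD[OF minimal this, where a = "\<lambda>_. 0"]
  have "finite ?S \<or> finite {x. \<not> v x < v (nmul n x)}" by simp
  with inf show ?thesis by (simp only: simp_thms)
qed

text \<open>Some z would have both v (p z) and v (q z) above v z, although z is an integer
  combination of p z and q z.\<close>

lemma unique_prime:
  assumes "prime p" "prime q" and fin: "finite {x::'a. nmul p x = 0}" "finite {x::'a. nmul q x = 0}"
    and x: "x \<noteq> 0" "nmul p x = (0::'a)" and y: "y \<noteq> 0" "nmul q y = (0::'a)"
  shows "p = q"
proof (rule ccontr)
  assume "p \<noteq> q"
  then have "coprime (int p) (int q)" using assms(1,2) by (simp add: primes_coprime)
  then obtain a b where ab: "a * int p + b * int q = 1" by (metis bezout_int coprime_imp_gcd_eq_1)
  have "finite ({x. \<not> v x < v (nmul p x)} \<union> {x. \<not> v x < v (nmul q x)})"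
    using cofinite_value_increasing[OF fin(1) x] cofinite_value_increasing[OF fin(2) y] by simp
  then obtain z where z: "v z < v (nmul p z)" "v z < v (nmul q z)"
    using infinite_group by (metis (mono_tags, lifting) UNIV_eq_I UnI1 UnI2 mem_Collect_eq)
  have "z = zmul (a * int p + b * int q) z" by (simp add: ab)
  also have "\<dots> = zmul a (nmul p z) + zmul b (nmul q z)"
    by (simp only: zmul.scale_left_distrib zmul.scale_scale flip: zmul_int)
  finally have "v z \<ge> min (v (zmul a (nmul p z))) (v (zmul b (nmul q z)))" using v_add by metis
  moreover have "v z < v (zmul a (nmul p z))" "v z < v (zmul b (nmul q z))"
    using z v_zmul less_le_trans by blast+
  ultimately show False by (simp add: min_le_iff_disj not_le[symmetric])
qed

text \<open>If all prime kernels are finite, fix a prime p with torsion. If n = m p^k with m prime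
  to p annihilates z but p^k does not, then a prime factor of m would have torsion too, against
  uniqueness.\<close>

lemma elementary_or_primary:
  "elementary_abelian TYPE('a) \<or>
    (\<exists>p. prime p \<and> finite {x::'a. nmul p x = 0} \<and> (\<forall>x::'a. \<exists>k. nmul (p ^ k) x = 0) \<and>
      (\<exists>x::'a. x \<noteq> 0 \<and> nmul p x = 0))"
proof (cases "\<exists>p. prime p \<and> infinite {x::'a. nmul p x = 0}")
  case True
  then show ?thesis unfolding elementary_abelian_def using finite_kernel_or_killed by blast
next
  case False
  then have fin: "finite {x::'a. nmul p x = 0}" if "prime p" for p using that by blast
  have "\<exists>x::'a. x \<noteq> 0"
  proof (rule ccontr)
    assume "\<not> ?thesis"
    then have "(UNIV :: 'a set) = {0}" by auto
    then show False using infinite_group by (metis finite.emptyI finite_insert)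
  qed
  then obtain x :: 'a where x: "x \<noteq> 0" by blast
  obtain n where n: "n > 0" "nmul n x = 0" using torsion by blast
  obtain p y where p: "prime p" "y \<noteq> 0" "nmul p y = (0::'a)" using ex_prime_torsion[OF n x] by blast
  have "\<exists>k. nmul (p ^ k) z = 0" for z :: 'a
  proof -
    obtain n where n: "n > 0" "nmul n z = 0" using torsion by blast
    obtain k m where m: "\<not> p dvd m" "n = m * p ^ k" using prime_power_canonical[OF p(1) n(1)] by blast
    have "nmul (p ^ k) z = 0"
    proof (rule ccontr)
      assume ne: "nmul (p ^ k) z \<noteq> 0"
      have "m > 0" using m n by (auto intro: Nat.gr0I)
      moreover have "nmul m (nmul (p ^ k) z) = 0" using n m by (simp add: nmul_mult)
      ultimately obtain q w where q: "prime q" "q dvd m" "w \<noteq> 0" "nmul q w = (0::'a)"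
        using ex_prime_torsion[OF _ _ ne] by blast
      have "p = q" by (rule unique_prime[OF p(1) q(1) fin[OF p(1)] fin[OF q(1)] p(2,3) q(3,4)])
      then show False using q(2) m(1) by simp
    qed
    then show ?thesis by blast
  qed
  then show ?thesis using p fin by blast
qed

end

section \<open>Multiplication far out in the value set\<close>

locale minimal_omega_group = omega_valued_group v h + minimal_group v
  for v :: "'a::ab_group_add \<Rightarrow> 'g::{linorder, order_top}" and h :: "nat \<Rightarrow> 'g"
begin

lemma finite_imp_bounded_lev:
  assumes "finite A"
  shows "\<exists>N. \<forall>x. N < lev x \<longrightarrow> x \<notin> A"
proof -
  have "finite (lev ` A)" using assms by simp
  then obtain N where "\<forall>n\<in>lev ` A. n \<le> N" unfolding finite_nat_set_iff_bounded_le by blast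
  then show ?thesis by (intro exI[of _ N]) auto
qed

text \<open>M collects the elements where v (n x) is least within the fibre of x. Fibres are finite,
  so each contains such an element and M is infinite, hence cofinite. Far out whole fibres lie in M,
  where the value of n x is constant.\<close>

lemma eventually_well_defined:
  "\<exists>N. \<forall>x y. N < lev x \<longrightarrow> lev y = lev x \<longrightarrow> lev (nmul n y) = lev (nmul n x)"
proof -
  define M where "M = {x. \<forall>y. v y = v x \<longrightarrow> v (nmul n x) \<le> v (nmul n y)}"
  have "expressible v (\<lambda>a b. v (a (Suc 0)) = v (a 0) \<longrightarrow> v (nmul n (a 0)) \<le> v (nmul n (a (Suc 0))))"
    by (intro expressible_intros)
  from minimal_valued_groupD[OF minimal expressible_all_group[OF this, of "Suc 0"], where a = "\<lambda>_. 0"]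
  have "finite M \<or> finite {x. x \<notin> M}" by (simp add: M_def)
  moreover have "infinite M"
  proof
    assume "finite M"
    have "\<gamma> \<in> v ` M" for \<gamma>
    proof -
      obtain x0 where "v x0 = \<gamma>" using surjD[OF surj_v, of \<gamma>] by auto
      then have "v -` {\<gamma>} \<noteq> {}" by auto
      with finite_fibre obtain x where x: "x \<in> v -` {\<gamma>}"
        and min: "Min ((\<lambda>y. v (nmul n y)) ` (v -` {\<gamma>})) = v (nmul n x)"
        by (rule obtains_MIN)
      have "v (nmul n x) \<le> v (nmul n y)" if "v y = v x" for y
        unfolding min[symmetric] using that x finite_fibre by (intro Min_le) auto
      then have "x \<in> M" by (simp add: M_def)
      then show ?thesis using x by auto
    qed
    then have "v ` M = UNIV" by blast
    then show False using \<open>finite M\<close> infinite_values by (metis finite_imageI)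
  qed
  ultimately have "finite {x. x \<notin> M}" by simp
  from finite_imp_bounded_lev[OF this] obtain N where N: "\<And>x. N < lev x \<Longrightarrow> x \<in> M" by auto
  have "lev (nmul n y) \<le> lev (nmul n x)" if "N < lev x" "lev y = lev x" for x y
  proof -
    have "v y = v x" using that(2) h_lev by metis
    then show ?thesis using N[OF that(1)] by (simp add: M_def v_le_iff)
  qed
  then show ?thesis by (metis le_antisym)
qed

text \<open>The definable set W must be shown infinite. If its levels were bounded by N, let B bound
  the image levels up to N and take x of least level whose image exceeds B, which exists by
  divisibility. Then x lies in W at a level above N.\<close>

lemma eventually_strict_mono:
  assumes div: "\<And>x::'a. \<exists>y. nmul n y = x"
  shows "\<exists>N. \<forall>x y. N < lev x \<longrightarrow> lev y < lev x \<longrightarrow> lev (nmul n y) < lev (nmul n x)"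
proof -
  define W where "W = {x. \<forall>y. v x < v y \<longrightarrow> v (nmul n x) < v (nmul n y)}"
  have "expressible v (\<lambda>a b. v (a 0) < v (a (Suc 0)) \<longrightarrow> v (nmul n (a 0)) < v (nmul n (a (Suc 0))))"
    by (intro expressible_intros)
  from minimal_valued_groupD[OF minimal expressible_all_group[OF this, of "Suc 0"], where a = "\<lambda>_. 0"]
  have "finite W \<or> finite {x. x \<notin> W}" by (simp add: W_def)
  moreover have "infinite W"
  proof
    assume "finite W"
    from finite_imp_bounded_lev[OF this] obtain N where N: "\<And>x. N < lev x \<Longrightarrow> x \<notin> W" by auto
    have "finite ((\<lambda>y. lev (nmul n y)) ` {y. lev y \<le> N})" using finite_lev by simp
    then obtain B where B: "\<And>y. lev y \<le> N \<Longrightarrow> lev (nmul n y) \<le> B"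
      unfolding finite_nat_set_iff_bounded_le by auto
    define P where "P k \<longleftrightarrow> (\<exists>x. lev x = k \<and> B < lev (nmul n x))" for k
    obtain z where "lev z = Suc B" using lev_surj by blast
    then obtain x0 where "lev (nmul n x0) = Suc B" using div by metis
    then have "P (lev x0)" by (auto simp: P_def)
    then have "P (Least P)" by (rule LeastI)
    then obtain x where x: "lev x = Least P" "B < lev (nmul n x)" by (auto simp: P_def)
    have least: "lev (nmul n y) \<le> B" if "lev y < lev x" for y
    proof -
      have "\<not> P (lev y)" using that x(1) by (intro not_less_Least) simp
      then show ?thesis by (auto simp: P_def not_less)
    qed
    have "N < lev x" using B[of x] x(2) by linarith
    moreover have "x \<in> W" using least x(2) by (auto simp: W_def v_less_iff intro: le_less_trans)
    ultimately show False using N by blast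
  qed
  ultimately have "finite {x. x \<notin> W}" by simp
  from finite_imp_bounded_lev[OF this] obtain N where N: "\<And>x. N < lev x \<Longrightarrow> x \<in> W" by auto
  then have "\<forall>x y. N < lev x \<longrightarrow> lev y < lev x \<longrightarrow> lev (nmul n y) < lev (nmul n x)"
    by (simp add: W_def v_less_iff)
  then show ?thesis by blast
qed

text \<open>Far out, multiplication by \<open>p\<close> is strictly monotone on levels, so the drop in level is
  nonincreasing; being positive, it is eventually constant.\<close>

lemma eventually_shift:
  assumes ker: "finite {x::'a. nmul p x = 0}" and x0: "x0 \<noteq> 0" "nmul p x0 = (0::'a)"
  obtains l N where "l \<ge> 1" "\<And>x. N \<le> lev x \<Longrightarrow> lev (nmul p x) + l = lev x"
proof -
  obtain N0 where N0: "\<And>x y. N0 < lev x \<Longrightarrow> lev y = lev x \<Longrightarrow> lev (nmul p y) = lev (nmul p x)"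
    using eventually_well_defined by blast
  obtain N1 where N1: "\<And>x y. N1 < lev x \<Longrightarrow> lev y < lev x \<Longrightarrow> lev (nmul p y) < lev (nmul p x)"
    using eventually_strict_mono[OF divisible[OF ker]] by blast
  obtain N2 where N2: "\<And>x. N2 < lev x \<Longrightarrow> lev (nmul p x) < lev x"
    using finite_imp_bounded_lev[OF cofinite_value_increasing[OF ker x0]] by (auto simp: v_less_iff)
  define N where "N = Suc (max N0 (max N1 N2))"
  obtain s where s: "\<And>n. lev (s n) = n" using lev_surj by metis
  define g where "g n = lev (nmul p (s n))" for n
  have g: "lev (nmul p x) = g (lev x)" if "N \<le> lev x" for x
    using N0[of x "s (lev x)"] that by (simp add: g_def s N_def)
  have g_less: "g n < n" if "N \<le> n" for n
    using N2[of "s n"] that by (simp add: g_def s N_def)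
  have g_mono: "g n < g (Suc n)" if "N \<le> n" for n
    using N1[of "s (Suc n)" "s n"] that by (simp add: g_def s N_def)
  have "\<exists>m\<ge>N. \<forall>n\<ge>N. m - g m \<le> n - g n"
    using ex_has_least_nat[of "\<lambda>n. N \<le> n" N "\<lambda>n. n - g n"] by auto
  then obtain m where m: "N \<le> m" "\<And>n. N \<le> n \<Longrightarrow> m - g m \<le> n - g n" by blast
  have const: "n - g n = m - g m" if "m \<le> n" for n
    using that
  proof (induction n rule: dec_induct)
    case (step n)
    have "Suc n - g (Suc n) \<le> n - g n" using g_mono[of n] g_less[of n] m(1) step.hyps by simp
    moreover have "m - g m \<le> Suc n - g (Suc n)" using m step.hyps by simp
    ultimately show ?case using step.IH by simp
  qed simp
  show ?thesis
  proof (rule that)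
    show "m - g m \<ge> 1" using g_less[OF m(1)] by simp
    show "lev (nmul p x) + (m - g m) = lev x" if "m \<le> lev x" for x
    proof -
      have "N \<le> lev x" using that m(1) by simp
      then show ?thesis using g[of x] g_less[of "lev x"] const[OF that] by simp
    qed
  qed
qed

text \<open>Level 0 is excluded because the value \<infinity> also serves as the default where f_n
  is undefined.\<close>

lemma f_fun_h_eq_iff:
  assumes "j > 0"
  shows "f_fun v n (h i) = h j \<longleftrightarrow> (\<forall>x. lev x = i \<longrightarrow> lev (nmul n x) = j)"
proof -
  have "h j \<noteq> top" using assms h_0 h_eq_iff[of j 0] by simp
  moreover have "(\<forall>x. v x = h i \<longrightarrow> v (nmul n x) = h j) \<longleftrightarrow> (\<forall>x. lev x = i \<longrightarrow> lev (nmul n x) = j)"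
    by (simp add: v_eq_h_iff)
  ultimately show ?thesis
    using f_fun_eq_iff[of "h j" n "h i"] by (auto simp: eq_commute[of "f_fun v n (h i)"])
qed

text \<open>Far out, p subtracts l from levels. Separated systems are carried down by p and lifted
  back by division, which gives the relations R_m. For n = m p^k with m prime to p, f_n shifts by k
  l and so commutes with the shift by l.\<close>

lemma eventually_right_shift_isoI:
  assumes p: "prime p" and ker: "finite {x::'a. nmul p x = 0}"
    and x0: "x0 \<noteq> 0" "nmul p x0 = (0::'a)"
    and primary: "\<And>x::'a. \<exists>k. nmul (p ^ k) x = 0"
  shows "eventually_right_shift_iso v p"
proof -
  obtain l N where l: "l \<ge> 1" and shift: "\<And>x. N \<le> lev x \<Longrightarrow> lev (nmul p x) + l = lev x"
    using eventually_shift[OF ker x0] by blast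
  have shift_iff: "lev (nmul p x) = c \<longleftrightarrow> lev x = c + l" if "N \<le> c" for c x
    using shift[of x] lev_nmul[of p x] that by (cases "N \<le> lev x") auto
  have pow_iff: "lev (nmul (p ^ k) x) = c \<longleftrightarrow> lev x = c + k * l" if "N \<le> c" for k c x
    using that
  proof (induction k arbitrary: c)
    case (Suc k)
    have "nmul (p ^ Suc k) x = nmul p (nmul (p ^ k) x)" by (simp add: nmul_mult)
    then have "lev (nmul (p ^ Suc k) x) = c \<longleftrightarrow> lev (nmul (p ^ k) x) = c + l"
      using shift_iff[OF Suc.prems] by simp
    also have "\<dots> \<longleftrightarrow> lev x = c + l + k * l" using Suc.prems by (intro Suc.IH) simp
    finally show ?case by (simp add: algebra_simps)
  qed simp
  \<comment> \<open>Starting above \<open>N + l\<close> keeps the shifted levels above N, where the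
    shift law still holds.\<close>
  define I where "I = h ` {n. N + l < n}"
  have I_iff: "h n \<in> I \<longleftrightarrow> N + l < n" for n unfolding I_def by (auto simp: h_eq_iff)
  have shift_at: "lev (nmul p x) = n - l" if "lev x = n" "N + l < n" for x n
    using shift[of x] that by simp
  have f: "f_fun v p (h n) = h (n - l)" if "N + l < n" for n
    using that shift_at by (simp add: f_fun_h_eq_iff)
  have R: "R_rel v m (h n) \<longleftrightarrow> R_rel v m (h (n - l))" if n: "N + l < n" for m n
  proof -
    have "separated lev m n \<longleftrightarrow> separated lev m (n - l)"
    proof
      assume "separated lev m n"
      then obtain X where X: "finite X" "card X = Suc m" "\<And>x. x \<in> X \<Longrightarrow> lev x \<le> n"
        "\<And>x y. x \<in> X \<Longrightarrow> y \<in> X \<Longrightarrow> x \<noteq> y \<Longrightarrow> lev (x - y) = n" unfolding separated_def by blast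
      have diff: "lev (nmul p x - nmul p y) = n - l" if "x \<in> X" "y \<in> X" "x \<noteq> y" for x y
        using shift_at[OF X(4)[OF that] n] by (simp add: nmul_diff)
      have "inj_on (nmul p) X"
      proof (rule inj_onI, rule ccontr)
        fix x y assume xy: "x \<in> X" "y \<in> X" "nmul p x = nmul p y" "x \<noteq> y"
        then show False using diff[OF xy(1,2,4)] n lev_eq_0_iff[of 0] by simp
      qed
      then have "card (nmul p ` X) = Suc m" using X(2) by (simp add: card_image)
      moreover have "lev (nmul p x) \<le> n - l" if "x \<in> X" for x
        using shift[of x] lev_nmul[of p x] X(3)[OF that] n by (cases "N \<le> lev x") auto
      ultimately show "separated lev m (n - l)"
        unfolding separated_def using X(1) diff by (intro exI[of _ "nmul p ` X"]) auto
    next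
      assume "separated lev m (n - l)"
      then obtain Y where Y: "finite Y" "card Y = Suc m" "\<And>x. x \<in> Y \<Longrightarrow> lev x \<le> n - l"
        "\<And>x y. x \<in> Y \<Longrightarrow> y \<in> Y \<Longrightarrow> x \<noteq> y \<Longrightarrow> lev (x - y) = n - l" unfolding separated_def by blast
      obtain s where s: "\<And>y::'a. nmul p (s y) = y" using divisible[OF ker] by metis
      have "inj s" by (rule injI) (metis s)
      then have "card (s ` Y) = Suc m" using Y(2) by (simp add: card_image inj_on_subset)
      moreover have "lev (s y) \<le> n" if "y \<in> Y" for y
        using shift[of "s y"] s[of y] Y(3)[OF that] n by (cases "N \<le> lev (s y)") auto
      moreover have "lev (s x - s y) = n" if "x \<in> Y" "y \<in> Y" "x \<noteq> y" for x y
      proof -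
        have "lev (nmul p (s x - s y)) = n - l" using Y(4)[OF that] by (simp add: nmul_diff s)
        then show ?thesis using shift_iff[of "n - l"] n by simp
      qed
      ultimately show "separated lev m n"
        unfolding separated_def using Y(1) by (intro exI[of _ "s ` Y"]) auto
    qed
    then show ?thesis using n by (simp add: separated_iff_R_rel)
  qed
  have F: "f_fun v n (h i) = h j \<longleftrightarrow> f_fun v n (h (i - l)) = h (j - l)"
    if n: "n \<ge> 1" and i: "N + l < i" and j: "N + l < j" for n i j
  proof -
    obtain k m where m: "\<not> p dvd m" "n = m * p ^ k" using prime_power_canonical[OF p, of n] n by auto
    have lev_n: "lev (nmul n x) = lev (nmul (p ^ k) x)" for x
    proof -
      obtain e where "nmul (p ^ e) (nmul (p ^ k) x) = 0" using primary by blast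
      then show ?thesis using lev_nmul_coprime[OF p m(1)] by (simp add: m(2) nmul_mult)
    qed
    \<comment> \<open>This condition depends only on the difference of the two levels, so it is
      unchanged when l is subtracted from both.\<close>
    have *: "f_fun v n (h a) = h c \<longleftrightarrow> a = c + k * l" if "N \<le> c" "c > 0" for a c
    proof -
      have "f_fun v n (h a) = h c \<longleftrightarrow> (\<forall>x. lev x = a \<longrightarrow> lev x = c + k * l)"
        using that by (simp add: f_fun_h_eq_iff lev_n pow_iff)
      also have "\<dots> \<longleftrightarrow> a = c + k * l" using lev_surj[of a] by auto
      finally show ?thesis .
    qed
    show ?thesis using *[of j i] *[of "j - l" "i - l"] i j by auto
  qed
  show ?thesis
    unfolding eventually_right_shift_iso_def lv_iso_onto_image_def
  proof (intro exI[of _ I] conjI ballI allI impI)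
    fix \<gamma> \<delta> assume "\<gamma> \<in> I" "\<delta> \<le> \<gamma>"
    then obtain n m where "\<gamma> = h n" "N + l < n" "\<delta> = h m" unfolding I_def using h_cases by blast
    then show "\<delta> \<in> I" using \<open>\<delta> \<le> \<gamma>\<close> by (simp add: I_iff h_le_iff)
  next
    show "finite (- I)" unfolding finite_values by (intro exI[of _ "N + l"]) (simp add: I_iff)
  next
    fix \<gamma> assume "\<gamma> \<in> I"
    then obtain n where n: "\<gamma> = h n" "N + l < n" unfolding I_def by blast
    then show "f_defined_at v p \<gamma>"
      unfolding f_defined_at_def by (intro exI[of _ "h (n - l)"]) (simp add: v_eq_h_iff shift_at)
  next
    show "\<exists>l\<ge>1. \<forall>\<gamma>\<in>I. (is_successor ^^ l) \<gamma> (f_fun v p \<gamma>)"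
      using l by (intro exI[of _ l]) (auto simp: I_def f is_successor_pow_iff)
  next
    show "inj_on (f_fun v p) I" by (rule inj_onI) (auto simp: I_def f h_eq_iff)
  next
    fix \<gamma> \<delta> assume "\<gamma> \<in> I" "\<delta> \<in> I"
    then show "\<gamma> \<le> \<delta> \<longleftrightarrow> f_fun v p \<gamma> \<le> f_fun v p \<delta>" by (auto simp: I_def f h_le_iff)
  next
    fix m :: nat and \<gamma> assume "1 \<le> m" "\<gamma> \<in> I"
    then show "R_rel v m \<gamma> \<longleftrightarrow> R_rel v m (f_fun v p \<gamma>)" using R by (auto simp: I_def f)
  next
    fix n :: nat and \<gamma> \<delta> assume n: "1 \<le> n" "\<gamma> \<in> I" "\<delta> \<in> I"
    then obtain i j where ij: "\<gamma> = h i" "N + l < i" "\<delta> = h j" "N + l < j" unfolding I_def by blast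
    then show "f_fun v n \<gamma> = \<delta> \<longleftrightarrow> f_fun v n (f_fun v p \<gamma>) = f_fun v p \<delta>"
      using F[OF n(1) ij(2,4)] by (simp add: f)
  qed
qed

end

theorem theorem4:
  fixes v :: "'a::ab_group_add \<Rightarrow> 'g::{linorder, order_top}"
  assumes "valued_abelian_group v"
    and "infinite (UNIV :: 'g set)"
  shows "minimal_valued_group v \<longleftrightarrow>
    minimal_value_set v \<and>
    order_type_omega_star TYPE('g) \<and>
    (\<forall>\<gamma>. finite (v -` {\<gamma>})) \<and>
    (elementary_abelian TYPE('a) \<or>
      (\<exists>p. prime p \<and> finite_product_of_pruefer p TYPE('a) \<and> eventually_right_shift_iso v p))"
proof
  interpret valued_abelian_group v by fact
  assume min: "minimal_valued_group v"
  then interpret minimal_group v using assms(2) by unfold_locales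
  obtain h :: "nat \<Rightarrow> 'g" where h: "bij h" "\<And>i j. h i \<le> h j \<longleftrightarrow> j \<le> i"
    using order_type unfolding order_type_omega_star_def by blast
  then interpret minimal_omega_group v h using finite_fibre by unfold_locales
  have group: "elementary_abelian TYPE('a) \<or>
      (\<exists>p. prime p \<and> finite_product_of_pruefer p TYPE('a) \<and> eventually_right_shift_iso v p)"
    using elementary_or_primary
  proof (elim disjE exE conjE)
    fix p and x0 :: 'a
    assume p: "prime p" "finite {x::'a. nmul p x = 0}" "\<forall>x::'a. \<exists>k. nmul (p ^ k) x = 0"
      and x0: "x0 \<noteq> 0" "nmul p x0 = 0"
    have "finite_product_of_pruefer p TYPE('a)"
      using p by (intro finite_product_of_prueferI divisible) auto
    moreover have "eventually_right_shift_iso v p"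
      using p x0 by (intro eventually_right_shift_isoI) auto
    ultimately show ?thesis using p(1) by blast
  qed simp
  then show "minimal_value_set v \<and>
    order_type_omega_star TYPE('g) \<and>
    (\<forall>\<gamma>. finite (v -` {\<gamma>})) \<and>
    (elementary_abelian TYPE('a) \<or>
      (\<exists>p. prime p \<and> finite_product_of_pruefer p TYPE('a) \<and> eventually_right_shift_iso v p))"
    using minimal_value_set_if_minimal[OF min assms(2)] order_type finite_fibre by blast
next
  assume *: "minimal_value_set v \<and>
    order_type_omega_star TYPE('g) \<and>
    (\<forall>\<gamma>. finite (v -` {\<gamma>})) \<and>
    (elementary_abelian TYPE('a) \<or>
      (\<exists>p. prime p \<and> finite_product_of_pruefer p TYPE('a) \<and> eventually_right_shift_iso v p))"
  interpret valued_abelian_group v by fact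
  obtain h :: "nat \<Rightarrow> 'g" where h: "bij h" "\<And>i j. h i \<le> h j \<longleftrightarrow> j \<le> i"
    using * unfolding order_type_omega_star_def by blast
  then interpret omega_valued_group v h using * by unfold_locales auto
  show "minimal_valued_group v"
    using * minimal_if_elementary_abelian minimal_if_pruefer by blast
qed

end
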